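(* Let $N\ge2$, $T=\{x\in\mathbb{R}^N:1<|x|<2\}$, $2<p<2^*$ ($2^*=\frac{2N}{N-2}$ if $N\ge3$, $+\infty$ if $N=2$), and for $\lambda>0$ let $u_\lambda$ be the unique positive solution in $H^1_{0,rad}(T)$ of $-\Delta u+\lambda u=u^{p-1}$ in $T$, $u=0$ on $\partial T$. Then as $\lambda\to+\infty$: (1) if $N=2$ and $p<6$, or $N\ge3$, then $\int_T u_\lambda^2\to+\infty$; (2) if $N=2$ and $p=6$, then $\liminf_{\lambda\to+\infty}\int_T u_\lambda^2\in(0,+\infty)$; (3) if $N=2$ and $p>6$, then $\int_T u_\lambda^2\to0$. *)

theory Defs
  imports "HOL-Analysis.Analysis"
begin

definition annulus :: "'a::euclidean_space set" where
  "annulus = {x. 1 < norm x \<and> norm x < 2}"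

definition pderiv :: "('a::euclidean_space \<Rightarrow> real) \<Rightarrow> 'a \<Rightarrow> 'a \<Rightarrow> real" where
  "pderiv f b x = frechet_derivative f (at x) b"

definition grad :: "('a::euclidean_space \<Rightarrow> real) \<Rightarrow> 'a \<Rightarrow> 'a" where
  "grad f x = (\<Sum>b\<in>Basis. pderiv f b x *\<^sub>R b)"

definition Cinf :: "('a::euclidean_space \<Rightarrow> real) \<Rightarrow> bool" where
  "Cinf f \<longleftrightarrow> (\<exists>F. f \<in> F \<and> (\<forall>g\<in>F. (\<forall>x. g differentiable (at x)) \<and>
                         (\<forall>b\<in>Basis. pderiv g b \<in> F)))"

definition test_fun :: "'a::euclidean_space set \<Rightarrow> ('a \<Rightarrow> real) \<Rightarrow> bool" where
  "test_fun U \<phi> \<longleftrightarrow> Cinf \<phi> \<and> compact (closure {x. \<phi> x \<noteq> 0}) \<and> closure {x. \<phi> x \<noteq> 0} \<subseteq> U"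

definition H1_grad :: "'a::euclidean_space set \<Rightarrow> ('a \<Rightarrow> real) \<Rightarrow> ('a \<Rightarrow> 'a) \<Rightarrow> bool" where
  "H1_grad U u g \<longleftrightarrow>
     set_borel_measurable lborel U u \<and> set_integrable lborel U (\<lambda>x. (u x)\<^sup>2) \<and>
     set_borel_measurable lborel U g \<and> set_integrable lborel U (\<lambda>x. (norm (g x))\<^sup>2) \<and>
     (\<forall>\<phi> b. test_fun U \<phi> \<longrightarrow> b \<in> Basis \<longrightarrow>
        (LINT x:U|lborel. u x * pderiv \<phi> b x) = - (LINT x:U|lborel. (g x \<bullet> b) * \<phi> x))"

definition H10_grad :: "'a::euclidean_space set \<Rightarrow> ('a \<Rightarrow> real) \<Rightarrow> ('a \<Rightarrow> 'a) \<Rightarrow> bool" where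
  "H10_grad U u g \<longleftrightarrow> H1_grad U u g \<and>
     (\<exists>\<phi>s. (\<forall>k. test_fun U (\<phi>s k)) \<and>
        (\<lambda>k. LINT x:U|lborel. (\<phi>s k x - u x)\<^sup>2 + (norm (grad (\<phi>s k) x - g x))\<^sup>2) \<longlonglongrightarrow> 0)"

definition radial_on :: "'a::euclidean_space set \<Rightarrow> ('a \<Rightarrow> real) \<Rightarrow> bool" where
  "radial_on U u \<longleftrightarrow> (\<exists>v. AE x in lborel. x \<in> U \<longrightarrow> u x = v (norm x))"

definition pos_rad_solution :: "real \<Rightarrow> real \<Rightarrow> 'a::euclidean_space set \<Rightarrow> ('a \<Rightarrow> real) \<Rightarrow> bool" where
  "pos_rad_solution lam p U u \<longleftrightarrow>
     (\<exists>g. H10_grad U u g \<and> radial_on U u \<and> (AE x in lborel. x \<in> U \<longrightarrow> u x > 0) \<and>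
       (\<forall>\<phi>. test_fun U \<phi> \<longrightarrow>
          set_integrable lborel U (\<lambda>x. u x powr (p - 1) * \<phi> x) \<and>
          (LINT x:U|lborel. g x \<bullet> grad \<phi> x + lam * u x * \<phi> x) =
          (LINT x:U|lborel. u x powr (p - 1) * \<phi> x)))"

end

theory Submission
  imports Defs
begin

text \<open>
  A radial solution is \<open>u(x) = V(|x|)\<close> almost everywhere, where \<open>V\<close> is continuous on \<open>[1, 2]\<close>, vanishes at
  both ends and solves \<open>(r^n V')' = r^n (\<lambda> V - V^(p - 1))\<close> with \<open>n = N - 1\<close>; the mass of \<open>u\<close> is a constant
  times \<open>B = \<integral> r^n V^2\<close>. Both bounds \<open>B \<approx> \<lambda>^((6 - p) / (2 (p - 2)))\<close> come from the differential equation.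

  Lower bound: testing with \<open>V\<close> gives \<open>A + \<lambda> B = D\<close> for \<open>A = \<integral> r^n V'^2\<close> and \<open>D = \<integral> r^n V^p \<le> M^(p - 2) B\<close>,
  \<open>M\<close> being the maximum of \<open>V\<close>, and \<open>M^2 \<le> 2 \<integral> |V V'| \<le> t B + A / t\<close> with \<open>t = M^((p - 2) / 2)\<close> yields
  \<open>M^((6 - p) / 2) \<le> 2 B\<close>, while \<open>\<lambda> \<le> M^(p - 2)\<close>.

  Upper bound for \<open>N = 2\<close>: the energy \<open>V'^2 / 2 - \<lambda> V^2 / 2 + V^p / p\<close> decreases and ends at \<open>V'(2)^2 / 2 \<ge> 0\<close>,
  hence is nonnegative. Therefore \<open>V\<close> has a single critical point, and the set where \<open>V\<close> exceeds a given
  small multiple of \<open>\<lambda>^(1 / (p - 2))\<close> is an interval of length \<open>O(\<lambda>^(-1/2))\<close> as soon as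
  \<open>M^(p - 2) = O(\<lambda>)\<close>. If \<open>M\<close> were larger than that, the energy would be almost constant and \<open>V\<close> would drop to
  \<open>0\<close> on both sides within a distance \<open>O(M^(1 - p / 2))\<close>, which is less than the width of the annulus.
\<close>

section \<open>Radial profiles\<close>

text \<open>The obstacle before any estimate is that \<open>u\<close> is only a class in H^1_0: it
  has a weak gradient, its boundary values are hidden in the approximation by test functions, and
  its radial representative need not be measurable. No regularity theory is invoked. The identity
  behind the reduction is integration by parts of \<open>u\<close> against the fields x
  \<kappa>(|x|), which need not vanish on the boundary. It yields the continuous representative and
  both boundary values; radial test functions then give the differential equation. The exponent is
  the scaling one: a peak of height \<lambda>^(1/(p-2)) and width \<lambda>^(-1/2) has mass of order
  \<lambda>^(2/(p-2) - 1/2) = \<lambda>^((6-p)/(2(p-2))). The tails need no decay estimate in the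
  upper bound: where V^(p-2) \<le> \<lambda>/2 the contribution to D is at most \<lambda> B / 2, and
  it is absorbed in A + \<lambda> B = D.\<close>

locale profile =
  fixes n :: nat and lam p :: real and V W :: "real \<Rightarrow> real"
  assumes p_gt: "2 < p" and lam_pos: "0 < lam"
    and cont_V: "continuous_on {1..2} V" and cont_W: "continuous_on {1..2} W"
    and V_1: "V 1 = 0" and V_2: "V 2 = 0"
    and V_pos: "\<And>r. 1 < r \<Longrightarrow> r < 2 \<Longrightarrow> 0 < V r"
    and deriv_V: "\<And>r. 1 < r \<Longrightarrow> r < 2 \<Longrightarrow> (V has_real_derivative W r / r ^ n) (at r)"
    and deriv_W: "\<And>r. 1 < r \<Longrightarrow> r < 2 \<Longrightarrow>
      (W has_real_derivative r ^ n * (lam * V r - V r powr (p - 1))) (at r)"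
begin

text \<open>The flux \<open>W\<close> = r^n V' is kept as a separate function: it is continuous up
  to the endpoints, whereas derivatives are required in the open interval only. So
  \<open>slope\<close> is V' in the interior and a continuous extension of it at 1 and 2.\<close>

definition slope :: "real \<Rightarrow> real" where "slope r = W r / r ^ n"
definition A :: real where "A = integral {1..2} (\<lambda>r. r ^ n * (slope r)\<^sup>2)"
definition B :: real where "B = integral {1..2} (\<lambda>r. r ^ n * (V r)\<^sup>2)"
definition D :: real where "D = integral {1..2} (\<lambda>r. r ^ n * V r powr p)"

lemma V_nonneg: "1 \<le> r \<Longrightarrow> r \<le> 2 \<Longrightarrow> 0 \<le> V r"
  using V_pos[of r] V_1 V_2 by (cases "r = 1 \<or> r = 2") (auto simp: less_le)

lemma cont_slope: "continuous_on {1..2} slope"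
  unfolding slope_def by (intro continuous_intros cont_W) auto

lemma cont_powr: "q > 0 \<Longrightarrow> continuous_on {1..2} (\<lambda>r. V r powr q)"
  by (rule continuous_on_powr') (auto intro!: cont_V continuous_intros V_nonneg)

lemma integrable_terms:
  "(\<lambda>r. r ^ n * (slope r)\<^sup>2) integrable_on {1..2}"
  "(\<lambda>r. r ^ n * (V r)\<^sup>2) integrable_on {1..2}"
  "(\<lambda>r. r ^ n * V r powr p) integrable_on {1..2}"
  using p_gt by (auto intro!: integrable_continuous_real continuous_intros cont_slope cont_V cont_powr)

lemma V_powr_Suc: "1 \<le> r \<Longrightarrow> r \<le> 2 \<Longrightarrow> V r * V r powr (p - 1) = V r powr p"
  using V_nonneg[of r] powr_mult_base[of "V r" "p - 1"] by simp

lemma V_powr_pred: "1 \<le> r \<Longrightarrow> r \<le> 2 \<Longrightarrow> V r powr (p - 1) = V r * V r powr (p - 2)"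
  using powr_mult_base[of "V r" "p - 2"] V_nonneg by simp

lemma V_powr_split: "1 \<le> r \<Longrightarrow> r \<le> 2 \<Longrightarrow> V r powr p = (V r)\<^sup>2 * V r powr (p - 2)"
  using V_powr_Suc V_powr_pred by (simp add: power2_eq_square mult.assoc)

text \<open>The product V W has derivative W^2 / r^n + r^n (lam V^2 - V^p) and vanishes at both
  ends. Differentiability is known only inside the interval, hence the interior version of the
  fundamental theorem.\<close>

lemma energy_identity: "A + lam * B = D"
proof -
  have "((\<lambda>r. W r / r ^ n * W r + r ^ n * (lam * V r - V r powr (p - 1)) * V r) has_integral
        V 2 * W 2 - V 1 * W 1) {1..2}"
    by (rule fundamental_theorem_of_calculus_interior)
      (auto intro!: continuous_intros cont_V cont_W derivative_eq_intros deriv_V deriv_W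
        simp flip: has_real_derivative_iff_has_vector_derivative)
  moreover have "W r / r ^ n * W r + r ^ n * (lam * V r - V r powr (p - 1)) * V r =
      r ^ n * (slope r)\<^sup>2 + lam * (r ^ n * (V r)\<^sup>2) - r ^ n * V r powr p" if "r \<in> {1..2}" for r
  proof -
    have "W r / r ^ n * W r = r ^ n * (slope r)\<^sup>2"
      using that by (simp add: slope_def power2_eq_square)
    moreover have "V r powr (p - 1) * V r = V r powr p"
      using V_powr_Suc[of r] that by (simp add: mult.commute)
    ultimately show ?thesis by (simp add: algebra_simps power2_eq_square)
  qed
  ultimately have "((\<lambda>r. r ^ n * (slope r)\<^sup>2 + lam * (r ^ n * (V r)\<^sup>2) - r ^ n * V r powr p)
      has_integral 0) {1..2}"
    by (subst (asm) has_integral_cong) (auto simp: V_1 V_2)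
  moreover have "((\<lambda>r. r ^ n * (slope r)\<^sup>2 + lam * (r ^ n * (V r)\<^sup>2) - r ^ n * V r powr p)
      has_integral (A + lam * B - D)) {1..2}"
    unfolding A_def B_def D_def
    by (intro has_integral_add has_integral_diff has_integral_mult_right integrable_integral integrable_terms)
  ultimately have "0 = A + lam * B - D" by (rule has_integral_unique)
  then show ?thesis by simp
qed

lemma A_nonneg: "A \<ge> 0"
  unfolding A_def by (rule integral_nonneg) (auto intro: integrable_terms)

lemma B_nonneg: "B \<ge> 0"
  unfolding B_def by (rule integral_nonneg) (auto intro: integrable_terms)

lemma maximum_point:
  obtains r0 where "1 < r0" "r0 < 2" "\<And>r. r \<in> {1..2} \<Longrightarrow> V r \<le> V r0" "0 < V r0"
proof -
  obtain r0 where r0: "r0 \<in> {1..2}" "\<And>r. r \<in> {1..2} \<Longrightarrow> V r \<le> V r0"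
    using continuous_attains_sup[of "{1..2::real}" V] cont_V by auto
  have pos: "0 < V r0"
    using r0(2)[of "3/2"] V_pos[of "3/2"] by simp
  then have "1 < r0" "r0 < 2"
    using r0(1) V_1 V_2 by (auto simp: less_le)
  with r0 pos that show ?thesis by blast
qed

text \<open>V^2 is the integral of 2 V V' from the endpoint 1, where \<open>V\<close> vanishes, and
  Young's inequality with weight \<open>t\<close> splits the product. Since r^n \<ge> 1 the weight
  can be inserted afterwards; \<open>t\<close> stays free in order to balance the two terms.\<close>

lemma sup_bound_interp:
  assumes x: "1 \<le> x" "x \<le> 2" and t: "t > 0"
  shows "(V x)\<^sup>2 \<le> t * B + A / t"
proof -
  have sub: "{1..x} \<subseteq> {1..2}" using x by auto
  let ?f = "\<lambda>r. t * (r ^ n * (V r)\<^sup>2) + (r ^ n * (slope r)\<^sup>2) / t"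
  have "((\<lambda>r. 2 * V r * slope r) has_integral (V x)\<^sup>2 - (V 1)\<^sup>2) {1..x}"
    by (rule fundamental_theorem_of_calculus_interior)
      (use x in \<open>auto intro!: continuous_intros continuous_on_subset[OF cont_V sub] derivative_eq_intros deriv_V
        simp: slope_def power2_eq_square simp flip: has_real_derivative_iff_has_vector_derivative\<close>)
  then have I1: "((\<lambda>r. 2 * V r * slope r) has_integral (V x)\<^sup>2) {1..x}"
    by (simp add: V_1)
  have I2: "(?f has_integral (t * B + A / t)) {1..2}"
    unfolding A_def B_def using t
    by (intro has_integral_add has_integral_divide has_integral_mult_right integrable_integral integrable_terms)
  then have "?f integrable_on {1..x}"
    using integrable_on_subinterval[OF _ sub] by blast
  then have I3: "(?f has_integral integral {1..x} ?f) {1..x}" by blast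
  have pw: "2 * V r * slope r \<le> ?f r" if "r \<in> {1..2}" for r
  proof -
    let ?a = "V r" and ?b = "slope r"
    have "0 \<le> (t * ?a - ?b)\<^sup>2 / t" using t by simp
    also have "\<dots> = t * ?a\<^sup>2 + ?b\<^sup>2 / t - 2 * ?a * ?b"
      using t by (simp add: power2_eq_square field_simps)
    finally have 1: "2 * ?a * ?b \<le> t * ?a\<^sup>2 + ?b\<^sup>2 / t" by simp
    have "1 * (t * ?a\<^sup>2 + ?b\<^sup>2 / t) \<le> r ^ n * (t * ?a\<^sup>2 + ?b\<^sup>2 / t)"
      using that t by (intro mult_right_mono) auto
    with 1 show ?thesis by (simp add: algebra_simps)
  qed
  have "(V x)\<^sup>2 \<le> integral {1..x} ?f"
    using has_integral_le[OF I1 I3] pw x by auto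
  also have "\<dots> \<le> t * B + A / t"
    using has_integral_subset_le[OF sub I3 I2] t by auto
  finally show ?thesis .
qed

lemma D_le:
  assumes "\<And>r. r \<in> {1..2} \<Longrightarrow> V r \<le> M"
  shows "D \<le> M powr (p - 2) * B"
proof -
  have "V r powr (p - 2) \<le> M powr (p - 2)" if "r \<in> {1..2}" for r
    using assms[OF that] V_nonneg[of r] that p_gt by (intro powr_mono2) auto
  then have "r ^ n * V r powr p \<le> M powr (p - 2) * (r ^ n * (V r)\<^sup>2)" if "r \<in> {1..2}" for r
    using V_powr_split[of r] that mult_right_mono[of "V r powr (p - 2)" "M powr (p - 2)" "r ^ n * (V r)\<^sup>2"]
    by (simp add: mult_ac)
  then have "D \<le> integral {1..2} (\<lambda>r. M powr (p - 2) * (r ^ n * (V r)\<^sup>2))"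
    unfolding D_def
    using integrable_on_cmult_left[OF integrable_terms(2), of "M powr (p - 2)"]
    by (intro integral_le integrable_terms) (auto simp: algebra_simps)
  then show ?thesis by (simp add: B_def)
qed

lemma B_pos: "B > 0"
proof -
  have "\<not> B \<le> 0"
  proof
    assume "B \<le> 0"
    then have "B = 0" using B_nonneg by simp
    then have "((\<lambda>r. r ^ n * (V r)\<^sup>2) has_integral 0) {1..2}"
      using integrable_terms(2) B_def by (metis integrable_integral)
    then have "((\<lambda>r. r ^ n * (V r)\<^sup>2) has_integral 0) (cbox 1 2)" by simp
    then have "(3/2) ^ n * (V (3/2))\<^sup>2 = 0"
      by (rule has_integral_0_cbox_imp_0[rotated 2])
        (auto intro!: continuous_intros cont_V simp: box_real)
    then show False using V_pos[of "3/2"] by simp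
  qed
  then show ?thesis by simp
qed

lemma mass_lower_bound:
  assumes p6: "p \<le> 6"
  shows "lam powr ((6 - p) / (2 * (p - 2))) \<le> 2 * B"
proof -
  obtain r0 where r0: "1 < r0" "r0 < 2" "\<And>r. r \<in> {1..2} \<Longrightarrow> V r \<le> V r0" "0 < V r0"
    using maximum_point by blast
  define M where "M = V r0"
  have M: "M > 0" using r0 by (simp add: M_def)
  have D: "D \<le> M powr (p - 2) * B" using D_le r0(3) by (simp add: M_def)
  \<comment> \<open>Dropping A \<ge> 0 leaves lam B \<le> D; after division by B > 0 the peak is
    seen to be at least as high as the constant solution lam^(1/(p-2)).\<close>
  have "lam * B \<le> M powr (p - 2) * B" using D energy_identity A_nonneg by linarith
  then have lam: "lam \<le> M powr (p - 2)" using B_pos by simp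
  define t where "t = M powr ((p - 2) / 2)"
  have t: "t > 0" using M by (simp add: t_def)
  have tt: "t * t = M powr (p - 2)" by (simp add: t_def flip: powr_add)
  \<comment> \<open>Dropping lam B instead gives A \<le> t^2 B, so this \<open>t\<close> makes each
    term of the interpolation bound at most t B.\<close>
  have "A \<le> t * t * B" using D energy_identity lam_pos B_pos tt
    by (smt (verit) mult_pos_pos)
  then have "A / t \<le> t * B" using t by (simp add: divide_le_eq mult_ac)
  then have "M\<^sup>2 \<le> t * (2 * B)"
    using sup_bound_interp[of r0 t] r0 t by (simp add: M_def)
  moreover have "M\<^sup>2 = t * M powr ((6 - p) / 2)"
  proof -
    have "t * M powr ((6 - p) / 2) = M powr ((p - 2) / 2 + (6 - p) / 2)"
      by (simp only: t_def powr_add)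
    also have "(p - 2) / 2 + (6 - p) / 2 = 2" by (simp add: field_simps)
    finally show ?thesis using M by (simp add: powr_numeral)
  qed
  ultimately have 1: "M powr ((6 - p) / 2) \<le> 2 * B" using t by simp
  \<comment> \<open>For p \<le> 6 the exponent is nonnegative, so the lower bound on the height
    passes to the power.\<close>
  have "lam powr ((6 - p) / (2 * (p - 2))) \<le> (M powr (p - 2)) powr ((6 - p) / (2 * (p - 2)))"
    using lam lam_pos p6 p_gt by (intro powr_mono2) auto
  also have "\<dots> = M powr ((p - 2) * ((6 - p) / (2 * (p - 2))))"
    by (rule powr_powr)
  also have "(p - 2) * ((6 - p) / (2 * (p - 2))) = (6 - p) / 2"
    using p_gt by (simp add: divide_simps)
  finally show ?thesis using 1 by simp
qed

end

section \<open>Planar profiles: energy and width of the peak\<close>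

text \<open>The function is negative just after \<open>x\<close>. A first return to f \<ge> 0 would
  be a zero reached from below, which a negative derivative excludes. Applied to the flux
  \<open>W\<close>, this leaves room for one critical point only.\<close>

lemma down_crossing:
  fixes f :: "real \<Rightarrow> real"
  assumes xy: "x < y" and cont: "continuous_on {x..y} f" and fx: "f x = 0"
    and cross: "\<And>t. t \<in> {x..y} \<Longrightarrow> f t = 0 \<Longrightarrow> \<exists>l<0. (f has_real_derivative l) (at t)"
  shows "f y < 0"
proof (rule ccontr)
  assume "\<not> f y < 0"
  obtain l where l: "l < 0" "(f has_real_derivative l) (at x)"
    using cross[of x] fx xy by auto
  obtain d where d: "d > 0" "\<And>h. 0 < h \<Longrightarrow> h < d \<Longrightarrow> f (x + h) < f x"
    using DERIV_neg_dec_right[OF l(2) l(1)] by blast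
  \<comment> \<open>Starting at a point where f is already negative keeps the zero at
    \<open>x\<close> itself out of the set \<open>S\<close> of returns.\<close>
  define x' where "x' = x + min d (y - x) / 2"
  have x': "x < x'" "x' < y" "f x' < 0"
    using d(2)[of "min d (y - x) / 2"] d(1) xy fx by (auto simp: x'_def min_def field_simps)
  define S where "S = {t \<in> {x'..y}. 0 \<le> f t}"
  have cont': "continuous_on {x'..y} f" by (rule continuous_on_subset[OF cont]) (use x' in auto)
  have "closed S"
    unfolding S_def by (intro continuous_on_closed_Collect_le cont' continuous_intros)
  moreover have "S \<subseteq> {x'..y}" by (auto simp: S_def)
  ultimately have "compact S"
    by (metis bounded_closed_interval bounded_subset compact_eq_bounded_closed)
  moreover have "S \<noteq> {}" using \<open>\<not> f y < 0\<close> x' by (auto simp: S_def)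
  ultimately obtain c where c: "c \<in> S" "\<And>t. t \<in> S \<Longrightarrow> c \<le> t"
    using compact_attains_inf[of S] by blast
  have c': "x' < c" "c \<le> y" "0 \<le> f c" using c(1) x' by (auto simp: S_def less_le)
  have "continuous_on {x'..c} f" using continuous_on_subset[OF cont'] c' by auto
  then obtain t where t: "x' \<le> t" "t \<le> c" "f t = 0"
    using IVT'[of f x' 0 c] x' c' by auto
  then have "t = c" using c(2)[of t] c' by (auto simp: S_def)
  then obtain l' where l': "l' < 0" "(f has_real_derivative l') (at c)"
    using cross[of c] t x' c' by auto
  obtain e where e: "e > 0" "\<And>h. 0 < h \<Longrightarrow> h < e \<Longrightarrow> f c < f (c - h)"
    using DERIV_neg_dec_left[OF l'(2) l'(1)] by blast
  define h where "h = min e (c - x') / 2"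
  have "0 < h" "h < e" "x' < c - h" using e(1) c' by (auto simp: h_def min_def field_simps)
  then have "c - h \<in> S" using e(2)[of h] c' by (auto simp: S_def)
  then show False using c(2) \<open>0 < h\<close> by fastforce
qed

text \<open>The descent from the top \<open>a\<close> is split at the level \<beta>. Above it,
  \<open>high\<close> forces a drop of at least k (r - a)^2 / 2; below it, \<open>low\<close> forces
  a drop at rate \<kappa>. Neither drop can exceed V a, which bounds both lengths.\<close>

lemma half_width:
  fixes V D :: "real \<Rightarrow> real"
  assumes ax: "a \<le> x" and cont: "continuous_on {a..x} V"
    and deriv: "\<And>r. a < r \<Longrightarrow> r < x \<Longrightarrow> (V has_real_derivative D r) (at r)"
    and D_nonpos: "\<And>r. a < r \<Longrightarrow> r < x \<Longrightarrow> D r \<le> 0"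
    and k: "k > 0" and \<kappa>: "\<kappa> > 0" and Vx: "0 \<le> V x" and Va: "\<beta> \<le> V a"
    and high: "\<And>r. a < r \<Longrightarrow> r < x \<Longrightarrow> \<beta> \<le> V r \<Longrightarrow> D r \<le> - k * (r - a)"
    and low: "\<And>r. a < r \<Longrightarrow> r < x \<Longrightarrow> V x \<le> V r \<Longrightarrow> V r \<le> \<beta> \<Longrightarrow> D r \<le> - \<kappa>"
  shows "x - a \<le> sqrt (2 * V a / k) + V a / \<kappa>"
proof -
  have mono: "V t \<le> V s" if "a \<le> s" "s \<le> t" "t \<le> x" for s t
  proof (cases "s = t")
    case False
    show ?thesis
    proof (rule DERIV_nonpos_imp_decreasing_open[of s t V])
      show "continuous_on {s..t} V" using continuous_on_subset[OF cont] that by auto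
      show "\<exists>y. DERIV V r :> y \<and> y \<le> 0" if "s < r" "r < t" for r
        using deriv[of r] D_nonpos[of r] that \<open>a \<le> s\<close> \<open>t \<le> x\<close> by auto
    qed (use that in auto)
  qed simp
  obtain s where s: "a \<le> s" "s \<le> x" "\<And>r. a < r \<Longrightarrow> r < s \<Longrightarrow> \<beta> \<le> V r"
    "\<And>r. s < r \<Longrightarrow> r < x \<Longrightarrow> V r \<le> \<beta>"
  proof (cases "\<beta> \<le> V x")
    case True
    \<comment> \<open>The level \<beta> is not crossed before \<open>x\<close>, so the linear regime
      is empty and the splitting point is \<open>x\<close>.\<close>
    show ?thesis
    proof (rule that[of x])
      show "\<beta> \<le> V r" if "a < r" "r < x" for r using mono[of r x] that True by auto
    qed (use ax in auto)
  next
    case False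
    obtain s where s: "a \<le> s" "s \<le> x" "V s = \<beta>"
      using IVT2'[of V x \<beta> a] False Va ax cont by auto
    show ?thesis
    proof (rule that[of s])
      show "\<beta> \<le> V r" if "a < r" "r < s" for r using mono[of r s] that s by auto
      show "V r \<le> \<beta>" if "s < r" "r < x" for r using mono[of s r] that s by auto
    qed (use s in auto)
  qed
  have "s - a \<le> sqrt (2 * V a / k)"
  proof -
    have "V s + k * (s - a)\<^sup>2 / 2 \<le> V a + k * (a - a)\<^sup>2 / 2"
    proof (rule DERIV_nonpos_imp_decreasing_open[OF s(1), of "\<lambda>r. V r + k * (r - a)\<^sup>2 / 2"])
      fix r assume r: "a < r" "r < s"
      have "((\<lambda>r. V r + k * (r - a)\<^sup>2 / 2) has_real_derivative D r + k * (r - a)) (at r)"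
        using r s by (auto intro!: derivative_eq_intros deriv)
      then show "\<exists>y. ((\<lambda>r. V r + k * (r - a)\<^sup>2 / 2) has_real_derivative y) (at r) \<and> y \<le> 0"
        using high[of r] s r by fastforce
    qed (use s in \<open>auto intro!: continuous_intros continuous_on_subset[OF cont]\<close>)
    moreover have "0 \<le> V s" using mono[of s x] s Vx by auto
    ultimately have "(s - a)\<^sup>2 \<le> 2 * V a / k" using k by (simp add: field_simps)
    then show ?thesis using real_le_rsqrt by blast
  qed
  moreover have "x - s \<le> V a / \<kappa>"
  proof -
    have "V x + \<kappa> * x \<le> V s + \<kappa> * s"
    proof (rule DERIV_nonpos_imp_decreasing_open[OF s(2), of "\<lambda>r. V r + \<kappa> * r"])
      fix r assume r: "s < r" "r < x"
      have "((\<lambda>r. V r + \<kappa> * r) has_real_derivative D r + \<kappa>) (at r)"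
        using r s by (auto intro!: derivative_eq_intros deriv)
      moreover have "D r + \<kappa> \<le> 0" using low[of r] mono[of r x] s r by fastforce
      ultimately show "\<exists>y. ((\<lambda>r. V r + \<kappa> * r) has_real_derivative y) (at r) \<and> y \<le> 0" by blast
    qed (use s in \<open>auto intro!: continuous_intros continuous_on_subset[OF cont]\<close>)
    moreover have "V s \<le> V a" using mono[of a s] s by auto
    ultimately show ?thesis using \<kappa> Vx by (simp add: field_simps)
  qed
  ultimately show ?thesis by simp
qed

section \<open>Energy and critical points in the plane\<close>

locale planar_profile = profile +
  assumes n_eq: "n = 1"
begin

text \<open>The Hamiltonian of V'' = lam V - V^(p-1), that is, of the equation without its
  first-order term; in the plane the missing term - V' / r acts as friction.\<close>

definition energy :: "real \<Rightarrow> real" where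
  "energy r = (slope r)\<^sup>2 / 2 - lam * (V r)\<^sup>2 / 2 + V r powr p / p"

lemma W_eq: "W r = r * slope r" if "r \<noteq> 0"
  using that unfolding slope_def by (simp add: n_eq)

lemma deriv_slope:
  assumes r: "1 < r" "r < 2"
  shows "(slope has_real_derivative lam * V r - V r powr (p - 1) - slope r / r) (at r)"
proof -
  have "((\<lambda>r. W r / r ^ n) has_real_derivative
      (r * (lam * V r - V r powr (p - 1)) * r - W r * 1) / (r * r)) (at r)"
    using r by (auto intro!: derivative_eq_intros deriv_W simp: n_eq)
  moreover have "(r * (lam * V r - V r powr (p - 1)) * r - W r * 1) / (r * r)
      = lam * V r - V r powr (p - 1) - slope r / r"
    unfolding slope_def using r by (simp add: n_eq field_simps)
  ultimately show ?thesis unfolding slope_def[abs_def] by simp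
qed

lemma deriv_V': "1 < r \<Longrightarrow> r < 2 \<Longrightarrow> (V has_real_derivative slope r) (at r)"
  using deriv_V by (simp add: slope_def)

lemma deriv_energy:
  assumes r: "1 < r" "r < 2"
  shows "(energy has_real_derivative - (slope r)\<^sup>2 / r) (at r)"
proof -
  have 1: "((\<lambda>r. V r powr p) has_real_derivative p * V r powr (p - 1) * slope r) (at r)"
    using DERIV_chain2[OF has_real_derivative_powr deriv_V'] V_pos r by auto
  have "(energy has_real_derivative slope r * (lam * V r - V r powr (p - 1) - slope r / r)
      - lam * V r * slope r + p * V r powr (p - 1) * slope r / p) (at r)"
    unfolding energy_def[abs_def]
    using r p_gt by (auto intro!: derivative_eq_intros deriv_slope deriv_V' 1 V_pos)
  moreover have "slope r * (lam * V r - V r powr (p - 1) - slope r / r)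
      - lam * V r * slope r + p * V r powr (p - 1) * slope r / p = - (slope r)\<^sup>2 / r"
    using p_gt r by (simp add: field_simps power2_eq_square)
  ultimately show ?thesis by simp
qed

lemma cont_energy: "continuous_on {1..2} energy"
  unfolding energy_def[abs_def]
  using p_gt by (auto intro!: continuous_intros cont_slope cont_V cont_powr)

lemma energy_antimono:
  assumes "1 \<le> a" "a \<le> b" "b \<le> 2"
  shows "energy b \<le> energy a"
proof (rule DERIV_nonpos_imp_decreasing_open[OF assms(2)])
  show "\<exists>y. (energy has_real_derivative y) (at r) \<and> y \<le> 0" if "a < r" "r < b" for r
    using deriv_energy[of r] that assms by force
qed (use assms in \<open>auto intro!: continuous_on_subset[OF cont_energy]\<close>)

lemma energy_nonneg: "1 \<le> r \<Longrightarrow> r \<le> 2 \<Longrightarrow> 0 \<le> energy r"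
  using energy_antimono[of r 2] p_gt by (intro order.trans[of 0 "energy 2" "energy r"]) (auto simp: energy_def V_2)

text \<open>Where the slope vanishes, nonnegative energy reads V^p / p \<ge> lam V^2 / 2. Since p/2
  > 1, critical values lie strictly above the equilibrium lam^(1/(p-2)), where the flux decreases;
  this is what excludes minima.\<close>

lemma critical_value:
  assumes r: "1 < r" "r < 2" and Wr: "W r = 0"
  shows "p / 2 * lam \<le> V r powr (p - 2)"
proof -
  have "lam * (V r)\<^sup>2 / 2 \<le> (V r)\<^sup>2 * V r powr (p - 2) / p"
    using energy_nonneg[of r] V_powr_split[of r] r Wr unfolding energy_def slope_def by simp
  moreover have "(V r)\<^sup>2 > 0" using V_pos[OF r] by simp
  ultimately show ?thesis using p_gt by (simp add: field_simps)
qed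

lemma critical_deriv:
  assumes r: "1 < r" "r < 2" and Wr: "W r = 0"
  shows "\<exists>l<0. (W has_real_derivative l) (at r)"
proof -
  have "lam < V r powr (p - 2)"
    using critical_value[OF assms] p_gt lam_pos by (smt (verit) mult_less_cancel_right1 less_divide_eq_1)
  moreover have "V r powr (p - 1) = V r * V r powr (p - 2)"
    using powr_mult_base[of "V r" "p - 2"] V_pos[OF r] by simp
  ultimately have "r ^ n * (lam * V r - V r powr (p - 1)) < 0"
    using r V_pos[OF r] n_eq by (simp add: mult_less_0_iff)
  then show ?thesis using deriv_W[OF r] by blast
qed

text \<open>Zeros of \<open>W\<close> are the critical points of \<open>V\<close>, and all of them
  are strict downward crossings; starting from a maximum point, the sign of \<open>W\<close> on
  either side is determined.\<close>

lemma unimodal: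
  obtains r0 where "1 < r0" "r0 < 2" "0 < V r0" "\<And>r. r \<in> {1..2} \<Longrightarrow> V r \<le> V r0" "W r0 = 0"
    "\<And>r. r0 < r \<Longrightarrow> r < 2 \<Longrightarrow> slope r \<le> 0" "\<And>r. 1 < r \<Longrightarrow> r < r0 \<Longrightarrow> 0 \<le> slope r"
proof -
  obtain r0 where r0: "1 < r0" "r0 < 2" "\<And>r. r \<in> {1..2} \<Longrightarrow> V r \<le> V r0" "0 < V r0"
    using maximum_point by blast
  have "W r0 / r0 ^ n = 0"
    by (rule DERIV_local_max[OF deriv_V, of _ "min (r0 - 1) (2 - r0)"])
      (use r0 in \<open>auto simp: abs_less_iff intro!: r0(3)\<close>)
  then have W0: "W r0 = 0" using r0 by simp
  have right: "W r < 0" if "r0 < r" "r < 2" for r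
    by (rule down_crossing[OF that(1)])
      (use that r0 W0 critical_deriv in \<open>auto intro!: continuous_on_subset[OF cont_W]\<close>)
  \<comment> \<open>The same argument runs backwards: t -> - W (- t) also crosses zero downwards
    only. The double negation is the value of this function at -r.\<close>
  have left: "- W (- (- r)) < 0" if "1 < r" "r < r0" for r
  proof (rule down_crossing[of "-r0" "-r" "\<lambda>t. - W (- t)"])
    show "continuous_on {- r0..- r} (\<lambda>t. - W (- t))"
      using that r0 by (intro continuous_intros continuous_on_compose2[OF cont_W]) auto
    fix t assume t: "t \<in> {- r0..- r}" "- W (- t) = 0"
    then have "1 < - t" "- t < 2" "W (- t) = 0" using that r0 by auto
    then obtain l where l: "l < 0" "(W has_real_derivative l) (at (- t))"
      using critical_deriv[of "- t"] by blast
    have "((\<lambda>t. - W (- t)) has_real_derivative - (l * (- 1))) (at t)"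
      by (intro DERIV_minus DERIV_chain2[where g = uminus and Db = "-1", OF l(2)]) (auto intro!: derivative_eq_intros)
    then show "\<exists>l<0. ((\<lambda>t. - W (- t)) has_real_derivative l) (at t)" using l(1) by auto
  qed (use that W0 in auto)
  show ?thesis
  proof (rule that[OF r0(1,2,4) r0(3) W0])
    show "slope r \<le> 0" if "r0 < r" "r < 2" for r
      unfolding slope_def using right[OF that] that r0 by (intro divide_nonpos_pos) auto
    show "0 \<le> slope r" if "1 < r" "r < r0" for r
      unfolding slope_def using left[OF that] that r0 by (intro divide_nonneg_pos) auto
  qed
qed

end

section \<open>Width and height of the peak\<close>

locale peaked_profile = planar_profile +
  fixes r0 :: real
  assumes r0: "1 < r0" "r0 < 2" "0 < V r0" "\<And>r. r \<in> {1..2} \<Longrightarrow> V r \<le> V r0" "W r0 = 0"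
    and right: "\<And>r. r0 < r \<Longrightarrow> r < 2 \<Longrightarrow> slope r \<le> 0"
    and left: "\<And>r. 1 < r \<Longrightarrow> r < r0 \<Longrightarrow> 0 \<le> slope r"
begin

text \<open>\<open>half_width\<close> is applied to the right branch and, after the reflection r ->
  -r, to the left one. The equation controls W = r V' rather than V': W' \<le> -k follows from r
  \<ge> 1, but returning from \<open>W\<close> to the slope uses r \<le> 2 and costs the factor that
  turns k into k / 2. In \<open>low\<close>, levels below V x do not occur, because the branch
  between \<open>r0\<close> and \<open>x\<close> stays above V x.\<close>

lemma peak_width:
  assumes k: "k > 0" and \<kappa>: "\<kappa> > 0" and \<beta>: "\<beta> \<le> V r0" and x: "1 \<le> x" "x \<le> 2"
    and high: "\<And>r. 1 < r \<Longrightarrow> r < 2 \<Longrightarrow> \<beta> \<le> V r \<Longrightarrow> k \<le> V r powr (p - 1) - lam * V r"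
    and low: "\<And>r. 1 < r \<Longrightarrow> r < 2 \<Longrightarrow> V x \<le> V r \<Longrightarrow> V r \<le> \<beta> \<Longrightarrow> \<kappa>\<^sup>2 \<le> (slope r)\<^sup>2"
  shows "\<bar>x - r0\<bar> \<le> sqrt (4 * V r0 / k) + V r0 / \<kappa>"
proof -
  have low': "\<kappa> \<le> \<bar>slope r\<bar>" if "1 < r" "r < 2" "V x \<le> V r" "V r \<le> \<beta>" for r
    using low[OF that] \<kappa> abs_le_square_iff[of \<kappa> "slope r"] by simp
  have W_step: "W t + k * t \<le> W s + k * s" if st: "1 \<le> s" "s \<le> t" "t \<le> 2"
    and V_st: "\<And>r. s < r \<Longrightarrow> r < t \<Longrightarrow> \<beta> \<le> V r" for s t
  proof (rule DERIV_nonpos_imp_decreasing_open[OF st(2), of "\<lambda>r. W r + k * r"])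
    fix r assume r: "s < r" "r < t"
    then have r': "1 < r" "r < 2" using st by auto
    have "((\<lambda>r. W r + k * r) has_real_derivative r * (lam * V r - V r powr (p - 1)) + k) (at r)"
      using r' by (auto intro!: derivative_eq_intros deriv_W simp: n_eq)
    moreover have "r * (lam * V r - V r powr (p - 1)) \<le> 1 * (lam * V r - V r powr (p - 1))"
      using high[OF r' V_st[OF r]] k r' by (intro mult_right_mono_neg) auto
    ultimately show "\<exists>y. ((\<lambda>r. W r + k * r) has_real_derivative y) (at r) \<and> y \<le> 0"
      using high[OF r' V_st[OF r]] by fastforce
  qed (use st in \<open>auto intro!: continuous_intros continuous_on_subset[OF cont_W]\<close>)
  show ?thesis
  proof (cases "r0 \<le> x")
    case True
    have "x - r0 \<le> sqrt (2 * V r0 / (k / 2)) + V r0 / \<kappa>"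
    proof (rule half_width[OF True, of V slope "k / 2" \<kappa> \<beta>])
      fix r assume r: "r0 < r" "r < x" "\<beta> \<le> V r"
      \<comment> \<open>Monotonicity of the branch keeps \<open>V\<close> above \<beta> on the whole
        stretch from \<open>r0\<close> to \<open>r\<close>, so \<open>W_step\<close> can start at
        the critical point, where \<open>W\<close> vanishes.\<close>
      have "V r \<le> V s" if "r0 < s" "s < r" for s
      proof (rule DERIV_nonpos_imp_decreasing_open[of s r V])
        show "continuous_on {s..r} V" using that r r0 x by (auto intro!: continuous_on_subset[OF cont_V])
        show "\<exists>y. DERIV V t :> y \<and> y \<le> 0" if "s < t" "t < r" for t
          using deriv_V'[of t] right[of t] that \<open>r0 < s\<close> r r0 x by auto
      qed (use that in auto)
      then have "W r + k * r \<le> W r0 + k * r0"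
        using r r0 x by (intro W_step) force+
      then have "W r \<le> - k * (r - r0)" using r0 by (simp add: algebra_simps)
      moreover have "W r = r * slope r" using r r0 by (intro W_eq) auto
      moreover have "2 * slope r \<le> r * slope r"
        using right[of r] r x by (intro mult_right_mono_neg) auto
      ultimately have "2 * slope r \<le> - k * (r - r0)" by linarith
      then show "slope r \<le> - (k / 2) * (r - r0)" by simp
    next
      fix r assume "r0 < r" "r < x" "V x \<le> V r" "V r \<le> \<beta>"
      then show "slope r \<le> - \<kappa>" using low'[of r] right[of r] r0 x by auto
    qed (use r0 x k \<kappa> \<beta> right V_nonneg in
        \<open>auto intro!: continuous_on_subset[OF cont_V] deriv_V'\<close>)
    then show ?thesis using True by simp
  next
    case False
    then have xr: "- r0 \<le> - x" by simp
    have "- x - (- r0) \<le> sqrt (2 * V (- (- r0)) / (k / 2)) + V (- (- r0)) / \<kappa>"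
    proof (rule half_width[OF xr, of "\<lambda>t. V (- t)" "\<lambda>t. - slope (- t)" "k / 2" \<kappa> \<beta>])
      show "continuous_on {- r0..- x} (\<lambda>t. V (- t))"
        using r0 x by (intro continuous_intros continuous_on_compose2[OF cont_V]) auto
      fix t assume t: "- r0 < t" "t < - x"
      show "((\<lambda>t. V (- t)) has_real_derivative - slope (- t)) (at t)"
        using DERIV_chain2[where g = uminus and Db = "-1" and x = t, OF deriv_V'[of "- t"]
            DERIV_minus[OF DERIV_ident]] t r0 x by simp
      show "- slope (- t) \<le> 0" using left[of "- t"] t x by auto
      show "- slope (- t) \<le> - \<kappa>" if "V (- (- x)) \<le> V (- t)" "V (- t) \<le> \<beta>"
        using low'[of "- t"] left[of "- t"] that r0 x t by auto
      assume Vt: "\<beta> \<le> V (- t)"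
      define r where "r = - t"
      have r: "x < r" "r < r0" "\<beta> \<le> V r" using t Vt by (auto simp: r_def)
      have "V r \<le> V s" if "r < s" "s < r0" for s
      proof (rule DERIV_nonneg_imp_increasing_open[of r s V])
        show "continuous_on {r..s} V" using that r r0 x by (auto intro!: continuous_on_subset[OF cont_V])
        show "\<exists>y. DERIV V t :> y \<and> 0 \<le> y" if "r < t" "t < s" for t
          using deriv_V'[of t] left[of t] that \<open>s < r0\<close> r r0 x by auto
      qed (use that in auto)
      then have "W r0 + k * r0 \<le> W r + k * r"
        using r r0 x by (intro W_step) force+
      then have "W r \<ge> k * (r0 - r)" using r0 by (simp add: algebra_simps)
      moreover have "W r = r * slope r" using r x by (intro W_eq) auto
      moreover have "r * slope r \<le> 2 * slope r"
        using left[of r] r x r0 by (intro mult_right_mono) auto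
      ultimately have "k * (r0 - r) \<le> 2 * slope r" by linarith
      then show "- slope (- t) \<le> - (k / 2) * (t - - r0)" by (simp add: algebra_simps r_def)
    qed (use r0 x k \<kappa> \<beta> V_nonneg in auto)
    then show ?thesis using False by simp
  qed
qed

lemma slope_sq: "(slope r)\<^sup>2 = 2 * energy r + lam * (V r)\<^sup>2 - 2 * V r powr p / p"
  by (simp add: energy_def field_simps)

text \<open>With M = V r0 and T = M^((p-2)/2) the energy at the top is of order M^2 T^2. Friction
  dissipates at most M T times the drop of \<open>V\<close>, hence at most M^2 T on the right
  branch, smaller by a factor T. So |V'| is of order M T away from the top and both branches have
  length O(1/T); as they fill an interval of length 1, T is bounded.\<close>

lemma tall_peak:
  assumes tall: "(p + 2 * 4 powr (p - 2)) * lam \<le> V r0 powr (p - 2)"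
    and T: "4 * p \<le> V r0 powr ((p - 2) / 2)"
  shows "V r0 powr ((p - 2) / 2) \<le> 2 * (sqrt (32 * 4 powr (p - 2)) + sqrt (4 * p))"
proof -
  define M where "M = V r0"
  define T where "T = V r0 powr ((p - 2) / 2)"
  have M: "M > 0" using r0 by (simp add: M_def)
  have Tp: "T > 0" "4 * p \<le> T" using r0 T by (auto simp: T_def)
  have T2: "M powr (p - 2) = T\<^sup>2"
    by (simp add: T_def M_def power2_eq_square flip: powr_add)
  have Mp: "M powr p = M\<^sup>2 * T\<^sup>2"
    using V_powr_split[of r0] r0 T2 by (simp add: M_def)
  \<comment> \<open>The two summands of the constant act separately: p lam \<le> T^2 leaves at least
    half of M^2 T^2 / p as energy at the top, and 2 4^(p-2) lam \<le> T^2 gives V^(p-2) \<ge> 2 lam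
    wherever V \<ge> M / 4.\<close>
  have "p * lam \<le> (p + 2 * 4 powr (p - 2)) * lam"
    using lam_pos by (intro mult_right_mono) auto
  then have lam1: "p * lam \<le> T\<^sup>2" using tall T2 by (simp add: M_def)
  have "2 * 4 powr (p - 2) * lam \<le> (p + 2 * 4 powr (p - 2)) * lam"
    using lam_pos p_gt by (intro mult_right_mono) auto
  then have lam2: "2 * 4 powr (p - 2) * lam \<le> T\<^sup>2" using tall T2 by (simp add: M_def)
  have slope0: "slope r0 = 0" using r0 by (simp add: slope_def)
  have E0: "energy r0 = M\<^sup>2 * T\<^sup>2 / p - lam * M\<^sup>2 / 2"
    using Mp by (simp add: energy_def slope0 M_def)
  have "lam * M\<^sup>2 / 2 \<le> M\<^sup>2 * T\<^sup>2 / (2 * p)"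
    using lam1 p_gt M by (simp add: field_simps)
  then have E0': "M\<^sup>2 * T\<^sup>2 / (2 * p) \<le> energy r0"
    using E0 p_gt by (simp add: field_simps)
  have quarter: "M\<^sup>2 * T\<^sup>2 / (4 * p) \<le> M\<^sup>2 * T\<^sup>2 / (2 * p)"
    using p_gt by (simp add: field_simps)
  have E_right: "M\<^sup>2 * T\<^sup>2 / (2 * p) - M\<^sup>2 * T \<le> energy r" if r: "r0 \<le> r" "r \<le> 2" for r
  proof -
    \<comment> \<open>As 0 \<le> -V' \<le> M T on the right branch, the dissipation V'^2 / t is at
      most - M T V', so energy - M T V is nondecreasing there.\<close>
    have "energy r0 - M * T * V r0 \<le> energy r - M * T * V r"
    proof (rule DERIV_nonneg_imp_increasing_open[OF r(1), of "\<lambda>r. energy r - M * T * V r"])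
      fix t assume t: "r0 < t" "t < r"
      then have t': "1 < t" "t < 2" using r0 r by auto
      have "((\<lambda>r. energy r - M * T * V r) has_real_derivative
          - (slope t)\<^sup>2 / t - M * T * slope t) (at t)"
        using t' by (auto intro!: derivative_eq_intros deriv_energy deriv_V')
      moreover have "- (slope t)\<^sup>2 / t - M * T * slope t \<ge> 0"
      proof -
        have "(slope t)\<^sup>2 \<le> 2 * energy r0 + lam * M\<^sup>2"
        proof -
          have "energy t \<le> energy r0" using energy_antimono[of r0 t] r0 t t' by simp
          moreover have "(V t)\<^sup>2 \<le> M\<^sup>2"
            using r0(4)[of t] V_nonneg[of t] t' by (intro power_mono) (auto simp: M_def)
          then have "lam * (V t)\<^sup>2 \<le> lam * M\<^sup>2" using lam_pos by simp
          moreover have "0 \<le> 2 * V t powr p / p" using p_gt by simp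
          ultimately show ?thesis unfolding slope_sq by linarith
        qed
        also have "\<dots> = 2 / p * (M\<^sup>2 * T\<^sup>2)" by (simp add: E0)
        also have "\<dots> \<le> 1 * (M\<^sup>2 * T\<^sup>2)" using p_gt by (intro mult_right_mono) auto
        finally have "(slope t)\<^sup>2 \<le> (M * T)\<^sup>2" by (simp add: power_mult_distrib)
        then have "\<bar>slope t\<bar> \<le> M * T" using M Tp by (simp flip: abs_le_square_iff)
        then have "- slope t \<le> M * T" by simp
        moreover have "slope t \<le> 0" using right t t' by simp
        ultimately have "(- slope t) * (- slope t) \<le> M * T * (- slope t)"
          by (intro mult_right_mono) auto
        then have "(slope t)\<^sup>2 \<le> M * T * (- slope t)" by (simp add: power2_eq_square)
        moreover have "(slope t)\<^sup>2 / t \<le> (slope t)\<^sup>2"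
          using t' mult_left_mono[of 1 t "(slope t)\<^sup>2"] by (simp add: field_simps)
        ultimately show ?thesis by simp
      qed
      ultimately show "\<exists>y. ((\<lambda>r. energy r - M * T * V r) has_real_derivative y) (at t) \<and> 0 \<le> y"
        by blast
    next
      show "continuous_on {r0..r} (\<lambda>r. energy r - M * T * V r)"
        by (intro continuous_intros continuous_on_subset[OF cont_V] continuous_on_subset[OF cont_energy])
          (use r r0 in auto)
    qed
    moreover have "0 \<le> M * T * V r" using M Tp V_nonneg[of r] r r0 by simp
    moreover have "M * T * V r0 = M\<^sup>2 * T" by (simp add: M_def power2_eq_square)
    ultimately show ?thesis using E0' by linarith
  qed
  have "M\<^sup>2 * T * (4 * p) \<le> M\<^sup>2 * T * T" using Tp M by (intro mult_left_mono) auto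
  then have "M\<^sup>2 * T \<le> M\<^sup>2 * T\<^sup>2 / (4 * p)" using p_gt by (simp add: field_simps power2_eq_square)
  moreover have "M\<^sup>2 * T\<^sup>2 / (2 * p) = M\<^sup>2 * T\<^sup>2 / (4 * p) + M\<^sup>2 * T\<^sup>2 / (4 * p)"
    using p_gt by (simp add: field_simps)
  \<comment> \<open>Here 4 p \<le> T is spent: the loss M^2 T is at most half of the M^2 T^2 / (2 p)
    available. To the left of the top the energy is at least its value there.\<close>
  ultimately have E_low: "M\<^sup>2 * T\<^sup>2 / (4 * p) \<le> energy r" if "1 \<le> r" "r \<le> 2" for r
    using E_right[of r] energy_antimono[of r r0] E0' quarter that r0 by (cases "r0 \<le> r") auto
  define k where "k = M * T\<^sup>2 / (8 * 4 powr (p - 2))"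
  define \<kappa> where "\<kappa> = M * T / sqrt (4 * p)"
  have pos: "k > 0" "\<kappa> > 0" using M Tp p_gt by (auto simp: k_def \<kappa>_def)
  have width: "\<bar>x - r0\<bar> \<le> sqrt (4 * V r0 / k) + V r0 / \<kappa>" if x: "1 \<le> x" "x \<le> 2" for x
  proof (rule peak_width[OF pos, of "M / 4"])
    fix r assume r: "1 < r" "r < 2" and Vr: "M / 4 \<le> V r"
    have "(M / 4) powr (p - 2) \<le> V r powr (p - 2)"
      using M Vr p_gt by (intro powr_mono2) auto
    then have "T\<^sup>2 / 4 powr (p - 2) \<le> V r powr (p - 2)"
      using M T2 by (simp add: powr_divide)
    moreover have "lam \<le> T\<^sup>2 / 4 powr (p - 2) / 2" using lam2 by (simp add: field_simps)
    ultimately have "T\<^sup>2 / 4 powr (p - 2) / 2 \<le> V r powr (p - 2) - lam" by linarith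
    then have "M / 4 * (T\<^sup>2 / 4 powr (p - 2) / 2) \<le> V r * (V r powr (p - 2) - lam)"
      using M Vr by (intro mult_mono) auto
    then show "k \<le> V r powr (p - 1) - lam * V r"
      using V_powr_pred[of r] r by (simp add: k_def algebra_simps)
  next
    fix r assume r: "1 < r" "r < 2" and Vr: "V r \<le> M / 4"
    have "V r powr p \<le> (M / 4) powr p"
      using V_nonneg[of r] Vr r p_gt by (intro powr_mono2) auto
    also have "\<dots> = M\<^sup>2 * T\<^sup>2 / 4 powr p" using M Mp by (simp add: powr_divide)
    also have "\<dots> \<le> M\<^sup>2 * T\<^sup>2 / 4 powr 2"
      using M Tp p_gt by (intro divide_left_mono powr_mono) auto
    \<comment> \<open>At heights up to M / 4 the potential term takes away at most a quarter of what
      twice the energy supplies.\<close>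
    finally have "2 * V r powr p / p \<le> M\<^sup>2 * T\<^sup>2 / (8 * p)"
      using p_gt by (simp add: field_simps)
    moreover have "M\<^sup>2 * T\<^sup>2 / (8 * p) + M\<^sup>2 * T\<^sup>2 / (4 * p) \<le> 2 * (M\<^sup>2 * T\<^sup>2 / (4 * p))"
      using p_gt by (simp add: field_simps)
    moreover have "0 \<le> lam * (V r)\<^sup>2" using lam_pos by simp
    ultimately have "M\<^sup>2 * T\<^sup>2 / (4 * p) \<le> (slope r)\<^sup>2"
      using E_low[of r] r unfolding slope_sq by linarith
    then show "\<kappa>\<^sup>2 \<le> (slope r)\<^sup>2"
      using p_gt by (simp add: \<kappa>_def power_divide power_mult_distrib)
  qed (use M x in \<open>auto simp: M_def\<close>)
  have "4 * V r0 / k = 32 * 4 powr (p - 2) / T\<^sup>2"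
    using M Tp by (simp add: k_def M_def[symmetric] field_simps)
  then have "sqrt (4 * V r0 / k) = sqrt (32 * 4 powr (p - 2)) / T"
    using Tp by (simp add: real_sqrt_divide)
  moreover have "V r0 / \<kappa> = sqrt (4 * p) / T"
    using M by (simp add: \<kappa>_def M_def[symmetric])
  \<comment> \<open>The distances from \<open>r0\<close> to the ends 1 and 2 add up to 1, and each
    is bounded by the same width.\<close>
  ultimately have "1 \<le> 2 * (sqrt (32 * 4 powr (p - 2)) / T + sqrt (4 * p) / T)"
    using width[of 1] width[of 2] r0 by simp
  also have "\<dots> = 2 * (sqrt (32 * 4 powr (p - 2)) + sqrt (4 * p)) / T"
    by (simp add: add_divide_distrib)
  finally have "T \<le> 2 * (sqrt (32 * 4 powr (p - 2)) + sqrt (4 * p))"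
    using Tp by (simp add: le_divide_eq)
  then show ?thesis by (simp add: T_def)
qed

text \<open>The threshold on lam is chosen so that the critical value alone, T^2 \<ge> p/2 lam,
  makes T exceed 4 p plus the bound of \<open>tall_peak\<close>. A tall peak would then contradict
  that bound.\<close>

lemma height_bound:
  assumes large: "(4 * p + 2 * (sqrt (32 * 4 powr (p - 2)) + sqrt (4 * p)))\<^sup>2 < lam"
  shows "V r0 powr (p - 2) \<le> (p + 2 * 4 powr (p - 2)) * lam"
proof (rule ccontr)
  define T where "T = V r0 powr ((p - 2) / 2)"
  assume "\<not> ?thesis"
  then have tall: "(p + 2 * 4 powr (p - 2)) * lam \<le> V r0 powr (p - 2)" by simp
  have "1 * lam \<le> p / 2 * lam" using lam_pos p_gt by (intro mult_right_mono) auto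
  also have "\<dots> \<le> T\<^sup>2"
    using critical_value[OF r0(1,2,5)] by (simp add: T_def power2_eq_square flip: powr_add)
  finally have "(4 * p + 2 * (sqrt (32 * 4 powr (p - 2)) + sqrt (4 * p)))\<^sup>2 < T\<^sup>2"
    using large by simp
  then have *: "4 * p + 2 * (sqrt (32 * 4 powr (p - 2)) + sqrt (4 * p)) < T"
    by (rule power_less_imp_less_base) (simp add: T_def)
  moreover have "0 \<le> sqrt (32 * 4 powr (p - 2)) + sqrt (4 * p)" using p_gt by simp
  ultimately have "4 * p \<le> T" by simp
  then have "T \<le> 2 * (sqrt (32 * 4 powr (p - 2)) + sqrt (4 * p))"
    using tall_peak[OF tall] by (simp add: T_def)
  then show False using * p_gt by linarith
qed

text \<open>In lam B \<le> D the part with V^(p-2) \<le> lam / 2 is absorbed; the rest lives within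
  distance L of the top, with integrand at most 2 M^p. Since M = O(lam^(1/(p-2))) and L =
  O(lam^(-1/2)), the exponent is p/(p-2) - 1/2 - 1.\<close>

lemma mass_upper_bound:
  assumes K: "V r0 powr (p - 2) \<le> K * lam"
  defines "\<mu> \<equiv> (p + 2) / 4"
  shows "B \<le> 8 * K powr (p / (p - 2)) * (sqrt (4 * (K / \<mu>) powr (1 / (p - 2)) / (\<mu> - 1)) +
      (2 * K) powr (1 / (p - 2)) / sqrt ((p - 2) / (2 * p))) * lam powr (p / (p - 2) - 3 / 2)"
proof -
  define M where "M = V r0"
  define q where "q = 1 / (p - 2)"
  have q: "q > 0" "q * (p - 2) = 1" using p_gt by (auto simp: q_def)
  have M: "M > 0" using r0 by (simp add: M_def)
  \<comment> \<open>\<mu> is the midpoint of 1 and p/2. Where V^(p-2) \<ge> \<mu> lam, the flux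
    falls at a definite rate because \<mu> > 1; where V^(p-2) \<le> \<mu> lam, nonnegative energy
    gives V'^2 \<ge> lam V^2 (1 - 2 \<mu> / p), a positive factor because \<mu> < p/2.\<close>
  have \<mu>: "1 < \<mu>" "\<mu> < p / 2" using p_gt by (auto simp: \<mu>_def)
  have \<mu>2: "1 - 2 * \<mu> / p = (p - 2) / (2 * p)" using p_gt by (simp add: \<mu>_def field_simps)
  have M_crit: "p / 2 * lam \<le> M powr (p - 2)" using critical_value[OF r0(1,2,5)] by (simp add: M_def)
  have "0 < p / 2 * lam" using p_gt lam_pos by simp
  then have "0 < K * lam" using M_crit K by (simp add: M_def)
  then have Kpos: "K > 0" using lam_pos by (simp add: zero_less_mult_iff)
  have M_root: "M = (M powr (p - 2)) powr q" using M q by (simp add: powr_powr mult.commute)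
  define \<beta> where "\<beta> = (\<mu> * lam) powr q"
  define \<alpha> where "\<alpha> = (lam / 2) powr q"
  have pos: "\<beta> > 0" "\<alpha> > 0" using \<mu> lam_pos by (auto simp: \<alpha>_def \<beta>_def)
  have \<beta>_pow: "\<beta> powr (p - 2) = \<mu> * lam" and \<alpha>_pow: "\<alpha> powr (p - 2) = lam / 2"
    using \<mu> lam_pos q by (auto simp: \<alpha>_def \<beta>_def powr_powr)
  have "\<mu> * lam \<le> p / 2 * lam" using \<mu> lam_pos by (intro mult_right_mono) auto
  then have "\<mu> * lam \<le> M powr (p - 2)" using M_crit by simp
  then have "\<beta> \<le> (M powr (p - 2)) powr q"
    unfolding \<beta>_def using \<mu> lam_pos q by (intro powr_mono2) auto
  then have \<beta>M: "\<beta> \<le> M" using M_root by simp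
  have M_K: "M \<le> (K * lam) powr q"
    by (subst M_root, intro powr_mono2) (use K q in \<open>auto simp: M_def\<close>)
  have ratio: "M / (a * lam) powr q \<le> (K / a) powr q" if "a > 0" for a
  proof -
    have "M / (a * lam) powr q \<le> (K * lam) powr q / (a * lam) powr q"
      using M_K by (intro divide_right_mono) auto
    also have "\<dots> = (K * lam / (a * lam)) powr q"
      using that lam_pos Kpos by (subst powr_divide) auto
    finally show ?thesis using lam_pos by simp
  qed
  have M\<beta>: "M / \<beta> \<le> (K / \<mu>) powr q" using ratio[of \<mu>] \<mu> by (simp add: \<beta>_def)
  have M\<alpha>: "M / \<alpha> \<le> (2 * K) powr q" using ratio[of "1 / 2"] by (simp add: \<alpha>_def mult.commute)
  define k where "k = \<beta> * (lam * (\<mu> - 1))"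
  define \<kappa> where "\<kappa> = \<alpha> * sqrt (lam * ((p - 2) / (2 * p)))"
  have kpos: "k > 0" "\<kappa> > 0" using pos lam_pos \<mu> p_gt by (auto simp: k_def \<kappa>_def)
  define L where "L = sqrt (4 * V r0 / k) + V r0 / \<kappa>"
  \<comment> \<open>Only points with V x \<ge> \<alpha> are measured, because the lower bound for
    the slope at low levels is proportional to \<open>V\<close> itself.\<close>
  have width: "\<bar>x - r0\<bar> \<le> L" if x: "1 \<le> x" "x \<le> 2" and Vx: "\<alpha> \<le> V x" for x
    unfolding L_def
  proof (rule peak_width[OF kpos, of \<beta>])
    fix r assume r: "1 < r" "r < 2" and Vr: "\<beta> \<le> V r"
    have "\<beta> powr (p - 2) \<le> V r powr (p - 2)"
      using pos Vr p_gt by (intro powr_mono2) auto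
    then have "lam * (\<mu> - 1) \<le> V r powr (p - 2) - lam" using \<beta>_pow by (simp add: algebra_simps)
    then have "k \<le> V r * (V r powr (p - 2) - lam)"
      unfolding k_def using pos Vr lam_pos \<mu> by (intro mult_mono) auto
    then show "k \<le> V r powr (p - 1) - lam * V r"
      using V_powr_pred[of r] r by (simp add: algebra_simps)
  next
    fix r assume r: "1 < r" "r < 2" and Vr: "V x \<le> V r" "V r \<le> \<beta>"
    have "V r powr (p - 2) \<le> \<mu> * lam"
      unfolding \<beta>_pow[symmetric] using V_nonneg[of r] r Vr p_gt by (intro powr_mono2) auto
    then have "2 * V r powr (p - 2) / p \<le> 2 * (\<mu> * lam) / p"
      using p_gt by (intro divide_right_mono) auto
    then have "lam * ((p - 2) / (2 * p)) \<le> lam - 2 * V r powr (p - 2) / p"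
      unfolding \<mu>2[symmetric] by (simp add: algebra_simps)
    moreover have "\<alpha>\<^sup>2 \<le> (V r)\<^sup>2" using Vx Vr pos by (intro power_mono) auto
    ultimately have "\<alpha>\<^sup>2 * (lam * ((p - 2) / (2 * p))) \<le> (V r)\<^sup>2 * (lam - 2 * V r powr (p - 2) / p)"
      using lam_pos p_gt by (intro mult_mono) auto
    also have "\<dots> = lam * (V r)\<^sup>2 - 2 * V r powr p / p"
      using V_powr_split[of r] r by (simp add: algebra_simps)
    also have "\<dots> \<le> (slope r)\<^sup>2" unfolding slope_sq using energy_nonneg[of r] r by simp
    finally show "\<kappa>\<^sup>2 \<le> (slope r)\<^sup>2"
      using lam_pos p_gt by (simp add: \<kappa>_def power_mult_distrib)
  qed (use \<beta>M x in \<open>auto simp: M_def\<close>)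
  have L_nonneg: "L \<ge> 0" using M kpos by (simp add: L_def M_def)
  define c where "c = sqrt (4 * (K / \<mu>) powr q / (\<mu> - 1)) + (2 * K) powr q / sqrt ((p - 2) / (2 * p))"
  have L_c: "L \<le> c / sqrt lam"
  proof -
    have "4 * V r0 / k = 4 * (M / \<beta>) / (\<mu> - 1) / lam" by (simp add: k_def M_def field_simps)
    also have "\<dots> \<le> 4 * (K / \<mu>) powr q / (\<mu> - 1) / lam"
      using M\<beta> \<mu> lam_pos by (intro divide_right_mono mult_left_mono) auto
    finally have 1: "sqrt (4 * V r0 / k) \<le> sqrt (4 * (K / \<mu>) powr q / (\<mu> - 1)) / sqrt lam"
      unfolding real_sqrt_divide[symmetric] by (rule real_sqrt_le_mono)
    have "V r0 / \<kappa> = M / \<alpha> / sqrt ((p - 2) / (2 * p)) / sqrt lam"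
      unfolding \<kappa>_def real_sqrt_mult M_def by (simp only: divide_divide_eq_left mult_ac)
    also have "\<dots> \<le> (2 * K) powr q / sqrt ((p - 2) / (2 * p)) / sqrt lam"
      using M\<alpha> lam_pos p_gt by (intro divide_right_mono) auto
    finally show ?thesis using 1 by (simp add: L_def c_def add_divide_distrib)
  qed
  \<comment> \<open>Below \<alpha> the power V^p is dominated by lam/2 V^2; above it the point lies
    within distance L of the top, and the 2 bounds the weight r.\<close>
  have pw: "r ^ n * V r powr p \<le> lam / 2 * (r ^ n * (V r)\<^sup>2) +
      (if r \<in> {r0 - L..r0 + L} then 2 * M powr p else 0)" if r: "r \<in> {1..2}" for r
  proof (cases "V r \<le> \<alpha>")
    case True
    have "V r powr (p - 2) \<le> lam / 2"
      unfolding \<alpha>_pow[symmetric] using V_nonneg[of r] r True p_gt by (intro powr_mono2) auto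
    then have "r ^ n * (V r)\<^sup>2 * V r powr (p - 2) \<le> r ^ n * (V r)\<^sup>2 * (lam / 2)"
      using r by (intro mult_left_mono) auto
    moreover have "r ^ n * V r powr p = r ^ n * (V r)\<^sup>2 * V r powr (p - 2)"
      using V_powr_split[of r] r by simp
    ultimately have "r ^ n * V r powr p \<le> lam / 2 * (r ^ n * (V r)\<^sup>2)"
      by (simp only: mult_ac)
    moreover have "0 \<le> (if r \<in> {r0 - L..r0 + L} then 2 * M powr p else 0)" by simp
    ultimately show ?thesis by linarith
  next
    case False
    then have "r \<in> {r0 - L..r0 + L}" using width[of r] r by (auto simp: abs_le_iff)
    moreover have "r ^ n * V r powr p \<le> 2 * M powr p"
      using r V_nonneg[of r] r0(4)[of r] p_gt n_eq
      by (intro mult_mono powr_mono2) (auto simp: M_def)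
    moreover have "0 \<le> lam / 2 * (r ^ n * (V r)\<^sup>2)" using lam_pos r by simp
    ultimately show ?thesis by simp
  qed
  define J where "J = {1..2} \<inter> {r0 - L..r0 + L}"
  have J: "J = {max 1 (r0 - L)..min 2 (r0 + L)}" by (auto simp: J_def)
  have int_ind: "((\<lambda>r. if r \<in> {r0 - L..r0 + L} then 2 * M powr p else 0) has_integral
      integral J (\<lambda>r. 2 * M powr p)) {1..2}"
  proof -
    have "((\<lambda>r. 2 * M powr p) has_integral integral J (\<lambda>r. 2 * M powr p)) J"
      by (rule integrable_integral) (simp add: J integrable_const_ivl)
    then show ?thesis
      unfolding has_integral_restrict_Int J_def by (simp only: Int_commute)
  qed
  have "integral J (\<lambda>r. 2 * M powr p) \<le> 2 * L * (2 * M powr p)"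
  proof -
    have "integral J (\<lambda>r. 2 * M powr p) = measure lborel J * (2 * M powr p)"
      unfolding J by simp
    also have "measure lborel J \<le> 2 * L"
      unfolding J by (cases "max 1 (r0 - L) \<le> min 2 (r0 + L)") (use L_nonneg in auto)
    finally show ?thesis by (simp add: mult_right_mono)
  qed
  moreover have "D \<le> lam / 2 * B + integral J (\<lambda>r. 2 * M powr p)"
    unfolding D_def B_def
    by (rule has_integral_le[OF integrable_integral[OF integrable_terms(3)]
          has_integral_add[OF has_integral_mult_right[OF integrable_integral[OF integrable_terms(2)]] int_ind]])
      (use pw in auto)
  moreover have "lam * B \<le> D" using energy_identity A_nonneg by simp
  \<comment> \<open>The constant 8 collects the length 2 L, the weight 2 and the factor 2 from
    moving lam B / 2 to the left.\<close>
  ultimately have "lam * B \<le> 8 * L * M powr p" by simp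
  also have "\<dots> \<le> 8 * (c / sqrt lam) * (K * lam) powr (q * p)"
  proof -
    have "M powr p \<le> ((K * lam) powr q) powr p" using M_K M p_gt by (intro powr_mono2) auto
    then show ?thesis unfolding powr_powr using L_c L_nonneg by (intro mult_mono) auto
  qed
  also have "\<dots> = lam * (8 * K powr (q * p) * c * (lam powr (q * p) / (sqrt lam * lam)))"
    using lam_pos Kpos by (simp add: powr_mult)
  also have "lam powr (q * p) / (sqrt lam * lam) = lam powr (q * p - 3 / 2)"
  proof -
    have "sqrt lam * lam = lam powr (1 / 2) * lam powr 1"
      using lam_pos by (simp add: powr_half_sqrt)
    also have "\<dots> = lam powr (3 / 2)" unfolding powr_add[symmetric] by simp
    finally show ?thesis by (simp add: powr_diff)
  qed
  finally have "B \<le> 8 * K powr (q * p) * c * lam powr (q * p - 3 / 2)"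
    using lam_pos by simp
  then show ?thesis by (simp add: c_def q_def)
qed

end

text \<open>Both constants are chosen from \<open>p\<close> alone, before the profile, so that one
  bound serves the whole family as lam tends to infinity.\<close>

lemma planar_mass_upper_bound:
  assumes p: "2 < p"
  shows "\<exists>C \<Lambda>. \<forall>n lam V W. planar_profile n lam p V W \<longrightarrow> \<Lambda> < lam \<longrightarrow>
    profile.B n V \<le> C * lam powr (p / (p - 2) - 3 / 2)"
proof -
  let ?K = "p + 2 * 4 powr (p - 2)" and ?\<mu> = "(p + 2) / 4"
  let ?C = "8 * ?K powr (p / (p - 2)) * (sqrt (4 * (?K / ?\<mu>) powr (1 / (p - 2)) / (?\<mu> - 1)) +
      (2 * ?K) powr (1 / (p - 2)) / sqrt ((p - 2) / (2 * p)))"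
  show ?thesis
  proof (intro exI allI impI)
    fix n lam V W
    assume P: "planar_profile n lam p V W"
      and large: "(4 * p + 2 * (sqrt (32 * 4 powr (p - 2)) + sqrt (4 * p)))\<^sup>2 < lam"
    interpret planar_profile n lam p V W by (rule P)
    show "profile.B n V \<le> ?C * lam powr (p / (p - 2) - 3 / 2)"
    proof (rule unimodal)
      fix r0 assume *: "1 < r0" "r0 < 2" "0 < V r0" "\<And>r. r \<in> {1..2} \<Longrightarrow> V r \<le> V r0" "W r0 = 0"
        "\<And>r. r0 < r \<Longrightarrow> r < 2 \<Longrightarrow> slope r \<le> 0" "\<And>r. 1 < r \<Longrightarrow> r < r0 \<Longrightarrow> 0 \<le> slope r"
      interpret peaked_profile n lam p V W r0 by unfold_locales (fact *)+
      show ?thesis by (rule mass_upper_bound[OF height_bound[OF large]])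
    qed
  qed
qed

section \<open>Integration of radial functions over the annulus\<close>

abbreviation sphere_area :: "'a::euclidean_space itself \<Rightarrow> real" where
  "sphere_area _ \<equiv> real DIM('a) * unit_ball_vol (real DIM('a))"

lemma sphere_area_pos: "sphere_area TYPE('a::euclidean_space) > 0"
  by simp

lemma annulus_eq: "annulus = ball 0 2 - cball (0::'a::euclidean_space) 1"
  by (auto simp: annulus_def)

lemma annulus_measurable [measurable]: "(annulus :: 'a::euclidean_space set) \<in> sets borel"
  unfolding annulus_eq by (intro sets.Diff) auto

lemma emeasure_shell:
  assumes "0 \<le> s" "s \<le> 2"
  shows "emeasure lborel (ball 0 2 - cball (0::'a::euclidean_space) s) =
    ennreal (unit_ball_vol DIM('a) * 2 ^ DIM('a) - unit_ball_vol DIM('a) * s ^ DIM('a))"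
proof (cases "s = 2")
  case True
  then show ?thesis by (simp add: Diff_eq_empty_iff[THEN iffD2, OF ball_subset_cball])
next
  case False
  then have "cball (0::'a) s \<subseteq> ball 0 2" using assms by auto
  then have "emeasure lborel (ball 0 2 - cball (0::'a) s) =
      emeasure lborel (ball (0::'a) 2) - emeasure lborel (cball (0::'a) s)"
    using assms by (intro emeasure_Diff) (auto simp: emeasure_cball)
  also have "\<dots> = ennreal (unit_ball_vol DIM('a) * 2 ^ DIM('a)) - ennreal (unit_ball_vol DIM('a) * s ^ DIM('a))"
    using assms by (simp add: emeasure_ball emeasure_cball)
  also have "\<dots> = ennreal (unit_ball_vol DIM('a) * 2 ^ DIM('a) - unit_ball_vol DIM('a) * s ^ DIM('a))"
    using assms by (intro ennreal_minus) simp
  finally show ?thesis .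
qed

text \<open>Only radial integrands occur, so polar coordinates reduce to the image of Lebesgue
  measure under the norm. Finite measures on the line are determined by the rays {t<..}; both sides
  give the volume of a shell, once as a difference of balls and once by integrating the area of
  spheres.\<close>

lemma distr_norm_annulus:
  "distr (density lborel (\<lambda>x. ennreal (indicator annulus x))) borel (norm :: 'a::euclidean_space \<Rightarrow> real) =
   density lborel (\<lambda>r. ennreal (indicator {1<..<2} r * (sphere_area TYPE('a) * r ^ (DIM('a) - 1))))"
  (is "?M = ?N")
proof -
  let ?\<omega> = "unit_ball_vol (real DIM('a))"
  have eq: "emeasure ?M {t<..} = ennreal (?\<omega> * 2 ^ DIM('a) - ?\<omega> * (max 1 (min t 2)) ^ DIM('a))"
    "emeasure ?N {t<..} = ennreal (?\<omega> * 2 ^ DIM('a) - ?\<omega> * (max 1 (min t 2)) ^ DIM('a))" for t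
  proof -
    \<comment> \<open>Clamping \<open>t\<close> to [1, 2] treats rays starting below, inside and
      above the range of the norm at once.\<close>
    define s where "s = max 1 (min t 2)"
    have s: "1 \<le> s" "s \<le> 2" by (auto simp: s_def)
    have "emeasure ?M {t<..} = emeasure (density lborel (\<lambda>x. ennreal (indicator annulus x))) {x::'a. t < norm x}"
      by (subst emeasure_distr) (auto intro!: arg_cong[where f = "emeasure _"])
    also have "\<dots> = emeasure lborel (annulus \<inter> {x::'a. t < norm x})"
    proof -
      have "emeasure (density lborel (\<lambda>x. ennreal (indicator annulus x))) {x::'a. t < norm x}
         = (\<integral>\<^sup>+x. ennreal (indicator annulus x) * indicator {x::'a. t < norm x} x \<partial>lborel)"
        by (rule emeasure_density) auto
      also have "\<dots> = (\<integral>\<^sup>+x. indicator (annulus \<inter> {x::'a. t < norm x}) x \<partial>lborel)"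
        by (intro nn_integral_cong) (auto split: split_indicator)
      also have "\<dots> = emeasure lborel (annulus \<inter> {x::'a. t < norm x})"
        by (rule nn_integral_indicator) auto
      finally show ?thesis .
    qed
    also have "annulus \<inter> {x::'a. t < norm x} = ball 0 2 - cball 0 s"
      by (auto simp: annulus_def s_def max_def min_def split: if_splits)
    also have "emeasure lborel \<dots> = ennreal (?\<omega> * 2 ^ DIM('a) - ?\<omega> * s ^ DIM('a))"
      using s by (intro emeasure_shell) auto
    finally show "emeasure ?M {t<..} = ennreal (?\<omega> * 2 ^ DIM('a) - ?\<omega> * (max 1 (min t 2)) ^ DIM('a))"
      by (simp only: s_def)
    have "emeasure ?N {t<..} = (\<integral>\<^sup>+r. ennreal (indicator {1<..<2} r * (sphere_area TYPE('a) * r ^ (DIM('a) - 1))) *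
        indicator {t<..} r \<partial>lborel)"
      by (rule emeasure_density) auto
    also have "\<dots> = (\<integral>\<^sup>+r. ennreal (sphere_area TYPE('a) * r ^ (DIM('a) - 1)) * indicator {s..2} r \<partial>lborel)"
    proof (rule nn_integral_cong_AE)
      have "AE r in lborel. r \<noteq> s \<and> r \<noteq> (2::real)"
        by (intro AE_conjI AE_lborel_singleton)
      then show "AE r in lborel. ennreal (indicator {1<..<2} r * (sphere_area TYPE('a) * r ^ (DIM('a) - 1))) *
        indicator {t<..} r = ennreal (sphere_area TYPE('a) * r ^ (DIM('a) - 1)) * indicator {s..2} r"
        by eventually_elim (auto simp: s_def max_def min_def split: split_indicator if_splits)
    qed
    also have "\<dots> = ennreal (?\<omega> * 2 ^ DIM('a) - ?\<omega> * s ^ DIM('a))"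
      using s by (intro nn_integral_FTC_Icc[where F = "\<lambda>r. ?\<omega> * r ^ DIM('a)"])
        (auto intro!: derivative_eq_intros)
    finally show "emeasure ?N {t<..} = ennreal (?\<omega> * 2 ^ DIM('a) - ?\<omega> * (max 1 (min t 2)) ^ DIM('a))"
      by (simp only: s_def)
  qed
  show ?thesis
  proof (rule measure_eqI_lessThan)
    fix t show "emeasure ?M {t<..} < \<infinity>" "emeasure ?M {t<..} = emeasure ?N {t<..}"
      unfolding eq by simp_all
  qed simp_all
qed

lemma polar_integral:
  fixes f :: "real \<Rightarrow> real"
  assumes [measurable]: "f \<in> borel_measurable borel"
  shows "(\<integral>x. indicator annulus x * f (norm (x::'a::euclidean_space)) \<partial>lborel) =
      sphere_area TYPE('a) * (\<integral>r. indicator {1<..<2} r * (r ^ (DIM('a) - 1) * f r) \<partial>lborel)" (is ?eq)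
    and "integrable lborel (\<lambda>x::'a. indicator annulus x * f (norm x)) \<longleftrightarrow>
      integrable lborel (\<lambda>r. indicator {1<..<2} r * (r ^ (DIM('a) - 1) * f r))" (is ?int)
proof -
  let ?M = "distr (density lborel (\<lambda>x. ennreal (indicator annulus x))) borel (norm :: 'a \<Rightarrow> real)"
  have M1: "integral\<^sup>L ?M f = (\<integral>x. indicator annulus x * f (norm (x::'a)) \<partial>lborel)"
    by (subst integral_distr) (auto simp: integral_density)
  have M2: "integrable ?M f \<longleftrightarrow> integrable lborel (\<lambda>x::'a. indicator annulus x * f (norm x))"
    by (subst integrable_distr_eq) (auto simp: integrable_density)
  have nonneg: "AE r in lborel. 0 \<le> indicator {1<..<2} r * (sphere_area TYPE('a) * r ^ (DIM('a) - 1))"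
    by (auto split: split_indicator)
  have vol: "unit_ball_vol (real DIM('a)) \<noteq> 0"
    using unit_ball_vol_pos[of "real DIM('a)"] by linarith
  have mult: "(indicator {1<..<2} r * (sphere_area TYPE('a) * r ^ (DIM('a) - 1))) *\<^sub>R f r =
      sphere_area TYPE('a) * (indicator {1<..<2} r * (r ^ (DIM('a) - 1) * f r))" for r
    by (simp add: mult_ac)
  have N1: "integral\<^sup>L ?M f = sphere_area TYPE('a) * (\<integral>r. indicator {1<..<2} r * (r ^ (DIM('a) - 1) * f r) \<partial>lborel)"
    unfolding distr_norm_annulus by (subst integral_density[OF _ _ nonneg], simp, simp) (simp only: mult integral_mult_right_zero)
  have N2: "integrable ?M f \<longleftrightarrow> integrable lborel (\<lambda>r. indicator {1<..<2} r * (r ^ (DIM('a) - 1) * f r))"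
    unfolding distr_norm_annulus
    by (subst integrable_density[OF _ _ nonneg], simp, simp) (use vol in \<open>simp only: mult integrable_mult_right_iff, simp\<close>)
  show ?eq ?int using M1 M2 N1 N2 by simp_all
qed

text \<open>\<open>f\<close> is controlled on [1, 2] only, so it is replaced by its cut-off
  \<open>?g\<close>, which is Borel and gives the same integrand on the annulus.\<close>

lemma polar_continuous:
  fixes f :: "real \<Rightarrow> real"
  assumes f: "continuous_on {1..2} f"
  shows "integrable lborel (\<lambda>x::'a::euclidean_space. indicator annulus x * f (norm x))"
    and "(\<integral>x. indicator annulus x * f (norm (x::'a)) \<partial>lborel) =
      sphere_area TYPE('a) * integral {1..2} (\<lambda>r. r ^ (DIM('a) - 1) * f r)"
proof -
  let ?g = "\<lambda>r. indicator {1<..<2} r * f r"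
  have g [measurable]: "?g \<in> borel_measurable borel"
    using borel_measurable_continuous_on_indicator[of "{1<..<2}" f] continuous_on_subset[OF f, of "{1<..<2}"]
    by (auto simp: subset_eq)
  have x: "indicator annulus x * f (norm x) = indicator annulus x * ?g (norm x)" for x :: 'a
    by (auto simp: annulus_def split: split_indicator)
  have 1: "continuous_on {1..2} (\<lambda>r. r ^ (DIM('a) - 1) * f r)" using f by (intro continuous_intros)
  then have 2: "set_integrable lborel {1..2} (\<lambda>r. r ^ (DIM('a) - 1) * f r)"
    by (intro borel_integrable_atLeastAtMost') 
  have ae: "AE r in lborel. indicator {1<..<2} r * (r ^ (DIM('a) - 1) * ?g r) =
      indicator {1..2} r *\<^sub>R (r ^ (DIM('a) - 1) * f r)"
    using AE_lborel_singleton[of 1] AE_lborel_singleton[of 2]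
    by eventually_elim (auto split: split_indicator)
  have 3: "integrable lborel (\<lambda>r. indicator {1<..<2} r * (r ^ (DIM('a) - 1) * ?g r))"
    using 2 unfolding set_integrable_def
    by (subst integrable_cong_AE[OF _ _ ae]) auto
  then show "integrable lborel (\<lambda>x::'a. indicator annulus x * f (norm x))"
    unfolding x by (subst polar_integral(2)) auto
  have "(\<integral>r. indicator {1<..<2} r * (r ^ (DIM('a) - 1) * ?g r) \<partial>lborel)
      = (LINT r:{1..2}|lborel. r ^ (DIM('a) - 1) * f r)"
    unfolding set_lebesgue_integral_def using 2
    by (intro integral_cong_AE ae) (auto simp: set_integrable_def)
  then show "(\<integral>x. indicator annulus x * f (norm (x::'a)) \<partial>lborel) =
      sphere_area TYPE('a) * integral {1..2} (\<lambda>r. r ^ (DIM('a) - 1) * f r)"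
    unfolding x polar_integral(1)[OF g] by (simp only: set_borel_integral_eq_integral(2)[OF 2])
qed

text \<open>By translation invariance the difference quotients of \<open>\<psi>\<close> along \<open>b\<close> have integral zero.\<close>

lemma integral_directional_derivative_eq_0:
  fixes \<psi> D :: "'a::euclidean_space \<Rightarrow> real"
  assumes deriv: "\<And>x. ((\<lambda>t. \<psi> (x + t *\<^sub>R b)) has_real_derivative D x) (at 0)"
    and bound: "\<And>x. \<bar>D x\<bar> \<le> L" and supp: "\<And>x. R < norm x \<Longrightarrow> \<psi> x = 0"
    and \<psi>: "integrable lborel \<psi>"
  shows "(\<integral>x. D x \<partial>lborel) = 0"
proof -
  define d where "d k x = real (Suc k) * (\<psi> (x + (1 / real (Suc k)) *\<^sub>R b) - \<psi> x)" for k x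
  have [measurable]: "\<psi> \<in> borel_measurable borel" using borel_measurable_integrable[OF \<psi>] by simp
  have shift: "integrable lborel (\<lambda>x. \<psi> (x + c))" "(\<integral>x. \<psi> (x + c) \<partial>lborel) = (\<integral>x. \<psi> x \<partial>lborel)" for c
  proof -
    have eq: "distr lborel borel (\<lambda>x. x + c) = lborel"
      using lborel_distr_plus[of c] by (simp add: add.commute[of _ c])
    show "integrable lborel (\<lambda>x. \<psi> (x + c))"
      using integrable_distr_eq[of "\<lambda>x. x + c" lborel borel \<psi>] \<psi> by (simp add: eq)
    show "(\<integral>x. \<psi> (x + c) \<partial>lborel) = (\<integral>x. \<psi> x \<partial>lborel)"
      using integral_distr[of "\<lambda>x. x + c" lborel borel \<psi>] by (simp add: eq)
  qed
  have deriv_t: "((\<lambda>t. \<psi> (x + t *\<^sub>R b)) has_real_derivative D (x + s *\<^sub>R b)) (at s)" for x s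
  proof -
    have "((\<lambda>t. \<psi> (x + s *\<^sub>R b + (t - s) *\<^sub>R b)) has_real_derivative D (x + s *\<^sub>R b) * 1) (at s)"
      by (rule DERIV_chain2[where g = "\<lambda>t. t - s"]) (auto intro!: derivative_eq_intros deriv)
    then show ?thesis by (simp add: algebra_simps)
  qed
  \<comment> \<open>The mean value theorem along the segment bounds all difference quotients by L,
    which provides the dominating function.\<close>
  have incr: "\<bar>\<psi> (x + h *\<^sub>R b) - \<psi> x\<bar> \<le> L * h" if h: "h > 0" for x h
  proof -
    obtain z where "\<psi> (x + h *\<^sub>R b) - \<psi> (x + 0 *\<^sub>R b) = (h - 0) * D (x + z *\<^sub>R b)"
      using MVT2[of 0 h "\<lambda>t. \<psi> (x + t *\<^sub>R b)" "\<lambda>t. D (x + t *\<^sub>R b)", OF h deriv_t] by blast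
    then show ?thesis using bound[of "x + z *\<^sub>R b"] that
      by (simp add: abs_mult mult.commute mult_left_mono)
  qed
  have lim: "(\<lambda>k. d k x) \<longlonglongrightarrow> D x" for x
  proof -
    have "((\<lambda>h. (\<psi> (x + (0 + h) *\<^sub>R b) - \<psi> (x + 0 *\<^sub>R b)) / h) \<longlongrightarrow> D x) (at 0)"
      using deriv[of x] by (simp add: DERIV_def)
    moreover have "filterlim (\<lambda>k. 1 / real (Suc k)) (at 0) sequentially"
      unfolding filterlim_at using LIMSEQ_inverse_real_of_nat
      by (auto simp: inverse_eq_divide)
    ultimately have "(\<lambda>k. (\<psi> (x + (0 + 1 / real (Suc k)) *\<^sub>R b) - \<psi> (x + 0 *\<^sub>R b)) / (1 / real (Suc k))) \<longlonglongrightarrow> D x"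
      by (rule filterlim_compose)
    then show ?thesis by (simp add: d_def[abs_def] mult.commute)
  qed
  have L: "L \<ge> 0" using bound[of 0] by linarith
  \<comment> \<open>The shifts have length at most norm b, so all difference quotients vanish
    outside one enlarged ball.\<close>
  have d_bound: "\<bar>d k x\<bar> \<le> L * indicator (cball 0 (\<bar>R\<bar> + norm b)) x" for k x
  proof (cases "x \<in> cball 0 (\<bar>R\<bar> + norm b)")
    case True
    have "\<bar>d k x\<bar> \<le> real (Suc k) * (L * (1 / real (Suc k)))"
      unfolding d_def abs_mult using incr[of "1 / real (Suc k)" x]
      by (intro mult_mono) auto
    then show ?thesis using True by simp
  next
    case False
    then have x: "\<bar>R\<bar> + norm b < norm x" by simp
    have "norm ((1 / real (Suc k)) *\<^sub>R b) \<le> 1 * norm b"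
      unfolding norm_scaleR by (intro mult_right_mono) auto
    moreover have "norm x \<le> norm (x + (1 / real (Suc k)) *\<^sub>R b) + norm ((1 / real (Suc k)) *\<^sub>R b)"
      by (metis add_diff_cancel_right' norm_triangle_ineq4)
    ultimately have "R < norm (x + (1 / real (Suc k)) *\<^sub>R b)" "R < norm x"
      using x norm_ge_zero[of b] abs_ge_self[of R] by linarith+
    then have "d k x = 0" unfolding d_def by (simp only: supp) simp
    then show ?thesis using L by simp
  qed
  have D_meas: "D \<in> borel_measurable lborel"
    by (rule borel_measurable_LIMSEQ_real[OF lim]) (auto simp: d_def[abs_def])
  have "(\<lambda>k. \<integral>x. d k x \<partial>lborel) \<longlonglongrightarrow> (\<integral>x. D x \<partial>lborel)"
  proof (rule integral_dominated_convergence)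
    show "integrable lborel (\<lambda>x. L * indicator (cball 0 (\<bar>R\<bar> + norm b)) x :: real)"
      by (intro integrable_mult_right integrable_real_indicator) (auto simp: emeasure_cball)
  qed (use D_meas lim d_bound in \<open>auto simp: d_def[abs_def]\<close>)
  moreover have "(\<integral>x. d k x \<partial>lborel) = 0" for k
    unfolding d_def using shift[of "(1 / real (Suc k)) *\<^sub>R b"] \<psi> by simp
  ultimately have "(\<lambda>k::nat. 0) \<longlonglongrightarrow> (\<integral>x. D x \<partial>lborel)" by simp
  then show ?thesis by (simp add: LIMSEQ_const_iff)
qed

section \<open>Smooth functions\<close>

lemma pderiv_eq: "(f has_derivative D) (at x) \<Longrightarrow> pderiv f b x = D b"
  unfolding pderiv_def using frechet_derivative_at[of f D x] by simp

lemma pderiv_real_eq: "(f has_real_derivative d) (at x) \<Longrightarrow> pderiv f 1 x = d"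
  for f :: "real \<Rightarrow> real"
  using pderiv_eq[of f "(*) d" x 1] by (simp add: has_field_derivative_def)

lemma Cinf_differentiable: "Cinf f \<Longrightarrow> f differentiable (at x)"
  unfolding Cinf_def by blast

lemma Cinf_pderiv: "Cinf f \<Longrightarrow> b \<in> Basis \<Longrightarrow> Cinf (pderiv f b)"
  unfolding Cinf_def by blast

lemma Cinf_continuous: "Cinf f \<Longrightarrow> continuous_on A f"
  by (meson Cinf_differentiable differentiable_at_imp_differentiable_on
      differentiable_imp_continuous_on)

lemma Cinf_has_derivative: "Cinf f \<Longrightarrow> (f has_derivative (\<lambda>h. pderiv f h x)) (at x)"
  using Cinf_differentiable[of f x] frechet_derivative_works[of f "at x"] unfolding pderiv_def by simp

lemma Cinf_has_real_derivative: "Cinf f \<Longrightarrow> (f has_real_derivative pderiv f 1 x) (at x)"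
  for f :: "real \<Rightarrow> real"
  by (metis Cinf_differentiable pderiv_real_eq real_differentiable_def)

text \<open>\<open>Cinf\<close> is a greatest fixed point, so smoothness is proved by exhibiting an
  invariant \<open>P\<close> stable under partial derivatives, with no induction on the
  order.\<close>

lemma Cinf_coinduct:
  assumes "P f" and step: "\<And>g. P g \<Longrightarrow> (\<forall>x. g differentiable (at x)) \<and> (\<forall>b\<in>Basis. P (pderiv g b))"
  shows "Cinf f"
  unfolding Cinf_def by (rule exI[of _ "{g. P g}"]) (use assms in auto)

lemma Cinf_real_coinduct:
  fixes f :: "real \<Rightarrow> real"
  assumes P: "P f" and step: "\<And>g. P g \<Longrightarrow> \<exists>g'. P g' \<and> (\<forall>x. (g has_real_derivative g' x) (at x))"
  shows "Cinf f"
  using P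
proof (rule Cinf_coinduct)
  fix g assume "P g"
  then obtain g' where g': "P g'" "\<And>x. (g has_real_derivative g' x) (at x)" using step by blast
  then have "pderiv g 1 = g'" using pderiv_real_eq by (intro ext) blast
  then show "(\<forall>x. g differentiable at x) \<and> (\<forall>b\<in>Basis. P (pderiv g b))"
    using g' real_differentiable_def by (auto simp: Basis_real_def)
qed

lemma Cinf_antiderivative:
  fixes f :: "real \<Rightarrow> real"
  assumes "Cinf f" "\<And>x. (F has_real_derivative f x) (at x)"
  shows "Cinf F"
proof (rule Cinf_real_coinduct[of "\<lambda>g. g = F \<or> Cinf g"])
  fix g assume "g = F \<or> Cinf g"
  then show "\<exists>g'. (g' = F \<or> Cinf g') \<and> (\<forall>x. (g has_real_derivative g' x) (at x))"
    using assms Cinf_has_real_derivative Cinf_pderiv[of g 1] by (auto simp: Basis_real_def)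
qed simp

lemma Cinf_const [simp]: "Cinf (\<lambda>x. c)"
proof (rule Cinf_coinduct[of "\<lambda>g. \<exists>c. g = (\<lambda>x. c)"])
  fix g :: "'a \<Rightarrow> real" assume "\<exists>c. g = (\<lambda>x. c)"
  moreover have "pderiv (\<lambda>x. c) b = (\<lambda>x. 0)" for c b
    by (intro ext) (rule pderiv_eq[OF has_derivative_const])
  ultimately show "(\<forall>x. g differentiable at x) \<and> (\<forall>b\<in>Basis. \<exists>c. pderiv g b = (\<lambda>x. c))"
    by auto
qed auto

lemma Cinf_lincomb:
  assumes "Cinf f" "Cinf g"
  shows "Cinf (\<lambda>x. \<alpha> * f x + \<beta> * g x)"
proof (rule Cinf_coinduct[of "\<lambda>h. \<exists>f g. Cinf f \<and> Cinf g \<and> h = (\<lambda>x. \<alpha> * f x + \<beta> * g x)"])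
  fix h assume "\<exists>f g. Cinf f \<and> Cinf g \<and> h = (\<lambda>x. \<alpha> * f x + \<beta> * g x)"
  then obtain f g where fg: "Cinf f" "Cinf g" and h: "h = (\<lambda>x. \<alpha> * f x + \<beta> * g x)" by blast
  have D: "(h has_derivative (\<lambda>v. \<alpha> * pderiv f v x + \<beta> * pderiv g v x)) (at x)" for x
    unfolding h by (intro has_derivative_add has_derivative_mult_right Cinf_has_derivative fg)
  then have "pderiv h b = (\<lambda>x. \<alpha> * pderiv f b x + \<beta> * pderiv g b x)" for b
    by (intro ext) (rule pderiv_eq)
  then show "(\<forall>x. h differentiable at x) \<and>
      (\<forall>b\<in>Basis. \<exists>f g. Cinf f \<and> Cinf g \<and> pderiv h b = (\<lambda>x. \<alpha> * f x + \<beta> * g x))"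
    using D fg Cinf_pderiv unfolding differentiable_def by blast
qed (use assms in blast)

lemma Cinf_affine:
  fixes f :: "real \<Rightarrow> real"
  assumes "Cinf f"
  shows "Cinf (\<lambda>s. f (\<alpha> * s + \<beta>))"
proof (rule Cinf_real_coinduct[of "\<lambda>h. \<exists>c f. Cinf f \<and> h = (\<lambda>s. c * f (\<alpha> * s + \<beta>))"])
  fix h assume "\<exists>c f. Cinf f \<and> h = (\<lambda>s. c * f (\<alpha> * s + \<beta>))"
  then obtain c f where f: "Cinf f" and h: "h = (\<lambda>s. c * f (\<alpha> * s + \<beta>))" by blast
  have "(h has_real_derivative c * (pderiv f 1 (\<alpha> * x + \<beta>) * \<alpha>)) (at x)" for x
    unfolding h
    by (intro DERIV_cmult DERIV_chain2[OF Cinf_has_real_derivative[OF f]])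
      (auto intro!: derivative_eq_intros)
  then have "\<forall>x. (h has_real_derivative (c * \<alpha>) * pderiv f 1 (\<alpha> * x + \<beta>)) (at x)"
    by (simp add: mult_ac)
  moreover have "Cinf (pderiv f 1)" using Cinf_pderiv[OF f] by (simp add: Basis_real_def)
  ultimately show "\<exists>g'. (\<exists>c f. Cinf f \<and> g' = (\<lambda>s. c * f (\<alpha> * s + \<beta>))) \<and>
      (\<forall>x. (h has_real_derivative g' x) (at x))" by blast
qed (use assms in \<open>auto intro!: exI[of _ 1]\<close>)

text \<open>Polynomial expressions in the generators are stable under differentiation as soon as the
  derivatives of the generators are such expressions, by the sum and product rules. This supplies
  the invariant for bumps and for radial functions.\<close>

inductive_set function_algebra :: "('a \<Rightarrow> real) set \<Rightarrow> ('a \<Rightarrow> real) set" for G where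
  generator: "g \<in> G \<Longrightarrow> g \<in> function_algebra G"
| const: "(\<lambda>x. c) \<in> function_algebra G"
| add: "f \<in> function_algebra G \<Longrightarrow> g \<in> function_algebra G \<Longrightarrow> (\<lambda>x. f x + g x) \<in> function_algebra G"
| mult: "f \<in> function_algebra G \<Longrightarrow> g \<in> function_algebra G \<Longrightarrow> (\<lambda>x. f x * g x) \<in> function_algebra G"

lemma Cinf_function_algebra:
  assumes gen: "\<And>g x. g \<in> G \<Longrightarrow> g differentiable (at x)"
    and pd: "\<And>g b. g \<in> G \<Longrightarrow> b \<in> Basis \<Longrightarrow> pderiv g b \<in> function_algebra G"
    and f: "f \<in> function_algebra G"
  shows "Cinf f"
proof (rule Cinf_coinduct[of "\<lambda>f. f \<in> function_algebra G", OF f])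
  fix f assume "f \<in> function_algebra G"
  then show "(\<forall>x. f differentiable at x) \<and> (\<forall>b\<in>Basis. pderiv f b \<in> function_algebra G)"
  proof induction
    case (generator g)
    then show ?case using gen pd by blast
  next
    case (const c)
    have "pderiv (\<lambda>x. c) b = (\<lambda>x. 0)" for b :: 'a
      by (intro ext) (rule pderiv_eq[OF has_derivative_const])
    then show ?case by (auto intro: function_algebra.const)
  next
    case (add f g)
    have D: "((\<lambda>x. f x + g x) has_derivative (\<lambda>v. pderiv f v x + pderiv g v x)) (at x)" for x
      using add.IH unfolding pderiv_def
      by (intro has_derivative_add) (simp_all flip: frechet_derivative_works)
    then have "pderiv (\<lambda>x. f x + g x) b = (\<lambda>x. pderiv f b x + pderiv g b x)" for b
      by (intro ext) (rule pderiv_eq)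
    then show ?case
      using D add.IH unfolding differentiable_def by (auto intro!: function_algebra.add)
  next
    case (mult f g)
    have D: "((\<lambda>x. f x * g x) has_derivative (\<lambda>v. f x * pderiv g v x + pderiv f v x * g x)) (at x)" for x
      using mult.IH unfolding pderiv_def
      by (intro has_derivative_mult) (simp_all flip: frechet_derivative_works)
    then have "pderiv (\<lambda>x. f x * g x) b = (\<lambda>x. f x * pderiv g b x + pderiv f b x * g x)" for b
      by (intro ext) (rule pderiv_eq)
    then show ?case
      using D mult unfolding differentiable_def
      by (auto intro!: function_algebra.add function_algebra.mult)
  qed
qed

text \<open>The generators are \<theta>(|x|) / |x|^m, with \<theta> smooth and zero for r < a,
  together with the linear functionals x \<bullet> b. Differentiation produces \<theta>' with power
  m + 1, \<theta> with power m + 2 and a factor x \<bullet> b, so it stays in the algebra. Vanishing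
  near 0 takes care of the origin, where the norm is not differentiable.\<close>

lemma Cinf_radial:
  fixes \<theta> :: "real \<Rightarrow> real"
  assumes \<theta>: "Cinf \<theta>" and a: "0 < a" and zero: "\<And>r. r < a \<Longrightarrow> \<theta> r = 0"
  shows "Cinf (\<lambda>x::'a::euclidean_space. \<theta> (norm x))"
    and "\<And>x b::'a. pderiv (\<lambda>x. \<theta> (norm x)) b x = pderiv \<theta> 1 (norm x) / norm x * (x \<bullet> b)"
proof -
  define S where "S = {\<theta>::real \<Rightarrow> real. Cinf \<theta> \<and> (\<forall>r<a. \<theta> r = 0)}"
  define gen where "gen \<theta> m = (\<lambda>x::'a. \<theta> (norm x) / norm x ^ m)" for \<theta> :: "real \<Rightarrow> real" and m :: nat
  define G where "G = {gen \<theta> m | \<theta> m. \<theta> \<in> S} \<union> range (\<lambda>b x. x \<bullet> b)"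
  have S_deriv: "pderiv \<theta> 1 \<in> S" if "\<theta> \<in> S" for \<theta>
  proof -
    have "pderiv \<theta> 1 r = 0" if "r < a" for r
    proof (rule pderiv_real_eq, rule has_field_derivative_transform_within_open[of "\<lambda>_. 0" 0 r "{..<a}"])
      show "(0::real) = \<theta> x" if "x \<in> {..<a}" for x using \<open>\<theta> \<in> S\<close> that by (auto simp: S_def)
    qed (use that in auto)
    then show ?thesis using that Cinf_pderiv[of \<theta> 1] by (auto simp: S_def Basis_real_def)
  qed
  have gen_deriv: "(gen \<theta> m has_derivative
      (\<lambda>v. (pderiv \<theta> 1 (norm x) / norm x ^ (m + 1) - real m * (\<theta> (norm x) / norm x ^ (m + 2))) * (x \<bullet> v))) (at x)"
    if \<theta>: "\<theta> \<in> S" for \<theta> m x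
  proof (cases "x = 0")
    case True
    have "pderiv \<theta> 1 0 = 0" "\<theta> 0 = 0" using \<theta> S_deriv[OF \<theta>] a by (auto simp: S_def)
    moreover have "(gen \<theta> m has_derivative (\<lambda>v. 0)) (at x)"
    proof (rule has_derivative_transform_within_open[of "\<lambda>_. 0" _ x UNIV "ball 0 a"])
      show "0 = gen \<theta> m y" if "y \<in> ball 0 a" for y
        using \<theta> that by (simp add: gen_def S_def)
    qed (use True a in auto)
    ultimately show ?thesis using True by simp
  next
    case False
    let ?r = "norm x"
    have "((\<lambda>r. \<theta> r / r ^ m) has_real_derivative
        (pderiv \<theta> 1 ?r * ?r ^ m - \<theta> ?r * (real m * ?r ^ (m - 1))) / (?r ^ m * ?r ^ m)) (at ?r)"
      using False \<theta> by (auto intro!: derivative_eq_intros Cinf_has_real_derivative simp: S_def)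
    also have "(pderiv \<theta> 1 ?r * ?r ^ m - \<theta> ?r * (real m * ?r ^ (m - 1))) / (?r ^ m * ?r ^ m) =
        pderiv \<theta> 1 ?r / ?r ^ m - real m * (\<theta> ?r / ?r ^ (m + 1))"
      using False by (cases m) (auto simp: field_simps)
    finally have "(gen \<theta> m has_derivative
        (\<lambda>v. (pderiv \<theta> 1 ?r / ?r ^ m - real m * (\<theta> ?r / ?r ^ (m + 1))) * (v \<bullet> sgn x))) (at x)"
      unfolding gen_def has_field_derivative_def
      by (rule has_derivative_compose[OF has_derivative_norm[OF False]])
    moreover have "(pderiv \<theta> 1 ?r / ?r ^ m - real m * (\<theta> ?r / ?r ^ (m + 1))) * (v \<bullet> sgn x) =
      (pderiv \<theta> 1 ?r / ?r ^ (m + 1) - real m * (\<theta> ?r / ?r ^ (m + 2))) * (x \<bullet> v)" for v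
      using False by (simp add: sgn_div_norm inner_commute field_simps)
    ultimately show ?thesis by simp
  qed
  have \<theta>S: "\<theta> \<in> S" using \<theta> zero by (simp add: S_def)
  have gen0: "gen \<theta> 0 = (\<lambda>x. \<theta> (norm x))" by (simp add: gen_def)
  show "pderiv (\<lambda>x. \<theta> (norm x)) b x = pderiv \<theta> 1 (norm x) / norm x * (x \<bullet> b)" for x b :: 'a
    using pderiv_eq[OF gen_deriv[OF \<theta>S, of 0 x], of b] unfolding gen0 by simp
  have lin: "pderiv (\<lambda>x::'a. x \<bullet> c) b = (\<lambda>x. b \<bullet> c)" for b c
    by (intro ext pderiv_eq has_derivative_inner_left has_derivative_ident)
  have "gen \<theta> 0 \<in> function_algebra G"
    by (intro function_algebra.generator) (use \<theta>S in \<open>auto simp: G_def\<close>)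
  moreover have "g differentiable (at x)" if "g \<in> G" for g x
    using that gen_deriv has_derivative_inner_left[OF has_derivative_ident]
    unfolding G_def differentiable_def by blast
  moreover have "pderiv g b \<in> function_algebra G" if "g \<in> G" "b \<in> Basis" for g b
  proof -
    from that(1) consider \<theta> m where "\<theta> \<in> S" "g = gen \<theta> m" | c where "g = (\<lambda>x. x \<bullet> c)"
      unfolding G_def by blast
    then show ?thesis
    proof cases
      case 1
      have "pderiv g b = (\<lambda>x. (gen (pderiv \<theta> 1) (m + 1) x + (- real m) * gen \<theta> (m + 2) x) * (x \<bullet> b))"
        using pderiv_eq[OF gen_deriv[OF 1(1)]] 1 by (intro ext) (simp add: gen_def)
      moreover have "\<dots> \<in> function_algebra G"
        by (intro function_algebra.mult function_algebra.add function_algebra.const function_algebra.generator)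
          (use 1 S_deriv in \<open>auto simp: G_def\<close>)
      ultimately show ?thesis by simp
    next
      case 2
      then show ?thesis using lin function_algebra.const by metis
    qed
  qed
  ultimately show "Cinf (\<lambda>x::'a. \<theta> (norm x))"
    using Cinf_function_algebra[of G "gen \<theta> 0"] unfolding gen0 by blast
qed

lemma test_fun_radial:
  fixes \<theta> :: "real \<Rightarrow> real"
  assumes \<theta>: "Cinf \<theta>" and ab: "1 < a" "b < 2" and zero: "\<And>r. r < a \<or> b < r \<Longrightarrow> \<theta> r = 0"
  shows "test_fun annulus (\<lambda>x::'a::euclidean_space. \<theta> (norm x))"
proof -
  have "{x::'a. \<theta> (norm x) \<noteq> 0} \<subseteq> {x. a \<le> norm x} \<inter> cball 0 b"
    using zero by force
  moreover have "closed ({x::'a. a \<le> norm x} \<inter> cball 0 b)"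
    by (intro closed_Int closed_Collect_le continuous_intros closed_cball)
  ultimately have *: "closure {x::'a. \<theta> (norm x) \<noteq> 0} \<subseteq> {x. a \<le> norm x} \<inter> cball 0 b"
    by (rule closure_minimal)
  then have "bounded (closure {x::'a. \<theta> (norm x) \<noteq> 0})"
    using bounded_subset[OF bounded_cball, of _ 0 b] by blast
  then have "compact (closure {x::'a. \<theta> (norm x) \<noteq> 0})"
    by (simp add: compact_eq_bounded_closed)
  moreover have "closure {x::'a. \<theta> (norm x) \<noteq> 0} \<subseteq> annulus"
    using * ab by (force simp: annulus_def)
  ultimately show ?thesis
    unfolding test_fun_def using Cinf_radial(1)[OF \<theta>, of a] ab zero by auto
qed

section \<open>A smooth bump and its antiderivatives\<close>

definition flat_exp :: "nat \<Rightarrow> real \<Rightarrow> real" where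
  "flat_exp k x = (if x > 0 then exp (- 1 / x) / x ^ k else 0)"

text \<open>A single term of the exponential series gives 1 / ((k+2)! x^(k+2)) \<le> exp (1/x). The
  two spare powers of x make the difference quotient at 0 tend to 0.\<close>

lemma flat_exp_le: "\<bar>flat_exp k x\<bar> \<le> fact (k + 2) * x\<^sup>2"
proof (cases "x > 0")
  case True
  define c :: real where "c = fact (k + 2)"
  have c: "c > 0" by (simp add: c_def)
  have "(\<Sum>i\<in>{k + 2}. inverse (fact i) *\<^sub>R (1 / x) ^ i) \<le> (\<Sum>i. inverse (fact i) *\<^sub>R (1 / x) ^ i)"
    using True by (intro sum_le_suminf summable_exp_generic) auto
  then have "1 / (c * x ^ (k + 2)) \<le> exp (1 / x)"
    unfolding c_def by (simp add: exp_def divide_inverse power_mult_distrib power_inverse)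
  then have "exp (- 1 / x) \<le> c * x ^ (k + 2)"
    using True c by (simp add: exp_minus divide_le_eq inverse_le_iff field_simps)
  then have "exp (- 1 / x) / x ^ k \<le> c * x\<^sup>2"
    using True by (simp add: pos_divide_le_eq power_add power2_eq_square mult_ac)
  then show ?thesis using True by (simp add: flat_exp_def c_def)
qed (simp add: flat_exp_def)

text \<open>The denominator x^k is in the definition for the sake of this formula: the derivative is
  a linear combination of members of the same family, also at 0.\<close>

lemma deriv_flat_exp:
  "(flat_exp k has_real_derivative flat_exp (k + 2) x - real k * flat_exp (k + 1) x) (at x)"
proof -
  consider "x > 0" | "x < 0" | "x = 0" by linarith
  then show ?thesis
  proof cases
    case 1
    have "((\<lambda>x. exp (- 1 / x) / x ^ k) has_real_derivative
        (exp (- 1 / x) * (1 / (x * x)) * x ^ k - exp (- 1 / x) * (real k * x ^ (k - 1))) / (x ^ k * x ^ k)) (at x)"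
      using 1 by (auto intro!: derivative_eq_intros)
    also have "(exp (- 1 / x) * (1 / (x * x)) * x ^ k - exp (- 1 / x) * (real k * x ^ (k - 1))) / (x ^ k * x ^ k)
        = flat_exp (k + 2) x - real k * flat_exp (k + 1) x"
      using 1 by (cases k) (auto simp: flat_exp_def field_simps)
    finally show ?thesis
      by (rule has_field_derivative_transform_within_open[of _ _ _ "{0<..}"])
        (use 1 in \<open>auto simp: flat_exp_def\<close>)
  next
    case 2
    have "(flat_exp k has_real_derivative 0) (at x)"
      by (rule has_field_derivative_transform_within_open[of "\<lambda>_. 0" _ _ "{..<0}"])
        (use 2 in \<open>auto simp: flat_exp_def\<close>)
    then show ?thesis using 2 by (simp add: flat_exp_def)
  next
    case 3
    have "((\<lambda>h. flat_exp k h / h) \<longlongrightarrow> 0) (at 0)"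
    proof (rule Lim_null_comparison)
      show "\<forall>\<^sub>F h in at 0. norm (flat_exp k h / h) \<le> fact (k + 2) * \<bar>h\<bar>"
      proof (rule always_eventually, rule allI)
        fix h :: real
        show "norm (flat_exp k h / h) \<le> fact (k + 2) * \<bar>h\<bar>"
        proof (cases "h = 0")
          case False
          have "\<bar>flat_exp k h\<bar> \<le> fact (k + 2) * \<bar>h\<bar> * \<bar>h\<bar>"
            using flat_exp_le[of k h] by (simp only: power2_eq_square abs_mult_self_eq mult.assoc)
          then show ?thesis using False by (simp only: real_norm_def abs_divide) (simp add: pos_divide_le_eq)
        qed simp
      qed
      show "((\<lambda>h. fact (k + 2) * \<bar>h\<bar>) \<longlongrightarrow> (0::real)) (at 0)"
        by (auto intro!: tendsto_eq_intros)
    qed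
    then have "(flat_exp k has_real_derivative 0) (at 0)"
      by (simp add: DERIV_def flat_exp_def)
    then show ?thesis using 3 by (simp add: flat_exp_def)
  qed
qed

definition bump :: "real \<Rightarrow> real" where
  "bump s = flat_exp 0 (s + 1) * flat_exp 0 (1 - s)"

lemma bump_nonneg: "0 \<le> bump s"
  by (simp add: bump_def flat_exp_def)

lemma bump_eq_0: "1 \<le> \<bar>s\<bar> \<Longrightarrow> bump s = 0"
  by (auto simp: bump_def flat_exp_def abs_if split: if_splits)

lemma bump_0: "0 < bump 0"
  by (simp add: bump_def flat_exp_def)

lemma Cinf_bump: "Cinf bump"
proof -
  define G where "G = range (\<lambda>k s. flat_exp k (s + 1)) \<union> range (\<lambda>k s. flat_exp k (1 - s))"
  have d1: "((\<lambda>s. flat_exp k (s + 1)) has_real_derivative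
      flat_exp (k + 2) (s + 1) + (- real k) * flat_exp (k + 1) (s + 1)) (at s)" for k s
  proof -
    have "((\<lambda>s. s + 1) has_real_derivative 1) (at s)" by (auto intro!: derivative_eq_intros)
    from DERIV_chain2[OF deriv_flat_exp this, of k] show ?thesis by simp
  qed
  have d2: "((\<lambda>s. flat_exp k (1 - s)) has_real_derivative
      (- 1) * flat_exp (k + 2) (1 - s) + real k * flat_exp (k + 1) (1 - s)) (at s)" for k s
  proof -
    have "((\<lambda>s. 1 - s) has_real_derivative - 1) (at s)" by (auto intro!: derivative_eq_intros)
    from DERIV_chain2[OF deriv_flat_exp this, of k] show ?thesis by simp
  qed
  have in1: "(\<lambda>s. flat_exp k (s + 1)) \<in> function_algebra G" "(\<lambda>s. flat_exp k (1 - s)) \<in> function_algebra G" for k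
    by (auto intro!: function_algebra.generator simp: G_def)
  have p1: "pderiv (\<lambda>s. flat_exp k (s + 1)) 1 =
      (\<lambda>s. flat_exp (k + 2) (s + 1) + (- real k) * flat_exp (k + 1) (s + 1))" for k
    using pderiv_real_eq[OF d1] by (intro ext)
  have p2: "pderiv (\<lambda>s. flat_exp k (1 - s)) 1 =
      (\<lambda>s. (- 1) * flat_exp (k + 2) (1 - s) + real k * flat_exp (k + 1) (1 - s))" for k
    using pderiv_real_eq[OF d2] by (intro ext)
  show ?thesis
  proof (rule Cinf_function_algebra[of G])
    show "g differentiable at x" if "g \<in> G" for g x
      using that d1 d2 unfolding G_def real_differentiable_def by blast
    have "pderiv (\<lambda>s. flat_exp k (s + 1)) 1 \<in> function_algebra G"
      "pderiv (\<lambda>s. flat_exp k (1 - s)) 1 \<in> function_algebra G" for k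
      unfolding p1 p2
      by (intro function_algebra.add function_algebra.mult[OF function_algebra.const] in1)+
    then show "pderiv g b \<in> function_algebra G" if "g \<in> G" "b \<in> Basis" for g b
      using that by (auto simp: Basis_real_def G_def)
    show "bump \<in> function_algebra G"
      unfolding bump_def[abs_def] by (intro function_algebra.mult in1)
  qed
qed

text \<open>The integral starts at a - 1, inside the zero region, so that every x \<ge> a is
  interior to an interval of integration and has a two-sided derivative; to the left of
  \<open>a\<close> the antiderivative is locally 0.\<close>

lemma antiderivative_from_left:
  fixes f :: "real \<Rightarrow> real"
  assumes cont: "continuous_on UNIV f" and zero: "\<And>x. x \<le> a \<Longrightarrow> f x = 0"
  obtains F where "\<And>x. (F has_real_derivative f x) (at x)" "\<And>x. x \<le> a \<Longrightarrow> F x = 0"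
proof
  let ?F = "\<lambda>x. integral {a - 1..x} f"
  show F0: "?F x = 0" if "x \<le> a" for x
    using that zero by (intro integral_unique has_integral_is_0) auto
  show "(?F has_real_derivative f x) (at x)" for x
  proof (cases "x < a")
    case True
    have "(?F has_real_derivative 0) (at x)"
      by (rule has_field_derivative_transform_within_open[of "\<lambda>_. 0" _ _ "{..<a}"])
        (use True F0 in auto)
    then show ?thesis using zero True by simp
  next
    case False
    have "(?F has_real_derivative f x) (at x within {a - 1..x + 1})"
      using False by (intro integral_has_real_derivative continuous_on_subset[OF cont]) auto
    then show ?thesis using False by (simp add: at_within_Icc_at)
  qed
qed

text \<open>Kept as an explicit constant in place of normalising the bump.\<close>

definition bump_mass :: real where "bump_mass = integral {- 1..1} bump"

lemma continuous_bump: "continuous_on A bump"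
  by (rule Cinf_continuous[OF Cinf_bump])

lemma bump_mass_pos: "bump_mass > 0"
proof -
  have "bump_mass \<ge> 0" unfolding bump_mass_def
    by (intro integral_nonneg integrable_continuous_real continuous_bump bump_nonneg)
  moreover have "bump_mass \<noteq> 0"
  proof
    assume "bump_mass = 0"
    then have "(bump has_integral 0) (cbox (- 1) 1)"
      using integrable_integral[OF integrable_continuous_real[OF continuous_bump], of "- 1" 1]
      by (simp add: bump_mass_def)
    then have "bump 0 = 0"
      by (rule has_integral_0_cbox_imp_0[OF continuous_bump bump_nonneg]) auto
    then show False using bump_0 by simp
  qed
  ultimately show ?thesis by simp
qed

text \<open>The second antiderivative \<open>R\<close> is 0 to the left of the support and affine to
  the right. A second difference of its translates thus has compact support, while its second
  derivative is a second difference of bumps; this is the test function for weak second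
  derivatives.\<close>

lemma bump_antiderivatives:
  obtains R1 R c where "\<And>s. (R1 has_real_derivative bump s) (at s)" "\<And>s. (R has_real_derivative R1 s) (at s)"
    "\<And>s. s \<le> - 1 \<Longrightarrow> R1 s = 0" "\<And>s. s \<le> - 1 \<Longrightarrow> R s = 0"
    "\<And>s. 1 \<le> s \<Longrightarrow> R1 s = bump_mass" "\<And>s. 1 \<le> s \<Longrightarrow> R s = c + bump_mass * s"
proof -
  obtain R1 where R1: "\<And>s. (R1 has_real_derivative bump s) (at s)" "\<And>s. s \<le> - 1 \<Longrightarrow> R1 s = 0"
    by (rule antiderivative_from_left[OF continuous_bump, of "- 1"]) (auto simp: bump_eq_0)
  have cR1: "continuous_on A R1" for A
    using R1(1) by (meson DERIV_isCont continuous_at_imp_continuous_on)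
  obtain R where R: "\<And>s. (R has_real_derivative R1 s) (at s)" "\<And>s. s \<le> - 1 \<Longrightarrow> R s = 0"
    by (rule antiderivative_from_left[OF cR1, of "- 1"]) (auto simp: R1)
  have cR: "continuous_on A R" for A
    using R(1) by (meson DERIV_isCont continuous_at_imp_continuous_on)
  have "(bump has_integral R1 1 - R1 (- 1)) {- 1..1}"
    by (rule fundamental_theorem_of_calculus)
      (auto intro: has_field_derivative_at_within R1 simp flip: has_real_derivative_iff_has_vector_derivative)
  then have R11: "R1 1 = bump_mass" using R1(2)[of "- 1"] by (simp add: bump_mass_def integral_unique)
  have R1_const: "R1 s = R1 1" if "1 \<le> s" for s
  proof (cases "s = 1")
    case False
    show ?thesis
    proof (rule DERIV_isconst_end[of 1 s R1])
      show "DERIV R1 x :> 0" if "1 < x" "x < s" for x using R1(1)[of x] bump_eq_0[of x] that by simp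
    qed (use that False cR1 in auto)
  qed simp
  have R1_mass: "R1 s = bump_mass" if "1 \<le> s" for s
    using R1_const[OF that] R11 by (rule trans)
  have "R s = (R 1 - bump_mass) + bump_mass * s" if "1 \<le> s" for s
  proof (cases "s = 1")
    case False
    have "R s - bump_mass * s = R 1 - bump_mass * 1"
    proof (rule DERIV_isconst_end[of 1 s "\<lambda>s. R s - bump_mass * s"])
      show "((\<lambda>s. R s - bump_mass * s) has_real_derivative 0) (at x)" if "1 < x" "x < s" for x
        using that R1_mass[of x] by (auto intro!: derivative_eq_intros R)
    qed (use that False cR in \<open>auto intro!: continuous_intros\<close>)
    then show ?thesis by simp
  qed simp
  then show ?thesis using that R1 R R1_mass by blast
qed

section \<open>Mollification and vanishing weak second derivatives\<close>

lemma mollifier_limit: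
  fixes G :: "real \<Rightarrow> real"
  assumes G: "continuous_on {1..2} G" and \<tau>: "1 < \<tau>" "\<tau> < 2"
  shows "((\<lambda>\<epsilon>. integral {1..2} (\<lambda>s. G s * (bump ((s - \<tau>) / \<epsilon>) / \<epsilon>))) \<longlongrightarrow> bump_mass * G \<tau>) (at_right 0)"
proof (rule tendstoI)
  fix e :: real assume e: "e > 0"
  obtain R1 R c where R1: "\<And>s. (R1 has_real_derivative bump s) (at s)"
    "\<And>s. s \<le> - 1 \<Longrightarrow> R1 s = 0" "\<And>s. 1 \<le> s \<Longrightarrow> R1 s = bump_mass"
    using bump_antiderivatives by metis
  define e' where "e' = e / (2 * bump_mass)"
  have e': "e' > 0" "e' * bump_mass < e" using e bump_mass_pos by (auto simp: e'_def)
  have "continuous (at \<tau>) G"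
    using continuous_on_interior[OF G] \<tau> by (simp add: interior_atLeastAtMost_real)
  then obtain d0 where d0: "d0 > 0" "\<And>s. \<bar>s - \<tau>\<bar> < d0 \<Longrightarrow> \<bar>G s - G \<tau>\<bar> < e'"
    using e'(1) unfolding continuous_at_eps_delta dist_real_def by blast
  define d where "d = min d0 (min (\<tau> - 1) (2 - \<tau>))"
  have d: "d > 0" "d \<le> d0" "d \<le> \<tau> - 1" "d \<le> 2 - \<tau>" using d0 \<tau> by (auto simp: d_def)
  have "dist (integral {1..2} (\<lambda>s. G s * (bump ((s - \<tau>) / \<epsilon>) / \<epsilon>))) (bump_mass * G \<tau>) < e"
    if \<epsilon>: "0 < \<epsilon>" "\<epsilon> < d" for \<epsilon>
  proof -
    let ?\<rho> = "\<lambda>s. bump ((s - \<tau>) / \<epsilon>) / \<epsilon>"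
    have cont: "continuous_on {1..2} ?\<rho>"
      using \<epsilon> by (intro continuous_intros continuous_on_compose2[OF continuous_bump]) auto
    have "(?\<rho> has_integral R1 ((2 - \<tau>) / \<epsilon>) - R1 ((1 - \<tau>) / \<epsilon>)) {1..2}"
    proof (rule fundamental_theorem_of_calculus)
      fix s :: real
      have "((\<lambda>s. R1 ((s - \<tau>) / \<epsilon>)) has_real_derivative bump ((s - \<tau>) / \<epsilon>) * (1 / \<epsilon>)) (at s within {1..2})"
        by (rule DERIV_chain2[OF R1(1)]) (use \<epsilon> in \<open>auto intro!: derivative_eq_intros\<close>)
      then show "((\<lambda>s. R1 ((s - \<tau>) / \<epsilon>)) has_vector_derivative ?\<rho> s) (at s within {1..2})"
        by (simp add: has_real_derivative_iff_has_vector_derivative)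
    qed auto
    moreover have "R1 ((2 - \<tau>) / \<epsilon>) = bump_mass" "R1 ((1 - \<tau>) / \<epsilon>) = 0"
      using \<epsilon> d by (auto intro!: R1 simp: field_simps)
    ultimately have I\<rho>: "(?\<rho> has_integral bump_mass) {1..2}" by simp
    have IG: "((\<lambda>s. G s * ?\<rho> s) has_integral integral {1..2} (\<lambda>s. G s * ?\<rho> s)) {1..2}"
      by (intro integrable_integral integrable_continuous_real continuous_on_mult G cont)
    have Idiff: "((\<lambda>s. G s * ?\<rho> s - G \<tau> * ?\<rho> s) has_integral
        (integral {1..2} (\<lambda>s. G s * ?\<rho> s) - G \<tau> * bump_mass)) {1..2}"
      by (intro has_integral_diff IG has_integral_mult_right I\<rho>)
    have pw: "\<bar>G s * ?\<rho> s - G \<tau> * ?\<rho> s\<bar> \<le> e' * ?\<rho> s" for s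
    proof (cases "\<bar>s - \<tau>\<bar> < d0")
      case True
      have "\<bar>G s * ?\<rho> s - G \<tau> * ?\<rho> s\<bar> = \<bar>G s - G \<tau>\<bar> * ?\<rho> s"
        using bump_nonneg[of "(s - \<tau>) / \<epsilon>"] \<epsilon> by (simp add: abs_mult flip: left_diff_distrib diff_divide_distrib)
      also have "\<dots> \<le> e' * ?\<rho> s"
        using d0(2)[OF True] bump_nonneg[of "(s - \<tau>) / \<epsilon>"] \<epsilon> by (intro mult_right_mono) auto
      finally show ?thesis .
    next
      case False
      then have "1 \<le> \<bar>(s - \<tau>) / \<epsilon>\<bar>" using \<epsilon> d by (simp add: abs_divide le_divide_eq)
      then show ?thesis using bump_eq_0 by simp
    qed
    have "norm (integral {1..2} (\<lambda>s. G s * ?\<rho> s - G \<tau> * ?\<rho> s)) \<le> integral {1..2} (\<lambda>s. e' * ?\<rho> s)"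
      by (rule integral_norm_bound_integral)
        (use has_integral_integrable[OF Idiff] has_integral_integrable[OF has_integral_mult_right[OF I\<rho>, of e']] pw
          in \<open>simp_all only: real_norm_def\<close>)
    also have "\<dots> = e' * bump_mass" using has_integral_mult_right[OF I\<rho>] by (rule integral_unique)
    finally show ?thesis
      unfolding integral_unique[OF Idiff] using e' by (simp add: dist_real_def mult.commute)
  qed
  then show "\<forall>\<^sub>F \<epsilon> in at_right 0.
      dist (integral {1..2} (\<lambda>s. G s * (bump ((s - \<tau>) / \<epsilon>) / \<epsilon>))) (bump_mass * G \<tau>) < e"
    unfolding eventually_at_right_field using d(1) by blast
qed

text \<open>A discrete maximum principle. At an interior maximum \<open>t\<close> the step reaches
  the nearer endpoint, where f vanishes; then 2 f t equals one value of f, which is at most f t, so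
  f t cannot be positive.\<close>

lemma midpoint_zero_boundary_le:
  fixes f :: "real \<Rightarrow> real"
  assumes f: "continuous_on {1..2} f" "f 1 = 0" "f 2 = 0"
    and mid: "\<And>t h. 0 < h \<Longrightarrow> 1 \<le> t - h \<Longrightarrow> t + h \<le> 2 \<Longrightarrow> f (t + h) - 2 * f t + f (t - h) = 0"
    and r: "r \<in> {1..2}"
  shows "f r \<le> 0"
proof (rule ccontr)
  assume "\<not> f r \<le> 0"
  obtain t where t: "t \<in> {1..2}" "\<And>x. x \<in> {1..2} \<Longrightarrow> f x \<le> f t"
    using continuous_attains_sup[of "{1..2::real}" f] f by auto
  have pos: "f t > 0" using t(2)[OF r] \<open>\<not> f r \<le> 0\<close> by simp
  then have t': "1 < t" "t < 2" using t(1) f by (auto simp: less_le)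
  show False
  proof (cases "t - 1 \<le> 2 - t")
    case True
    then show False using mid[of "t - 1" t] t' t(2)[of "2 * t - 1"] pos f(2) by simp
  next
    case False
    then show False using mid[of "2 - t" t] t' t(2)[of "2 * t - 2"] pos f(3) by simp
  qed
qed

text \<open>A second-order du Bois-Reymond lemma. Testing with second differences of
  \<open>R\<close> at scale \<epsilon> and letting \<epsilon> tend to 0 shows that all second
  differences of \<open>G\<close> vanish; the discrete maximum principle, applied to
  \<open>G\<close> minus its chord in both signs, leaves only the chord.\<close>

lemma weak_second_derivative_zero_imp_affine:
  fixes G :: "real \<Rightarrow> real"
  assumes G: "continuous_on {1..2} G"
    and weak: "\<And>\<theta> a b. Cinf \<theta> \<Longrightarrow> 1 < a \<Longrightarrow> b < 2 \<Longrightarrow> (\<And>r. r < a \<or> b < r \<Longrightarrow> \<theta> r = 0) \<Longrightarrow>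
      integral {1..2} (\<lambda>r. G r * pderiv (pderiv \<theta> 1) 1 r) = 0"
  obtains \<alpha> \<beta> where "\<And>r. r \<in> {1..2} \<Longrightarrow> G r = \<alpha> + \<beta> * r"
proof -
  obtain R1 R c where R1: "\<And>s. (R1 has_real_derivative bump s) (at s)"
    and R: "\<And>s. (R has_real_derivative R1 s) (at s)" "\<And>s. s \<le> - 1 \<Longrightarrow> R s = 0"
      "\<And>s. 1 \<le> s \<Longrightarrow> R s = c + bump_mass * s"
    using bump_antiderivatives by metis
  have R_Cinf: "Cinf R" by (rule Cinf_antiderivative[OF Cinf_antiderivative[OF Cinf_bump R1] R(1)])
  have open_mid: "G (t + h) - 2 * G t + G (t - h) = 0" if h: "0 < h" "1 < t - h" "t + h < 2" for t h
  proof -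
    let ?I = "\<lambda>\<tau> \<epsilon>. integral {1..2} (\<lambda>s. G s * (bump ((s - \<tau>) / \<epsilon>) / \<epsilon>))"
    let ?\<Delta> = "\<lambda>f. f (t + h) - 2 * f t + f (t - h) :: real"
    have lim: "((\<lambda>\<epsilon>. ?\<Delta> (\<lambda>\<tau>. ?I \<tau> \<epsilon>)) \<longlongrightarrow> ?\<Delta> (\<lambda>\<tau>. bump_mass * G \<tau>)) (at_right 0)"
      using h by (intro tendsto_intros mollifier_limit G) auto
    \<comment> \<open>For \<epsilon> < d the three bumps at t - h, t and t + h stay inside (1,
      2).\<close>
    define d where "d = min (t - h - 1) (2 - t - h)"
    have d: "d > 0" using h by (auto simp: d_def)
    have zero: "?\<Delta> (\<lambda>\<tau>. ?I \<tau> \<epsilon>) = 0" if \<epsilon>: "0 < \<epsilon>" "\<epsilon> < d" for \<epsilon>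
    proof -
      have shift: "R ((s - \<tau>) / \<epsilon>) = R (1 / \<epsilon> * s + - \<tau> / \<epsilon>)" for s \<tau>
        by (simp add: diff_divide_distrib)
      \<comment> \<open>The factor \<epsilon> cancels one of the two inner derivatives 1/\<epsilon>,
        so that the second derivative carries the kernel bump(s/\<epsilon>)/\<epsilon> of the
        mollifier.\<close>
      define \<theta> where "\<theta> s = \<epsilon> * ?\<Delta> (\<lambda>\<tau>. R ((s - \<tau>) / \<epsilon>))" for s
      define \<theta>1 where "\<theta>1 s = ?\<Delta> (\<lambda>\<tau>. R1 ((s - \<tau>) / \<epsilon>))" for s
      define \<theta>2 where "\<theta>2 s = ?\<Delta> (\<lambda>\<tau>. bump ((s - \<tau>) / \<epsilon>)) / \<epsilon>" for s
      have inner: "((\<lambda>s. (s - \<tau>) / \<epsilon>) has_real_derivative 1 / \<epsilon>) (at s)" for s \<tau>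
        using \<epsilon> by (auto intro!: derivative_eq_intros)
      have "(\<theta> has_real_derivative \<epsilon> * ?\<Delta> (\<lambda>\<tau>. R1 ((s - \<tau>) / \<epsilon>) * (1 / \<epsilon>))) (at s)" for s
        unfolding \<theta>_def[abs_def]
        by (intro DERIV_cmult DERIV_add DERIV_diff DERIV_chain2[OF R(1) inner])
      moreover have "\<epsilon> * (a * (1 / \<epsilon>) - 2 * (b * (1 / \<epsilon>)) + c * (1 / \<epsilon>)) = a - 2 * b + c" for a b c :: real
        using \<epsilon> by (simp add: field_simps)
      ultimately have \<theta>1: "(\<theta> has_real_derivative \<theta>1 s) (at s)" for s
        unfolding \<theta>1_def by simp
      have "(\<theta>1 has_real_derivative ?\<Delta> (\<lambda>\<tau>. bump ((s - \<tau>) / \<epsilon>) * (1 / \<epsilon>))) (at s)" for s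
        unfolding \<theta>1_def[abs_def]
        by (intro DERIV_cmult DERIV_add DERIV_diff DERIV_chain2[OF R1 inner])
      then have \<theta>2: "(\<theta>1 has_real_derivative \<theta>2 s) (at s)" for s
        using \<epsilon> by (simp add: \<theta>2_def add_divide_distrib diff_divide_distrib)
      have "Cinf (\<lambda>s. 1 * (1 * R ((s - (t + h)) / \<epsilon>) + (- 2) * R ((s - t) / \<epsilon>)) + 1 * R ((s - (t - h)) / \<epsilon>))"
        unfolding shift by (intro Cinf_lincomb Cinf_affine R_Cinf)
      from Cinf_lincomb[OF this Cinf_const[of 0], of \<epsilon> 0]
      have "Cinf \<theta>" by (simp add: \<theta>_def[abs_def])
      moreover have "\<theta> r = 0" if r: "r < t - h - \<epsilon> \<or> t + h + \<epsilon> < r" for r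
        using r
      proof
        assume "r < t - h - \<epsilon>"
        then have "(r - (t + h)) / \<epsilon> \<le> - 1" "(r - t) / \<epsilon> \<le> - 1" "(r - (t - h)) / \<epsilon> \<le> - 1"
          using \<epsilon> h by (auto simp: divide_le_eq)
        then show ?thesis by (simp add: \<theta>_def R)
      next
        \<comment> \<open>To the right of all three supports \<open>R\<close> is affine, and second
          differences of affine functions vanish.\<close>
        assume "t + h + \<epsilon> < r"
        then have "1 \<le> (r - (t + h)) / \<epsilon>" "1 \<le> (r - t) / \<epsilon>" "1 \<le> (r - (t - h)) / \<epsilon>"
          using \<epsilon> h by (auto simp: le_divide_eq)
        then show ?thesis using \<epsilon> by (simp add: \<theta>_def R field_simps)
      qed
      moreover have "pderiv \<theta> 1 = \<theta>1" using \<theta>1 by (intro ext pderiv_real_eq)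
      moreover have "pderiv \<theta>1 1 = \<theta>2" using \<theta>2 by (intro ext pderiv_real_eq)
      ultimately have 0: "integral {1..2} (\<lambda>r. G r * \<theta>2 r) = 0"
        using weak[of \<theta> "t - h - \<epsilon>" "t + h + \<epsilon>"] \<epsilon> by (simp add: d_def)
      have I: "((\<lambda>s. ?\<Delta> (\<lambda>\<tau>. G s * (bump ((s - \<tau>) / \<epsilon>) / \<epsilon>))) has_integral (?\<Delta> (\<lambda>\<tau>. ?I \<tau> \<epsilon>))) {1..2}"
        using \<epsilon> by (intro has_integral_add has_integral_diff has_integral_mult_right integrable_integral
            integrable_continuous_real continuous_intros G continuous_on_compose2[OF continuous_bump]) auto
      have "(\<lambda>s. ?\<Delta> (\<lambda>\<tau>. G s * (bump ((s - \<tau>) / \<epsilon>) / \<epsilon>))) = (\<lambda>r. G r * \<theta>2 r)"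
        using \<epsilon> by (intro ext) (simp add: \<theta>2_def field_simps)
      from integral_unique[OF I[unfolded this]] 0 show ?thesis by (rule trans[OF sym])
    qed
    have "\<forall>\<^sub>F \<epsilon> in at_right 0. ?\<Delta> (\<lambda>\<tau>. ?I \<tau> \<epsilon>) = 0"
      unfolding eventually_at_right_field using zero d by blast
    then have "((\<lambda>\<epsilon>. ?\<Delta> (\<lambda>\<tau>. ?I \<tau> \<epsilon>)) \<longlongrightarrow> 0) (at_right 0)"
      by (rule tendsto_eventually)
    then have "?\<Delta> (\<lambda>\<tau>. bump_mass * G \<tau>) = 0"
      using tendsto_unique[OF _ lim] by simp
    then have "bump_mass * (G (t + h) - 2 * G t + G (t - h)) = 0" by (simp add: algebra_simps)
    then show ?thesis using bump_mass_pos by simp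
  qed
  \<comment> \<open>Steps touching the endpoints are reached by scaling \<open>h\<close> with
    \<kappa> < 1 and letting \<kappa> tend to 1.\<close>
  have mid: "G (t + h) - 2 * G t + G (t - h) = 0" if h: "0 < h" "1 \<le> t - h" "t + h \<le> 2" for t h
  proof -
    have bnd: "t + \<kappa> * h \<in> {1..2}" "t - \<kappa> * h \<in> {1..2}" if "\<kappa> \<in> {0..1}" for \<kappa>
    proof -
      have "\<kappa> * h \<le> 1 * h" "0 \<le> \<kappa> * h" using that h by (intro mult_right_mono mult_nonneg_nonneg; simp)+
      then show "t + \<kappa> * h \<in> {1..2}" "t - \<kappa> * h \<in> {1..2}"
        using h unfolding atLeastAtMost_iff by linarith+
    qed
    have "G (t + 1 * h) - 2 * G t + G (t - 1 * h) = 0"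
    proof (rule continuous_constant_on_closure[of "{0<..<1}" "\<lambda>\<kappa>. G (t + \<kappa> * h) - 2 * G t + G (t - \<kappa> * h)" 0 1])
      show "continuous_on (closure {0<..<1}) (\<lambda>\<kappa>. G (t + \<kappa> * h) - 2 * G t + G (t - \<kappa> * h))"
        using bnd by (intro continuous_intros continuous_on_compose2[OF G]) auto
      show "G (t + \<kappa> * h) - 2 * G t + G (t - \<kappa> * h) = 0" if "\<kappa> \<in> {0<..<1}" for \<kappa>
      proof (rule open_mid)
        have "\<kappa> * h < 1 * h" "0 < \<kappa> * h" using that h by (intro mult_strict_right_mono, auto)
        then show "0 < \<kappa> * h" "1 < t - \<kappa> * h" "t + \<kappa> * h < 2" using h by linarith+
      qed
    qed auto
    then show ?thesis by simp
  qed
  define L where "L r = G 1 + (G 2 - G 1) * (r - 1)" for r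
  have L: "continuous_on {1..2} L" unfolding L_def by (intro continuous_intros)
  have mid1: "G (t + h) - L (t + h) - 2 * (G t - L t) + (G (t - h) - L (t - h)) = 0"
    if h: "0 < h" "1 \<le> t - h" "t + h \<le> 2" for t h
    using mid[OF that] by (simp add: L_def algebra_simps)
  have mid2: "L (t + h) - G (t + h) - 2 * (L t - G t) + (L (t - h) - G (t - h)) = 0"
    if h: "0 < h" "1 \<le> t - h" "t + h \<le> 2" for t h
    using mid1[OF that] by simp
  have "G r - L r \<le> 0" if "r \<in> {1..2}" for r
    by (rule midpoint_zero_boundary_le[of "\<lambda>r. G r - L r", OF _ _ _ mid1 that])
      (auto intro!: continuous_intros G L simp: L_def)
  moreover have "L r - G r \<le> 0" if "r \<in> {1..2}" for r
    by (rule midpoint_zero_boundary_le[of "\<lambda>r. L r - G r", OF _ _ _ mid2 that])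
      (auto intro!: continuous_intros G L simp: L_def)
  ultimately have "G r = (G 1 - (G 2 - G 1)) + (G 2 - G 1) * r" if "r \<in> {1..2}" for r
    using that by (force simp: L_def algebra_simps)
  then show ?thesis using that by blast
qed

section \<open>The profile of a radial solution\<close>

definition closed_annulus :: "'a::euclidean_space set" where
  "closed_annulus = {x. 1 \<le> norm x} \<inter> cball 0 2"

lemma compact_closed_annulus: "compact (closed_annulus :: 'a::euclidean_space set)"
  unfolding closed_annulus_def
  by (intro closed_Int_compact closed_Collect_le continuous_intros compact_cball)

lemma annulus_subset: "annulus \<subseteq> closed_annulus"
  by (auto simp: annulus_def closed_annulus_def)

lemma integrable_annulus_continuous:
  fixes f :: "'a::euclidean_space \<Rightarrow> 'b::{banach, second_countable_topology}"
  assumes "continuous_on closed_annulus f"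
  shows "set_integrable lborel annulus f"
proof -
  have "set_integrable lborel closed_annulus f"
    unfolding set_integrable_def using borel_integrable_compact[OF compact_closed_annulus assms]
    by (simp only: indicator_scaleR_eq_if[symmetric] if_distrib cong: if_cong)
  then show ?thesis by (rule set_integrable_subset) (auto simp: annulus_subset)
qed

lemma emeasure_annulus_finite: "emeasure lborel (annulus :: 'a::euclidean_space set) < \<infinity>"
proof -
  have "emeasure lborel (annulus :: 'a set) \<le> emeasure lborel (ball (0::'a) 2)"
    by (rule emeasure_mono) (auto simp: annulus_def)
  also have "\<dots> < \<infinity>" by (simp add: emeasure_ball)
  finally show ?thesis .
qed

text \<open>The annulus has finite measure and a \<le> 1 + a^2, so square integrable functions are
  integrable there.\<close>

lemma set_integrable_of_square:
  fixes f :: "'a::euclidean_space \<Rightarrow> 'b::euclidean_space"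
  assumes "set_borel_measurable lborel annulus f" "set_integrable lborel annulus (\<lambda>x. (norm (f x))\<^sup>2)"
  shows "set_integrable lborel annulus f"
proof -
  have "set_integrable lborel annulus (\<lambda>x::'a. 1 :: real)"
    by (rule integrable_annulus_continuous) simp
  then have "set_integrable lborel annulus (\<lambda>x. 1 + (norm (f x))\<^sup>2)"
    using assms(2) by (rule set_integral_add)
  moreover have "norm y \<le> norm (1 + (norm y)\<^sup>2)" for y :: 'b
  proof -
    have "0 \<le> (norm y - 1)\<^sup>2" by simp
    then have "2 * norm y \<le> 1 + (norm y)\<^sup>2" by (simp add: power2_eq_square algebra_simps)
    then have "norm y \<le> 1 + (norm y)\<^sup>2" using norm_ge_zero[of y] by linarith
    then show ?thesis by simp
  qed
  ultimately show ?thesis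
    unfolding set_integrable_def using assms(1) unfolding set_borel_measurable_def
    by (elim Bochner_Integration.integrable_bound) (auto split: split_indicator)
qed

lemma set_integrable_inner_continuous:
  fixes f c :: "'a::euclidean_space \<Rightarrow> 'b::euclidean_space"
  assumes f: "set_integrable lborel annulus f" and c: "continuous_on closed_annulus c"
  shows "set_integrable lborel annulus (\<lambda>x. f x \<bullet> c x)"
proof -
  obtain C where C: "\<And>x. x \<in> closed_annulus \<Longrightarrow> norm (c x) \<le> C"
    using compact_imp_bounded[OF compact_continuous_image[OF c compact_closed_annulus]]
    unfolding bounded_iff by blast
  have [measurable]: "(\<lambda>x. indicator annulus x *\<^sub>R f x) \<in> borel_measurable lborel"
    "(\<lambda>x. indicator annulus x *\<^sub>R c x) \<in> borel_measurable lborel"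
    using f integrable_annulus_continuous[OF c] unfolding set_integrable_def
    by (auto dest: borel_measurable_integrable simp del: measurable_lborel1)
  have "set_integrable lborel annulus (\<lambda>x. C * norm (f x))"
    by (intro set_integrable_mult_right set_integrable_norm f)
  then show ?thesis
    unfolding set_integrable_def
  proof (rule Bochner_Integration.integrable_bound)
    have eq: "(\<lambda>x. indicator annulus x *\<^sub>R (f x \<bullet> c x)) =
        (\<lambda>x. (indicator annulus x *\<^sub>R f x) \<bullet> (indicator annulus x *\<^sub>R c x))"
      by (auto split: split_indicator)
    show "(\<lambda>x. indicator annulus x *\<^sub>R (f x \<bullet> c x)) \<in> borel_measurable lborel"
      unfolding eq by measurable
    have "\<bar>f x \<bullet> c x\<bar> \<le> \<bar>C * norm (f x)\<bar>" if x: "x \<in> annulus" for x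
    proof -
      have "\<bar>f x \<bullet> c x\<bar> \<le> norm (f x) * norm (c x)" by (rule Cauchy_Schwarz_ineq2)
      also have "\<dots> \<le> norm (f x) * C"
        using C[of x] x annulus_subset by (intro mult_left_mono) auto
      finally show ?thesis by (simp add: mult.commute)
    qed
    then show "AE x in lborel. norm (indicator annulus x *\<^sub>R (f x \<bullet> c x)) \<le>
        norm (indicator annulus x *\<^sub>R (C * norm (f x)))"
      by (auto split: split_indicator)
  qed
qed

lemma annulus_integral_cong_AE:
  fixes f h :: "'a::euclidean_space \<Rightarrow> real"
  assumes "set_integrable lborel annulus f" "set_integrable lborel annulus h"
    and "AE x in lborel. x \<in> annulus \<longrightarrow> f x = h x"
  shows "(LINT x:annulus|lborel. f x) = (LINT x:annulus|lborel. h x)"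
  using assms unfolding set_lebesgue_integral_def set_integrable_def
  by (intro integral_cong_AE borel_measurable_integrable)
    (auto elim!: eventually_mono split: split_indicator)

section \<open>Divergence identities for radial fields\<close>

lemma test_fun_outside:
  assumes "test_fun U \<phi>" "x \<notin> U"
  shows "\<phi> x = 0" "pderiv \<phi> b x = 0" "\<exists>S. open S \<and> x \<in> S \<and> (\<forall>y\<in>S. \<phi> y = 0)"
proof -
  let ?S = "- closure {x. \<phi> x \<noteq> 0}"
  have S: "open ?S" "x \<in> ?S" using assms by (auto simp: test_fun_def)
  have zero: "\<phi> y = 0" if "y \<in> ?S" for y using that closure_subset[of "{x. \<phi> x \<noteq> 0}"] by auto
  show "\<phi> x = 0" using S zero by blast
  show "\<exists>S. open S \<and> x \<in> S \<and> (\<forall>y\<in>S. \<phi> y = 0)" using S zero by blast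
  have "(\<phi> has_derivative (\<lambda>_. 0)) (at x)"
    by (rule has_derivative_transform_within_open[OF has_derivative_const S]) (simp only: zero)
  then show "pderiv \<phi> b x = 0" by (rule pderiv_eq)
qed

lemma grad_inner: "grad f x \<bullet> y = (\<Sum>b\<in>Basis. pderiv f b x * (b \<bullet> y))"
  by (simp add: grad_def inner_sum_left)

lemma continuous_pderiv: "Cinf \<phi> \<Longrightarrow> b \<in> Basis \<Longrightarrow> continuous_on A (pderiv \<phi> b)"
  by (intro Cinf_continuous Cinf_pderiv)

lemma continuous_grad: "Cinf \<phi> \<Longrightarrow> continuous_on A (grad \<phi>)"
  unfolding grad_def[abs_def] by (intro continuous_intros continuous_pderiv)

text \<open>The integrand is the divergence of the compactly supported field \<phi>(x) \<kappa>(|x|)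
  x. Each coordinate contributes a directional derivative \<open>D b\<close> with integral 0; in the
  sum the squares of the coordinates add up to |x|^2.\<close>

lemma test_fun_radial_divergence:
  fixes \<phi> :: "'a::euclidean_space \<Rightarrow> real"
  assumes \<phi>: "test_fun annulus \<phi>"
    and \<kappa>: "\<And>r. r > 0 \<Longrightarrow> (\<kappa> has_real_derivative \<kappa>' r) (at r)" and cont: "continuous_on {0<..} \<kappa>'"
  shows "(LINT x:annulus|lborel. (grad \<phi> x \<bullet> x) * \<kappa> (norm x) +
    \<phi> x * (\<kappa>' (norm x) * norm x + real DIM('a) * \<kappa> (norm x))) = 0"
proof -
  have C: "Cinf \<phi>" using \<phi> by (simp add: test_fun_def)
  have cont\<kappa>: "continuous_on {0<..} \<kappa>"
    by (rule DERIV_continuous_on[OF has_field_derivative_at_within[OF \<kappa>]]) simp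
  define D where "D b x = pderiv \<phi> b x * (\<kappa> (norm x) * (x \<bullet> b)) +
    \<phi> x * (\<kappa>' (norm x) * (x \<bullet> b)\<^sup>2 / norm x + \<kappa> (norm x))" for b x
  have pos: "norm x \<in> {0<..}" "norm x \<noteq> 0" if "x \<in> closed_annulus" for x :: 'a
    using that by (auto simp: closed_annulus_def)
  have cont_norm: "continuous_on closed_annulus (\<lambda>x::'a. \<kappa> (norm x))"
    "continuous_on closed_annulus (\<lambda>x::'a. \<kappa>' (norm x))"
    using pos by (intro continuous_on_compose2[OF cont\<kappa>] continuous_on_compose2[OF cont] continuous_intros; auto)+
  have contD: "continuous_on closed_annulus (D b)" if "b \<in> Basis" for b
    unfolding D_def[abs_def] using pos that
    by (intro continuous_intros cont_norm continuous_pderiv Cinf_continuous C) auto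
  have D_out: "D b x = 0" if "x \<notin> annulus" for b x
    using test_fun_outside(1,2)[OF \<phi> that] by (simp add: D_def)
  have int0: "(\<integral>x. D b x \<partial>lborel) = 0" if b: "b \<in> Basis" for b
  proof -
    obtain L where L: "\<And>x. x \<in> closed_annulus \<Longrightarrow> norm (D b x) \<le> L"
      using compact_imp_bounded[OF compact_continuous_image[OF contD[OF b] compact_closed_annulus]]
      unfolding bounded_iff by blast
    let ?\<psi> = "\<lambda>x. \<phi> x * (\<kappa> (norm x) * (x \<bullet> b))"
    show ?thesis
    proof (rule integral_directional_derivative_eq_0[of ?\<psi> b "D b" "max L 0" 2])
      fix x :: 'a
      show "((\<lambda>t. ?\<psi> (x + t *\<^sub>R b)) has_real_derivative D b x) (at 0)"
      proof (cases "x = 0")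
        case True
        then have x: "x \<notin> annulus" by (simp add: annulus_def)
        \<comment> \<open>The norm is not differentiable at the origin, but \<phi> vanishes on a
          neighbourhood of it.\<close>
        obtain S where S: "open S" "x \<in> S" "\<And>y. y \<in> S \<Longrightarrow> \<phi> y = 0"
          using test_fun_outside(3)[OF \<phi> x] by metis
        have "((\<lambda>t. ?\<psi> (x + t *\<^sub>R b)) has_real_derivative 0) (at 0)"
        proof (rule has_field_derivative_transform_within_open[of "\<lambda>_. 0"])
          show "open ((\<lambda>t. x + t *\<^sub>R b) -` S)"
            by (intro open_vimage S continuous_intros)
        qed (use S in auto)
        then show ?thesis using D_out[OF x] by simp
      next
        case False
        have line: "((\<lambda>t. x + t *\<^sub>R b) has_derivative (\<lambda>t. t *\<^sub>R b)) (at 0)"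
          by (auto intro!: derivative_eq_intros)
        have 1: "((\<lambda>t. \<phi> (x + t *\<^sub>R b)) has_real_derivative pderiv \<phi> b x) (at 0)"
        proof -
          have "(\<phi> has_derivative (\<lambda>h. pderiv \<phi> h x)) (at (x + 0 *\<^sub>R b))"
            using Cinf_has_derivative[OF C] by simp
          from has_derivative_compose[OF line this]
          have *: "((\<lambda>t. \<phi> (x + t *\<^sub>R b)) has_derivative (\<lambda>t. pderiv \<phi> (t *\<^sub>R b) x)) (at 0)" .
          have "pderiv \<phi> (t *\<^sub>R b) x = pderiv \<phi> b x * t" for t
            using linear_scale[OF has_derivative_linear[OF Cinf_has_derivative[OF C, of x]], of t b]
            by (simp add: mult.commute)
          with * show ?thesis by (simp add: has_field_derivative_def)
        qed
        have 2: "((\<lambda>t. norm (x + t *\<^sub>R b)) has_real_derivative (x \<bullet> b) / norm x) (at 0)"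
        proof -
          have "(norm has_derivative (\<lambda>h. h \<bullet> sgn x)) (at (x + 0 *\<^sub>R b))"
            using has_derivative_norm[OF False] by simp
          from has_derivative_compose[OF line this]
          have *: "((\<lambda>t. norm (x + t *\<^sub>R b)) has_derivative (\<lambda>t. (t *\<^sub>R b) \<bullet> sgn x)) (at 0)" .
          moreover have "(\<lambda>t. (t *\<^sub>R b) \<bullet> sgn x) = (*) ((x \<bullet> b) / norm x)"
            by (intro ext) (simp add: sgn_div_norm inner_commute divide_inverse)
          ultimately show ?thesis unfolding has_field_derivative_def by (simp only:)
        qed
        have 3: "((\<lambda>t. \<kappa> (norm (x + t *\<^sub>R b))) has_real_derivative \<kappa>' (norm x) * ((x \<bullet> b) / norm x)) (at 0)"
          by (rule DERIV_chain2[where f = \<kappa>, OF _ 2]) (use \<kappa>[of "norm x"] False in simp)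
        have 4: "((\<lambda>t. (x + t *\<^sub>R b) \<bullet> b) has_real_derivative 1) (at 0)"
          using b by (simp add: inner_add_left) (auto intro!: derivative_eq_intros)
        have "((\<lambda>t. ?\<psi> (x + t *\<^sub>R b)) has_real_derivative
            pderiv \<phi> b x * (\<kappa> (norm (x + 0 *\<^sub>R b)) * ((x + 0 *\<^sub>R b) \<bullet> b)) +
            (\<kappa>' (norm x) * ((x \<bullet> b) / norm x) * ((x + 0 *\<^sub>R b) \<bullet> b) + 1 * \<kappa> (norm (x + 0 *\<^sub>R b))) * \<phi> (x + 0 *\<^sub>R b)) (at 0)"
          by (intro DERIV_mult 1 3 4)
        then show ?thesis by (simp add: D_def power2_eq_square mult_ac)
      qed
      show "\<bar>D b x\<bar> \<le> max L 0"
        using L[of x] D_out[of x b] annulus_subset by (cases "x \<in> annulus") auto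
      show "?\<psi> x = 0" if "2 < norm x"
        using that test_fun_outside(1)[OF \<phi>, of x] by (simp add: annulus_def)
    next
      have "set_integrable lborel annulus ?\<psi>"
        by (intro integrable_annulus_continuous continuous_intros cont_norm Cinf_continuous C)
      moreover have "(\<lambda>x. indicator annulus x *\<^sub>R ?\<psi> x) = ?\<psi>"
        using test_fun_outside(1)[OF \<phi>] by (auto split: split_indicator)
      ultimately show "integrable lborel ?\<psi>" by (simp add: set_integrable_def)
    qed
  qed
  have D_ind: "indicator annulus x *\<^sub>R D b x = D b x" for b x
    using D_out by (auto split: split_indicator)
  have intD: "integrable lborel (D b)" if "b \<in> Basis" for b
    using integrable_annulus_continuous[OF contD[OF that]] by (simp only: set_integrable_def D_ind)
  have "(grad \<phi> x \<bullet> x) * \<kappa> (norm x) + \<phi> x * (\<kappa>' (norm x) * norm x + real DIM('a) * \<kappa> (norm x))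
      = (\<Sum>b\<in>Basis. D b x)" for x
  proof -
    have sq: "(norm x)\<^sup>2 = (\<Sum>b\<in>Basis. (x \<bullet> b)\<^sup>2)"
      unfolding power2_norm_eq_inner euclidean_inner[of x x] by (simp add: power2_eq_square)
    have "(\<Sum>b\<in>Basis. \<kappa>' (norm x) * (x \<bullet> b)\<^sup>2 / norm x) = \<kappa>' (norm x) * (norm x)\<^sup>2 / norm x"
      by (simp only: sq sum_distrib_left sum_divide_distrib)
    also have "\<dots> = \<kappa>' (norm x) * norm x"
      by (simp add: power2_eq_square)
    finally have "(\<Sum>b\<in>Basis. \<kappa>' (norm x) * (x \<bullet> b)\<^sup>2 / norm x + \<kappa> (norm x)) =
        \<kappa>' (norm x) * norm x + real DIM('a) * \<kappa> (norm x)"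
      by (simp only: sum.distrib sum_constant of_nat_mult)
    then have *: "(\<Sum>b\<in>Basis. \<phi> x * (\<kappa>' (norm x) * (x \<bullet> b)\<^sup>2 / norm x + \<kappa> (norm x))) =
        \<phi> x * (\<kappa>' (norm x) * norm x + real DIM('a) * \<kappa> (norm x))"
      by (simp only: sum_distrib_left[symmetric])
    have **: "(\<Sum>b\<in>Basis. pderiv \<phi> b x * (\<kappa> (norm x) * (x \<bullet> b))) = (grad \<phi> x \<bullet> x) * \<kappa> (norm x)"
      unfolding grad_inner sum_distrib_right by (intro sum.cong) (auto simp: inner_commute)
    show ?thesis unfolding D_def by (simp only: sum.distrib * **)
  qed
  then have "(LINT x:annulus|lborel. (grad \<phi> x \<bullet> x) * \<kappa> (norm x) +
    \<phi> x * (\<kappa>' (norm x) * norm x + real DIM('a) * \<kappa> (norm x))) = (\<integral>x. (\<Sum>b\<in>Basis. D b x) \<partial>lborel)"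
    unfolding set_lebesgue_integral_def by (simp only: scaleR_sum_right D_ind)
  also have "\<dots> = (\<Sum>b\<in>Basis. \<integral>x. D b x \<partial>lborel)"
    by (rule Bochner_Integration.integral_sum) (rule intD)
  also have "\<dots> = 0" using int0 by simp
  finally show ?thesis .
qed

lemma set_integrable_sum_squares:
  fixes f f' :: "'a::euclidean_space \<Rightarrow> 'b::euclidean_space"
  assumes f: "set_borel_measurable lborel annulus f" "set_integrable lborel annulus (\<lambda>x. (norm (f x))\<^sup>2)"
    and f': "continuous_on UNIV f'"
  shows "set_integrable lborel annulus (\<lambda>x. (norm (f' x - f x))\<^sup>2)"
proof -
  have [measurable]: "(\<lambda>x. indicator annulus x *\<^sub>R f x) \<in> borel_measurable borel" "f' \<in> borel_measurable borel"
    using f(1) borel_measurable_continuous_onI[OF f'] by (simp_all add: set_borel_measurable_def)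
  have "set_integrable lborel annulus (\<lambda>x. (norm (f' x))\<^sup>2)"
    by (intro integrable_annulus_continuous continuous_intros continuous_on_subset[OF f']) auto
  then have "set_integrable lborel annulus (\<lambda>x. 2 * (norm (f' x))\<^sup>2 + 2 * (norm (f x))\<^sup>2)"
    using f(2) by (intro set_integral_add set_integrable_mult_right) auto
  then show ?thesis
    unfolding set_integrable_def
  proof (rule Bochner_Integration.integrable_bound)
    have "(\<lambda>x. indicator annulus x *\<^sub>R (norm (f' x - f x))\<^sup>2) =
        (\<lambda>x. indicator annulus x *\<^sub>R (norm (f' x - indicator annulus x *\<^sub>R f x))\<^sup>2)"
      by (auto split: split_indicator)
    then show "(\<lambda>x. indicator annulus x *\<^sub>R (norm (f' x - f x))\<^sup>2) \<in> borel_measurable lborel"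
      by simp
    have "(norm (v - w))\<^sup>2 \<le> 2 * (norm v)\<^sup>2 + 2 * (norm w)\<^sup>2" for v w :: 'b
    proof -
      have "(norm (v - w))\<^sup>2 \<le> (norm v + norm w)\<^sup>2"
        by (intro power_mono norm_triangle_ineq4) simp
      also have "\<dots> \<le> 2 * (norm v)\<^sup>2 + 2 * (norm w)\<^sup>2"
        using sum_squares_bound[of "norm v" "norm w"] by (simp add: power2_sum)
      finally show ?thesis .
    qed
    then show "AE x in lborel. norm (indicator annulus x *\<^sub>R (norm (f' x - f x))\<^sup>2) \<le>
        norm (indicator annulus x *\<^sub>R (2 * (norm (f' x))\<^sup>2 + 2 * (norm (f x))\<^sup>2))"
      by (auto split: split_indicator)
  qed
qed

text \<open>A substitute for the Cauchy-Schwarz inequality: on a set of finite measure it turns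
  convergence in L^2 into convergence in L^1.\<close>

lemma le_eps_square: "a \<le> \<epsilon> + a\<^sup>2 / \<epsilon>" if "\<epsilon> > 0" for a \<epsilon> :: real
proof -
  have "0 \<le> (a - \<epsilon>)\<^sup>2 + a\<^sup>2 + \<epsilon>\<^sup>2" by simp
  then have "a * \<epsilon> \<le> \<epsilon> * \<epsilon> + a\<^sup>2" by (simp add: power2_eq_square algebra_simps)
  then show ?thesis using that by (simp add: field_simps)
qed

text \<open>The integral is continuous in the H^1 norm of \<open>u\<close>, so the identity passes
  from test functions to their limits. As \<kappa> may be nonzero for |x| = 1 and |x| = 2, the
  absence of a boundary term is the form in which the zero trace of \<open>u\<close> is
  used.\<close>

lemma H10_radial_divergence:
  fixes u :: "'a::euclidean_space \<Rightarrow> real"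
  assumes H: "H10_grad annulus u g"
    and \<kappa>: "\<And>r. r > 0 \<Longrightarrow> (\<kappa> has_real_derivative \<kappa>' r) (at r)" and cont: "continuous_on {0<..} \<kappa>'"
  shows "(LINT x:annulus|lborel. (g x \<bullet> x) * \<kappa> (norm x) +
    u x * (\<kappa>' (norm x) * norm x + real DIM('a) * \<kappa> (norm x))) = 0"
proof -
  define m where "m r = \<kappa>' r * r + real DIM('a) * \<kappa> r" for r
  have cont\<kappa>: "continuous_on {0<..} \<kappa>"
    by (rule DERIV_continuous_on[OF has_field_derivative_at_within[OF \<kappa>]]) simp
  have contm: "continuous_on {0<..} m"
    unfolding m_def by (intro continuous_intros cont cont\<kappa>)
  have pos: "norm x \<in> {0<..}" if "x \<in> closed_annulus" for x :: 'a
    using that by (auto simp: closed_annulus_def)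
  have c\<kappa>: "continuous_on closed_annulus (\<lambda>x::'a. \<kappa> (norm x))"
    and cm: "continuous_on closed_annulus (\<lambda>x::'a. m (norm x))"
    using pos by (intro continuous_on_compose2[OF cont\<kappa>] continuous_on_compose2[OF contm] continuous_intros; auto)+
  have "bounded ((\<lambda>x::'a. \<kappa> (norm x)) ` closed_annulus \<union> (\<lambda>x::'a. m (norm x)) ` closed_annulus)"
    using compact_imp_bounded[OF compact_continuous_image[OF c\<kappa> compact_closed_annulus]]
      compact_imp_bounded[OF compact_continuous_image[OF cm compact_closed_annulus]] by simp
  then obtain C where C: "C > 0" "\<And>x::'a. x \<in> closed_annulus \<Longrightarrow> \<bar>\<kappa> (norm x)\<bar> \<le> C \<and> \<bar>m (norm x)\<bar> \<le> C"
    unfolding bounded_pos by fastforce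
  obtain \<phi>s where test: "\<And>k. test_fun annulus (\<phi>s k)"
    and lim: "(\<lambda>k. LINT x:annulus|lborel. (\<phi>s k x - u x)\<^sup>2 + (norm (grad (\<phi>s k) x - g x))\<^sup>2) \<longlonglongrightarrow> 0"
    using H unfolding H10_grad_def by blast
  have u: "set_borel_measurable lborel annulus u" "set_integrable lborel annulus (\<lambda>x. (norm (u x))\<^sup>2)"
    and g: "set_borel_measurable lborel annulus g" "set_integrable lborel annulus (\<lambda>x. (norm (g x))\<^sup>2)"
    using H unfolding H10_grad_def H1_grad_def by auto
  have C\<phi>: "Cinf (\<phi>s k)" for k using test by (auto simp: test_fun_def)
  define q where "q k x = (\<phi>s k x - u x)\<^sup>2 + (norm (grad (\<phi>s k) x - g x))\<^sup>2" for k x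
  define F where "F v w x = (v \<bullet> x) * \<kappa> (norm x) + w * m (norm x)" for v and w :: real and x :: 'a
  have q_int: "set_integrable lborel annulus (q k)" for k
    unfolding q_def
    using set_integrable_sum_squares[OF u Cinf_continuous[OF C\<phi>]] set_integrable_sum_squares[OF g continuous_grad[OF C\<phi>]]
    by (intro set_integral_add) simp_all
  have F_bound: "\<bar>F v w x\<bar> \<le> 2 * C * (norm v + \<bar>w\<bar>)" if x: "x \<in> annulus" for v w x
  proof -
    have x': "norm x \<le> 2" "\<bar>\<kappa> (norm x)\<bar> \<le> C" "\<bar>m (norm x)\<bar> \<le> C"
      using x C(2)[of x] annulus_subset by (auto simp: annulus_def)
    have "\<bar>v \<bullet> x\<bar> \<le> norm v * 2"
      using Cauchy_Schwarz_ineq2[of v x] mult_left_mono[OF x'(1), of "norm v"] by simp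
    then have "\<bar>v \<bullet> x\<bar> * \<bar>\<kappa> (norm x)\<bar> \<le> norm v * 2 * C" using x' by (intro mult_mono) auto
    moreover have "\<bar>w\<bar> * \<bar>m (norm x)\<bar> \<le> \<bar>w\<bar> * C" using x' by (intro mult_left_mono) auto
    moreover have "\<bar>w\<bar> * C \<le> \<bar>w\<bar> * (2 * C)" using C(1) by (intro mult_left_mono) auto
    ultimately show ?thesis
      unfolding F_def using abs_triangle_ineq[of "(v \<bullet> x) * \<kappa> (norm x)" "w * m (norm x)"]
      by (simp add: abs_mult algebra_simps)
  qed
  have F_int: "set_integrable lborel annulus (\<lambda>x. F (g x) (u x) x)"
    "set_integrable lborel annulus (\<lambda>x. F (grad (\<phi>s k) x) (\<phi>s k x) x)" for k
  proof -
    have "set_integrable lborel annulus (\<lambda>x. g x \<bullet> (\<kappa> (norm x) *\<^sub>R x))"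
      by (rule set_integrable_inner_continuous[OF set_integrable_of_square[OF g]])
        (intro continuous_intros c\<kappa>)
    moreover have "set_integrable lborel annulus (\<lambda>x. u x \<bullet> m (norm x))"
      by (rule set_integrable_inner_continuous[OF set_integrable_of_square[OF u]]) (rule cm)
    ultimately show "set_integrable lborel annulus (\<lambda>x. F (g x) (u x) x)"
      unfolding F_def by (intro set_integral_add) (simp_all add: mult.commute)
    show "set_integrable lborel annulus (\<lambda>x. F (grad (\<phi>s k) x) (\<phi>s k x) x)"
      unfolding F_def
      by (intro integrable_annulus_continuous continuous_intros continuous_grad Cinf_continuous C\<phi> c\<kappa> cm)
  qed
  have Fk0: "(LINT x:annulus|lborel. F (grad (\<phi>s k) x) (\<phi>s k x) x) = 0" for k
    unfolding F_def m_def using test_fun_radial_divergence[OF test \<kappa> cont] by simp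
  let ?I = "LINT x:annulus|lborel. F (g x) (u x) x"
  let ?T = "LINT x:(annulus::'a set)|lborel. (1::real)"
  have one_int: "set_integrable lborel annulus (\<lambda>x::'a. 1 :: real)"
    by (rule integrable_annulus_continuous) simp
  have bound: "\<bar>?I\<bar> \<le> 2 * C * (2 * \<epsilon> * ?T + (LINT x:annulus|lborel. q k x) / \<epsilon>)" if \<epsilon>: "\<epsilon> > 0" for \<epsilon> k
  proof -
    have "?I = ?I - (LINT x:annulus|lborel. F (grad (\<phi>s k) x) (\<phi>s k x) x)" by (simp add: Fk0)
    also have "\<dots> = (LINT x:annulus|lborel. F (g x) (u x) x - F (grad (\<phi>s k) x) (\<phi>s k x) x)"
      by (rule set_integral_diff(2)[symmetric]) (rule F_int)+
    finally have I: "?I = \<dots>" .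
    have "\<bar>?I\<bar> \<le> (LINT x:annulus|lborel. \<bar>F (g x) (u x) x - F (grad (\<phi>s k) x) (\<phi>s k x) x\<bar>)"
      unfolding I using set_integral_norm_bound[OF set_integral_diff(1)[OF F_int]] by simp
    also have "\<dots> \<le> (LINT x:annulus|lborel. 2 * C * (2 * \<epsilon> * 1 + q k x / \<epsilon>))"
    proof (rule set_integral_mono)
      fix x :: 'a assume x: "x \<in> annulus"
      have "F (g x) (u x) x - F (grad (\<phi>s k) x) (\<phi>s k x) x = F (g x - grad (\<phi>s k) x) (u x - \<phi>s k x) x"
        by (simp add: F_def inner_diff_left algebra_simps)
      then have "\<bar>F (g x) (u x) x - F (grad (\<phi>s k) x) (\<phi>s k x) x\<bar>
          \<le> 2 * C * (norm (g x - grad (\<phi>s k) x) + \<bar>u x - \<phi>s k x\<bar>)"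
        using F_bound[OF x] by simp
      also have "\<dots> \<le> 2 * C * ((\<epsilon> + (norm (g x - grad (\<phi>s k) x))\<^sup>2 / \<epsilon>) + (\<epsilon> + \<bar>u x - \<phi>s k x\<bar>\<^sup>2 / \<epsilon>))"
        by (intro mult_left_mono add_mono le_eps_square[OF \<epsilon>]) (use C(1) in simp)
      also have "\<dots> = 2 * C * (2 * \<epsilon> * 1 + q k x / \<epsilon>)"
        unfolding q_def by (simp add: norm_minus_commute power2_commute add_divide_distrib)
      finally show "\<bar>F (g x) (u x) x - F (grad (\<phi>s k) x) (\<phi>s k x) x\<bar> \<le> \<dots>" .
    next
      show "set_integrable lborel annulus (\<lambda>x. \<bar>F (g x) (u x) x - F (grad (\<phi>s k) x) (\<phi>s k x) x\<bar>)"
        by (intro set_integrable_abs set_integral_diff F_int)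
      show "set_integrable lborel annulus (\<lambda>x. 2 * C * (2 * \<epsilon> * 1 + q k x / \<epsilon>))"
        by (intro set_integrable_mult_right set_integral_add set_integrable_divide one_int q_int)
    qed
    also have "\<dots> = 2 * C * (2 * \<epsilon> * ?T + (LINT x:annulus|lborel. q k x) / \<epsilon>)"
      using one_int q_int
      by (simp only: set_integral_mult_right set_integral_add(2) set_integrable_mult_right set_integrable_divide
          set_integral_divide_zero)
    finally show ?thesis .
  qed
  \<comment> \<open>With \<epsilon> fixed, letting k tend to infinity removes the term with
    1/\<epsilon>; only afterwards does \<epsilon> tend to 0.\<close>
  have bound2: "\<bar>?I\<bar> \<le> 2 * C * (2 * \<epsilon> * ?T)" if \<epsilon>: "\<epsilon> > 0" for \<epsilon>
  proof -
    have "(\<lambda>k. 2 * C * (2 * \<epsilon> * ?T + (LINT x:annulus|lborel. q k x) / \<epsilon>)) \<longlonglongrightarrow> 2 * C * (2 * \<epsilon> * ?T + 0 / \<epsilon>)"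
      using lim \<epsilon> unfolding q_def by (intro tendsto_intros) auto
    then show ?thesis using bound[OF \<epsilon>] LIMSEQ_le_const by (metis (no_types, lifting) add.right_neutral div_0)
  qed
  have "((\<lambda>\<epsilon>. 2 * C * (2 * \<epsilon> * ?T)) \<longlongrightarrow> 2 * C * (2 * 0 * ?T)) (at_right 0)"
    by (intro tendsto_intros)
  then have "\<bar>?I\<bar> \<le> 2 * C * (2 * 0 * ?T)"
    by (rule tendsto_lowerbound) (use bound2 in \<open>auto intro: eventually_at_rightI[of 0 1]\<close>)
  then show ?thesis by (simp add: F_def m_def)
qed

section \<open>Radial functions and the continuous representative\<close>

lemma AE_norm_neq: "AE x in lborel. norm (x::'a::euclidean_space) \<noteq> t"
proof -
  have "sphere (0::'a) t \<in> null_sets lborel"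
    using negligible_sphere[of "0::'a" t]
    by (auto simp: null_sets_completion_iff negligible_iff_null_sets)
  then show ?thesis by (drule_tac AE_not_in) simp
qed

text \<open>The function \<open>w\<close> need not be measurable: a compact piece \<open>K\<close> of the set where \<open>d > 0\<close> is
  enlarged to the union of the spheres meeting it, on which \<open>d > 0\<close> still holds almost everywhere.\<close>

lemma radial_nonpos_AE:
  fixes d :: "'a::euclidean_space \<Rightarrow> real"
  assumes d: "set_integrable lborel annulus d"
    and radial: "AE x in lborel. x \<in> annulus \<longrightarrow> d x = w (norm x)"
    and test: "\<And>\<zeta>. continuous_on UNIV \<zeta> \<Longrightarrow> (LINT x:annulus|lborel. d x * \<zeta> (norm x)) = 0"
  shows "AE x in lborel. x \<in> annulus \<longrightarrow> d x \<le> 0"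
proof -
  define e where "e x = indicator annulus x *\<^sub>R d x" for x
  have e_int: "integrable lborel e" using d by (simp add: set_integrable_def e_def[abs_def])
  then have [measurable]: "e \<in> borel_measurable borel" using borel_measurable_integrable by fastforce
  obtain N where N: "\<And>x. x \<notin> N \<Longrightarrow> x \<in> annulus \<longrightarrow> d x = w (norm x)" "N \<in> null_sets lborel"
    using AE_E3[OF radial] by auto
  define S where "S = {x. e x > 0} - N"
  have S_sets: "S \<in> sets borel" using N(2) by (auto simp: S_def)
  have S_pos: "x \<in> annulus" "w (norm x) > 0" if "x \<in> S" for x
    using that N(1)[of x] by (auto simp: S_def e_def split: split_indicator_asm)
  have "emeasure lborel S = 0"
  proof (rule ccontr)
    assume "emeasure lborel S \<noteq> 0"
    moreover have "emeasure lborel S < \<infinity>"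
      using emeasure_mono[of S annulus lborel] S_pos(1) emeasure_annulus_finite[where 'a = 'a]
      by (auto intro: le_less_trans)
    ultimately obtain s where s: "emeasure lborel S = ennreal s" "s > 0"
      by (cases "emeasure lborel S") (auto simp: ennreal_eq_0_iff)
    \<comment> \<open>Inner regularity: S - K has measure less than that of \<open>S\<close>, so
      \<open>K\<close> keeps positive measure.\<close>
    obtain K where K: "closed K" "K \<subseteq> S" "S - K \<in> lmeasurable" "emeasure lebesgue (S - K) < ennreal s"
      using sets_lebesgue_inner_closed[of S s] S_sets s by auto
    have Kb: "bounded K" using K(2) S_pos(1)
      by (auto simp: annulus_def subset_eq intro!: bounded_subset[OF bounded_ball[of 0 2]])
    have K_pos: "emeasure lborel K \<noteq> 0"
    proof
      assume "emeasure lborel K = 0"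
      have "emeasure lborel S \<le> emeasure lborel K + emeasure lborel (S - K)"
        using emeasure_subadditive[of K lborel "S - K"] K S_sets by (simp add: Un_absorb1 borel_closed)
      also have "\<dots> = emeasure lebesgue (S - K)"
        using \<open>emeasure lborel K = 0\<close> K(1) S_sets by (simp add: borel_closed)
      finally show False using K(4) s by simp
    qed
    define R where "R = norm ` K"
    have "compact K" using K(1) Kb by (simp add: compact_eq_bounded_closed)
    then have R: "closed R" unfolding R_def
      by (intro compact_imp_closed compact_continuous_image continuous_intros)
    have "K \<noteq> {}" using K_pos by auto
    then have Rne: "R \<noteq> {}" by (simp add: R_def)
    \<comment> \<open>Continuous functions of the radius that decrease to the indicator of
      \<open>R\<close>; the limit uses that \<open>R\<close> is closed, as the image of a compact
      set.\<close>
    define \<zeta> where "\<zeta> n r = max 0 (1 - real n * infdist r R)" for n r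
    have \<zeta>: "continuous_on UNIV (\<zeta> n)" for n
      unfolding \<zeta>_def[abs_def] by (intro continuous_intros)
    have \<zeta>_lim: "(\<lambda>n. \<zeta> n r) \<longlonglongrightarrow> indicator R r" for r
    proof (cases "r \<in> R")
      case True
      then show ?thesis by (simp add: \<zeta>_def)
    next
      case False
      then have "infdist r R \<noteq> 0" using in_closed_iff_infdist_zero[OF R Rne] by simp
      then have i: "infdist r R > 0" using infdist_nonneg[of r R] by linarith
      have "\<zeta> n r = 0" if "n \<ge> nat \<lceil>1 / infdist r R\<rceil>" for n
      proof -
        have "1 / infdist r R \<le> real n" using that by linarith
        then show ?thesis using i by (simp add: \<zeta>_def divide_le_eq)
      qed
      then have "\<forall>\<^sub>F n in sequentially. \<zeta> n r = 0" unfolding eventually_sequentially by blast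
      then show ?thesis using False by (simp add: tendsto_eventually)
    qed
    have [measurable]: "R \<in> sets borel" "\<zeta> n \<in> borel_measurable borel" for n
      using R \<zeta> by (auto intro: borel_measurable_continuous_onI)
    have "(\<lambda>n. \<integral>x. e x * \<zeta> n (norm x) \<partial>lborel) \<longlonglongrightarrow> (\<integral>x. e x * indicator R (norm x) \<partial>lborel)"
    proof (rule integral_dominated_convergence[where w = "\<lambda>x. \<bar>e x\<bar>"])
      show "(\<lambda>x. e x * indicator R (norm x)) \<in> borel_measurable lborel" by simp
      show "(\<lambda>x. e x * \<zeta> n (norm x)) \<in> borel_measurable lborel" for n by simp
      show "AE x in lborel. norm (e x * \<zeta> n (norm x)) \<le> \<bar>e x\<bar>" for n
      proof (rule AE_I2)
        fix x :: 'a
        have "0 \<le> \<zeta> n (norm x)" "\<zeta> n (norm x) \<le> 1"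
          using infdist_nonneg[of "norm x" R] by (auto simp: \<zeta>_def)
        then show "norm (e x * \<zeta> n (norm x)) \<le> \<bar>e x\<bar>"
          using mult_left_mono[of "\<zeta> n (norm x)" 1 "\<bar>e x\<bar>"] by (simp add: abs_mult)
      qed
      show "AE x in lborel. (\<lambda>n. e x * \<zeta> n (norm x)) \<longlonglongrightarrow> e x * indicator R (norm x)"
        by (intro AE_I2 tendsto_mult tendsto_const \<zeta>_lim)
    qed (use e_int in simp)
    moreover have "(\<integral>x. e x * \<zeta> n (norm x) \<partial>lborel) = 0" for n
      using test[OF \<zeta>[of n]] by (simp add: set_lebesgue_integral_def e_def mult.assoc)
    ultimately have "(\<lambda>n::nat. 0) \<longlonglongrightarrow> (\<integral>x. e x * indicator R (norm x) \<partial>lborel)" by simp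
    then have int0: "(\<integral>x. e x * indicator R (norm x) \<partial>lborel) = 0"
      by (simp add: LIMSEQ_const_iff)
    have R_w: "w r > 0" if "r \<in> R" for r using that K(2) S_pos(2) by (auto simp: R_def)
    have nonneg: "AE x in lborel. 0 \<le> e x * indicator R (norm x)"
      using AE_not_in[OF N(2)]
    proof eventually_elim
      case (elim x)
      then show ?case using N(1)[of x] R_w[of "norm x"] by (auto simp: e_def split: split_indicator)
    qed
    have "integrable lborel (\<lambda>x. e x * indicator R (norm x))"
      using e_int by (rule Bochner_Integration.integrable_bound) (auto split: split_indicator)
    then have "AE x in lborel. e x * indicator R (norm x) = 0"
      using integral_nonneg_eq_0_iff_AE[OF _ nonneg] int0 by simp
    then have "AE x in lborel. x \<notin> K"
    proof eventually_elim
      case (elim x)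
      then show ?case using K(2) by (auto simp: R_def S_def split: split_indicator_asm)
    qed
    then have "emeasure lborel K = 0"
      using AE_iff_measurable[of K lborel "\<lambda>x. x \<notin> K"] K(1) by (simp add: borel_closed)
    then show False using K_pos by simp
  qed
  then have "S \<in> null_sets lborel" using S_sets by (auto simp: null_sets_def)
  from AE_not_in[OF this] AE_not_in[OF N(2)] show ?thesis
    by eventually_elim (auto simp: S_def e_def split: split_indicator_asm)
qed

text \<open>Formally g x = V'(|x|) x / |x|, and in polar coordinates the left side is the sphere
  area times the integral of V' Z. The identity is then integration by parts without boundary terms,
  since \<open>V\<close> vanishes at 1 and 2.\<close>

definition radial_flux :: "('a::euclidean_space \<Rightarrow> 'a) \<Rightarrow> (real \<Rightarrow> real) \<Rightarrow> bool" where
  "radial_flux g V \<longleftrightarrow>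
    (\<forall>Z \<zeta>. (\<forall>r>0. (Z has_real_derivative \<zeta> r) (at r)) \<longrightarrow> continuous_on {0<..} \<zeta> \<longrightarrow>
      (LINT x:annulus|lborel. ((g x \<bullet> x) / norm x ^ DIM('a)) * Z (norm x)) =
      - sphere_area TYPE('a) * integral {1..2} (\<lambda>r. V r * \<zeta> r))"

text \<open>The candidate for the radial profile is an integral of the radial component of the weak gradient
  over an outer shell; it is continuous and does not refer to values of \<open>u\<close> on null sets.\<close>

lemma radial_representation:
  fixes u :: "'a::euclidean_space \<Rightarrow> real"
  assumes H10: "H10_grad annulus u g" and radial: "radial_on annulus u"
  obtains V where "continuous_on UNIV V" "V 1 = 0" "V 2 = 0"
    "AE x in lborel. x \<in> annulus \<longrightarrow> u x = V (norm x)"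
    "radial_flux g V"
proof -
  let ?N = "DIM('a)" and ?c = "sphere_area TYPE('a)"
  have vol: "unit_ball_vol (real ?N) \<noteq> 0"
    using unit_ball_vol_pos[of "real ?N"] by linarith
  have u: "set_borel_measurable lborel annulus u" "set_integrable lborel annulus (\<lambda>x. (norm (u x))\<^sup>2)"
    and g: "set_borel_measurable lborel annulus g" "set_integrable lborel annulus (\<lambda>x. (norm (g x))\<^sup>2)"
    using H10 unfolding H10_grad_def H1_grad_def by auto
  note u_int = set_integrable_of_square[OF u] and g_int = set_integrable_of_square[OF g]
  have norm_pos: "norm x \<in> {0<..}" "norm x \<noteq> 0" if "x \<in> closed_annulus" for x :: 'a
    using that by (auto simp: closed_annulus_def)
  have cont_radial: "continuous_on closed_annulus (\<lambda>x::'a. f (norm x))" if "continuous_on {0<..} f" for f :: "real \<Rightarrow> real"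
    using norm_pos by (intro continuous_on_compose2[OF that] continuous_intros) auto
  have mult_int: "set_integrable lborel annulus (\<lambda>x. f x * h (norm x))"
    if "set_integrable lborel annulus f" "continuous_on {0<..} h" for f :: "'a \<Rightarrow> real" and h
    using set_integrable_inner_continuous[OF that(1) cont_radial[OF that(2)]] by simp
  define H where "H x = indicator annulus x * ((g x \<bullet> x) / norm x ^ ?N)" for x
  have H_set: "set_integrable lborel annulus (\<lambda>x. (g x \<bullet> x) / norm x ^ ?N)"
  proof -
    have "set_integrable lborel annulus (\<lambda>x. g x \<bullet> ((1 / norm x ^ ?N) *\<^sub>R x))"
      by (rule set_integrable_inner_continuous[OF g_int]) (use norm_pos in \<open>auto intro!: continuous_intros\<close>)
    then show ?thesis by simp
  qed
  have H_int: "integrable lborel H" using H_set by (simp add: set_integrable_def H_def[abs_def])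
  then have H_meas [measurable]: "H \<in> borel_measurable borel" using borel_measurable_integrable by fastforce
  have LINT_H: "(LINT x:annulus|lborel. ((g x \<bullet> x) / norm x ^ ?N) * f x) = (\<integral>x. H x * f x \<partial>lborel)" for f
    by (simp add: set_lebesgue_integral_def H_def mult.assoc)
  have flux: "(LINT x:annulus|lborel. u x * (\<zeta> (norm x) / norm x ^ (?N - 1))) = - (\<integral>x. H x * Z (norm x) \<partial>lborel)"
    if Z: "\<And>r. r > 0 \<Longrightarrow> (Z has_real_derivative \<zeta> r) (at r)" and \<zeta>: "continuous_on {0<..} \<zeta>" for Z \<zeta>
  proof -
    have cZ: "continuous_on {0<..} Z"
      by (rule DERIV_continuous_on[OF has_field_derivative_at_within[OF Z]]) simp
    \<comment> \<open>This choice makes the coefficient \<kappa>' r + N \<kappa> of \<open>u\<close>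
      collapse to \<zeta> / r^(N-1).\<close>
    define \<kappa> where "\<kappa> r = Z r / r ^ ?N" for r
    define \<kappa>' where "\<kappa>' r = (\<zeta> r * r ^ ?N - Z r * (real ?N * r ^ (?N - 1))) / (r ^ ?N * r ^ ?N)" for r
    have "(LINT x:annulus|lborel. (g x \<bullet> x) * \<kappa> (norm x) +
        u x * (\<kappa>' (norm x) * norm x + real ?N * \<kappa> (norm x))) = 0"
    proof (rule H10_radial_divergence[OF H10])
      show "(\<kappa> has_real_derivative \<kappa>' r) (at r)" if "r > 0" for r
        unfolding \<kappa>_def[abs_def] \<kappa>'_def using that by (auto intro!: derivative_eq_intros Z)
      show "continuous_on {0<..} \<kappa>'"
        unfolding \<kappa>'_def[abs_def] by (intro continuous_intros \<zeta> cZ) auto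
    qed
    also have "(LINT x:annulus|lborel. (g x \<bullet> x) * \<kappa> (norm x) +
        u x * (\<kappa>' (norm x) * norm x + real ?N * \<kappa> (norm x))) =
      (LINT x:annulus|lborel. ((g x \<bullet> x) / norm x ^ ?N) * Z (norm x) + u x * (\<zeta> (norm x) / norm x ^ (?N - 1)))"
    proof (rule set_lebesgue_integral_cong)
      have eq: "\<kappa>' r * r + real ?N * \<kappa> r = \<zeta> r / r ^ (?N - 1)" if "r > 0" for r
      proof -
        have N: "r ^ ?N = r * r ^ (?N - 1)"
          using DIM_positive[where 'a = 'a] by (cases ?N) auto
        show ?thesis using that by (simp add: \<kappa>_def \<kappa>'_def N field_simps)
      qed
      have "norm x > 0" if "x \<in> annulus" for x :: 'a using that by (auto simp: annulus_def)
      from eq[OF this] show "\<forall>x. x \<in> annulus \<longrightarrow> (g x \<bullet> x) * \<kappa> (norm x) + u x * (\<kappa>' (norm x) * norm x + real ?N * \<kappa> (norm x)) =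
          ((g x \<bullet> x) / norm x ^ ?N) * Z (norm x) + u x * (\<zeta> (norm x) / norm x ^ (?N - 1))"
        by (simp add: \<kappa>_def)
    qed simp
    also have "\<dots> = (LINT x:annulus|lborel. ((g x \<bullet> x) / norm x ^ ?N) * Z (norm x)) +
        (LINT x:annulus|lborel. u x * (\<zeta> (norm x) / norm x ^ (?N - 1)))"
      by (intro set_integral_add mult_int[OF H_set cZ] mult_int[OF u_int, where h = "\<lambda>r. \<zeta> r / r ^ (?N - 1)"]
          continuous_intros \<zeta>) auto
    finally show ?thesis unfolding LINT_H by linarith
  qed
  \<comment> \<open>Z = 1 and \<zeta> = 0 show that the total of \<open>H\<close> vanishes; this
    becomes V 1 = 0.\<close>
  have H0: "(\<integral>x. H x \<partial>lborel) = 0"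
    using flux[of "\<lambda>_. 1" "\<lambda>_. 0"] by (simp add: set_lebesgue_integral_def)
  \<comment> \<open>For the expected profile \<Phi> t is the sphere area times V 2 - V t, which
    explains sign and normalisation of \<open>V\<close>.\<close>
  define \<Phi> where "\<Phi> t = (\<integral>x. (if t < norm x then H x else 0) \<partial>lborel)" for t
  define V where "V t = - \<Phi> t / ?c" for t
  have cont_\<Phi>: "continuous_on UNIV \<Phi>"
    unfolding continuous_on_sequentially
  proof (intro ballI allI impI)
    fix t and s :: "nat \<Rightarrow> real" assume "(\<forall>n. s n \<in> UNIV) \<and> s \<longlonglongrightarrow> t"
    then have s: "s \<longlonglongrightarrow> t" by simp
    show "(\<Phi> \<circ> s) \<longlonglongrightarrow> \<Phi> t"
      unfolding \<Phi>_def comp_def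
    proof (rule integral_dominated_convergence[where w = "\<lambda>x. \<bar>H x\<bar>"])
      \<comment> \<open>The cut-off t < norm x jumps only on the sphere of radius \<open>t\<close>,
        a null set.\<close>
      show "AE x in lborel. (\<lambda>n. if s n < norm x then H x else 0) \<longlonglongrightarrow> (if t < norm x then H x else 0)"
        using AE_norm_neq[of t]
      proof eventually_elim
        case (elim x)
        show ?case
        proof (cases "t < norm x")
          case True
          with order_tendstoD(2)[OF s] have "\<forall>\<^sub>F n in sequentially. s n < norm x" by blast
          then have "\<forall>\<^sub>F n in sequentially. (if s n < norm x then H x else 0) = H x"
            by eventually_elim simp
          with True show ?thesis by (simp add: tendsto_eventually)
        next
          case False
          with elim have "norm x < t" by simp
          with order_tendstoD(1)[OF s] have "\<forall>\<^sub>F n in sequentially. norm x < s n" by blast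
          then have "\<forall>\<^sub>F n in sequentially. (if s n < norm x then H x else 0) = 0"
            by eventually_elim simp
          with False show ?thesis by (simp add: tendsto_eventually)
        qed
      qed
    qed (use H_int in auto)
  qed
  have LINT_Z: "(\<integral>x. H x * Z (norm x) \<partial>lborel) = - ?c * integral {1..2} (\<lambda>r. V r * \<zeta> r)"
    if Z: "\<And>r. r > 0 \<Longrightarrow> (Z has_real_derivative \<zeta> r) (at r)" and \<zeta>: "continuous_on {0<..} \<zeta>" for Z \<zeta>
  proof -
    have \<zeta>12: "continuous_on {1..2} \<zeta>" by (rule continuous_on_subset[OF \<zeta>]) auto
    define \<zeta>1 where "\<zeta>1 t = indicator {1..2} t * \<zeta> t" for t
    have \<zeta>1_int: "integrable lborel \<zeta>1"
      using borel_integrable_atLeastAtMost'[OF \<zeta>12] by (simp add: \<zeta>1_def[abs_def] set_integrable_def)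
    then have [measurable]: "\<zeta>1 \<in> borel_measurable borel" using borel_measurable_integrable by fastforce
    have prod: "integrable (lborel \<Otimes>\<^sub>M lborel) (\<lambda>(x, t). H x * \<zeta>1 t)"
    proof (rule lborel_pair.Fubini_integrable)
      show "AE x in lborel. integrable lborel (\<lambda>t. case (x, t) of (x, t) \<Rightarrow> H x * \<zeta>1 t)"
        using \<zeta>1_int by simp
      show "integrable lborel (\<lambda>x. \<integral>t. norm (case (x, t) of (x, t) \<Rightarrow> H x * \<zeta>1 t) \<partial>lborel)"
        using H_int by (simp add: abs_mult)
    qed measurable
    have int: "integrable (lborel \<Otimes>\<^sub>M lborel) (\<lambda>(x, t). if t < norm x then H x * \<zeta>1 t else 0)"
      by (rule Bochner_Integration.integrable_bound[OF prod]) (measurable, auto)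
    \<comment> \<open>Fubini on the region t < norm x: integrating over x produces \<Phi>,
      integrating over t produces Z (norm x) - Z 1. The constant Z 1 drops out because
      \<open>H\<close> has integral 0.\<close>
    have "(\<integral>t. (\<integral>x. (if t < norm x then H x * \<zeta>1 t else 0) \<partial>lborel) \<partial>lborel) =
        (\<integral>x. (\<integral>t. (if t < norm x then H x * \<zeta>1 t else 0) \<partial>lborel) \<partial>lborel)"
      by (rule lborel_pair.Fubini_integral[OF int])
    moreover have "(\<integral>x. (if t < norm x then H x * \<zeta>1 t else 0) \<partial>lborel) = \<Phi> t * \<zeta>1 t" for t
    proof -
      have "(\<integral>x. (if t < norm x then H x * \<zeta>1 t else 0) \<partial>lborel) =
          (\<integral>x. (if t < norm x then H x else 0) * \<zeta>1 t \<partial>lborel)"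
        by (intro Bochner_Integration.integral_cong) auto
      then show ?thesis by (simp add: \<Phi>_def)
    qed
    moreover have "(\<integral>t. (if t < norm x then H x * \<zeta>1 t else 0) \<partial>lborel) = H x * (Z (norm x) - Z 1)" for x
    proof (cases "x \<in> annulus")
      case True
      then have r: "1 < norm x" "norm x < 2" by (auto simp: annulus_def)
      have "(\<integral>t. (if t < norm x then H x * \<zeta>1 t else 0) \<partial>lborel) =
          (\<integral>t. H x * (indicator {1..norm x} t *\<^sub>R \<zeta> t) \<partial>lborel)"
      proof (rule integral_cong_AE)
        show "AE t in lborel. (if t < norm x then H x * \<zeta>1 t else 0) = H x * (indicator {1..norm x} t *\<^sub>R \<zeta> t)"
          using AE_lborel_singleton[of "norm x"]
          by eventually_elim (use r in \<open>auto simp: \<zeta>1_def split: split_indicator\<close>)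
        have "continuous_on {1..norm x} \<zeta>" by (rule continuous_on_subset[OF \<zeta>]) auto
        then have "(\<lambda>t. indicator {1..norm x} t *\<^sub>R \<zeta> t) \<in> borel_measurable borel"
          by (intro borel_measurable_continuous_on_indicator) auto
        then show "(\<lambda>t. H x * (indicator {1..norm x} t *\<^sub>R \<zeta> t)) \<in> borel_measurable lborel"
          by simp
      qed measurable
      also have "\<dots> = H x * integral {1..norm x} \<zeta>"
        using set_borel_integral_eq_integral(2)[OF borel_integrable_atLeastAtMost'[of 1 "norm x" \<zeta>]]
          continuous_on_subset[OF \<zeta>, of "{1..norm x}"]
        by (simp add: set_lebesgue_integral_def subset_eq)
      also have "integral {1..norm x} \<zeta> = Z (norm x) - Z 1"
        by (intro integral_unique fundamental_theorem_of_calculus)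
          (use r in \<open>auto simp flip: has_real_derivative_iff_has_vector_derivative
            intro: has_field_derivative_at_within[OF Z]\<close>)
      finally show ?thesis .
    next
      case False
      then have "H x = 0" by (simp add: H_def)
      then show ?thesis by (simp cong: if_cong)
    qed
    ultimately have *: "(\<integral>t. \<Phi> t * \<zeta>1 t \<partial>lborel) = (\<integral>x. H x * (Z (norm x) - Z 1) \<partial>lborel)" by simp
    have cZ: "continuous_on {0<..} Z"
      by (rule DERIV_continuous_on[OF has_field_derivative_at_within[OF Z]]) simp
    have HZ: "integrable lborel (\<lambda>x. H x * Z (norm x))"
      using mult_int[OF H_set cZ] by (simp add: set_integrable_def H_def mult.assoc)
    have "(\<integral>x. H x * (Z (norm x) - Z 1) \<partial>lborel) = (\<integral>x. H x * Z (norm x) \<partial>lborel)"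
      using HZ H_int H0 by (simp add: right_diff_distrib)
    moreover have "(\<integral>t. \<Phi> t * \<zeta>1 t \<partial>lborel) = integral {1..2} (\<lambda>t. \<Phi> t * \<zeta> t)"
    proof -
      have "continuous_on {1..2} (\<lambda>t. \<Phi> t * \<zeta> t)"
        by (intro continuous_intros \<zeta>12 continuous_on_subset[OF cont_\<Phi>]) auto
      from set_borel_integral_eq_integral(2)[OF borel_integrable_atLeastAtMost'[OF this]]
      show ?thesis by (simp add: set_lebesgue_integral_def \<zeta>1_def mult_ac)
    qed
    moreover have "integral {1..2} (\<lambda>t. \<Phi> t * \<zeta> t) = - ?c * integral {1..2} (\<lambda>r. V r * \<zeta> r)"
    proof -
      have "(\<lambda>t. \<Phi> t * \<zeta> t) = (\<lambda>t. - ?c * (V t * \<zeta> t))"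
        using vol by (intro ext) (simp add: V_def)
      then show ?thesis by (simp only: integral_mult_right)
    qed
    ultimately show ?thesis using * by simp
  qed
  have V_cont: "continuous_on A V" for A
    unfolding V_def[abs_def]
    by (intro continuous_intros continuous_on_subset[OF cont_\<Phi>]) (use vol in auto)
  have V_12: "V 1 = 0" "V 2 = 0"
  proof -
    have "\<Phi> 1 = (\<integral>x. H x \<partial>lborel)" "\<Phi> 2 = (\<integral>x. 0 \<partial>(lborel :: 'a measure))"
      unfolding \<Phi>_def by (intro Bochner_Integration.integral_cong; auto simp: H_def annulus_def split: split_indicator)+
    then show "V 1 = 0" "V 2 = 0" by (simp_all add: V_def H0)
  qed
  let ?d = "\<lambda>x. u x - V (norm x)"
  have V_radial: "set_integrable lborel annulus (\<lambda>x::'a. V (norm x))"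
    by (rule integrable_annulus_continuous[OF cont_radial[OF V_cont]])
  have d_int: "set_integrable lborel annulus ?d"
    by (intro set_integral_diff u_int V_radial)
  have test: "(LINT x:annulus|lborel. ?d x * \<zeta> (norm x)) = 0" if \<zeta>: "continuous_on UNIV \<zeta>" for \<zeta>
  proof -
    \<comment> \<open>The weight r^(N-1) cancels the denominator in \<open>flux\<close>, and an
      antiderivative of the weighted function serves as Z.\<close>
    let ?\<zeta> = "\<lambda>r. r ^ (?N - 1) * \<zeta> r"
    have c\<zeta>: "continuous_on A ?\<zeta>" for A
      by (intro continuous_intros continuous_on_subset[OF \<zeta>]) auto
    have Z: "((\<lambda>r. integral {0..r} ?\<zeta>) has_real_derivative ?\<zeta> r) (at r)" if "r > 0" for r
    proof -
      have "((\<lambda>r. integral {0..r} ?\<zeta>) has_real_derivative ?\<zeta> r) (at r within {0..r + 1})"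
        using that by (intro integral_has_real_derivative c\<zeta>) auto
      then show ?thesis using that by (simp add: at_within_Icc_at)
    qed
    have c\<zeta>': "continuous_on {0<..} \<zeta>" by (rule continuous_on_subset[OF \<zeta>]) auto
    have "(LINT x:annulus|lborel. u x * (?\<zeta> (norm x) / norm x ^ (?N - 1))) =
        ?c * integral {1..2} (\<lambda>r. V r * ?\<zeta> r)"
      using flux[OF Z c\<zeta>] LINT_Z[OF Z c\<zeta>] by simp
    moreover have "(LINT x:annulus|lborel. u x * (?\<zeta> (norm x) / norm x ^ (?N - 1))) =
        (LINT x:annulus|lborel. u x * \<zeta> (norm x))"
      by (rule set_lebesgue_integral_cong) (auto simp: annulus_def)
    moreover have "(LINT x:annulus|lborel. V (norm (x::'a)) * \<zeta> (norm x)) = ?c * integral {1..2} (\<lambda>r. V r * ?\<zeta> r)"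
    proof -
      have "continuous_on {1..2} (\<lambda>r. V r * \<zeta> r)"
        by (intro continuous_intros V_cont continuous_on_subset[OF \<zeta>]) auto
      from polar_continuous(2)[where 'a = 'a, OF this] show ?thesis
        by (simp add: set_lebesgue_integral_def mult_ac)
    qed
    moreover have "(LINT x:annulus|lborel. ?d x * \<zeta> (norm x)) =
        (LINT x:annulus|lborel. u x * \<zeta> (norm x)) - (LINT x:annulus|lborel. V (norm (x::'a)) * \<zeta> (norm x))"
      unfolding left_diff_distrib by (intro set_integral_diff mult_int u_int V_radial c\<zeta>')
    ultimately show ?thesis by simp
  qed
  obtain v where v: "AE x in lborel. x \<in> annulus \<longrightarrow> u x = v (norm x)"
    using radial unfolding radial_on_def by blast
  have le: "AE x in lborel. x \<in> annulus \<longrightarrow> ?d x \<le> 0"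
    by (rule radial_nonpos_AE[OF d_int _ test, where w = "\<lambda>r. v r - V r"])
      (use v in \<open>auto elim!: eventually_mono\<close>)
  \<comment> \<open>The sign lemma is one-sided, so it is applied once more with the opposite
    sign.\<close>
  have ge: "AE x in lborel. x \<in> annulus \<longrightarrow> - 1 * ?d x \<le> 0"
  proof (rule radial_nonpos_AE[where w = "\<lambda>r. - 1 * (v r - V r)"])
    show "set_integrable lborel annulus (\<lambda>x. - 1 * ?d x)"
      by (intro set_integrable_mult_right d_int)
    show "AE x in lborel. x \<in> annulus \<longrightarrow> - 1 * ?d x = - 1 * (v (norm x) - V (norm x))"
      using v by (auto elim!: eventually_mono)
    show "(LINT x:annulus|lborel. - 1 * ?d x * \<zeta> (norm x)) = 0" if "continuous_on UNIV \<zeta>" for \<zeta>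
      using test[OF that] by (simp only: mult.assoc set_integral_mult_right)
  qed
  have "AE x in lborel. x \<in> annulus \<longrightarrow> u x = V (norm x)"
    using le ge by eventually_elim auto
  then show ?thesis
    using that[OF V_cont V_12] LINT_Z unfolding radial_flux_def LINT_H by blast
qed

section \<open>Reduction to the ordinary differential equation\<close>

lemma weak_radial_equation:
  fixes u :: "'a::euclidean_space \<Rightarrow> real"
  assumes V: "continuous_on UNIV V" "\<And>r. r \<in> {1..2} \<Longrightarrow> 0 \<le> V r" and p: "2 < p"
    and uV: "AE x in lborel. x \<in> annulus \<longrightarrow> u x = V (norm x)"
    and flux: "radial_flux g V"
    and u: "set_integrable lborel annulus u" and g: "set_integrable lborel annulus g"
    and weak: "\<And>\<phi>. test_fun annulus \<phi> \<Longrightarrow> set_integrable lborel annulus (\<lambda>x. u x powr (p - 1) * \<phi> x) \<and>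
      (LINT x:annulus|lborel. g x \<bullet> grad \<phi> x + lam * u x * \<phi> x) =
      (LINT x:annulus|lborel. u x powr (p - 1) * \<phi> x)"
    and n: "n = DIM('a) - 1"
    and \<theta>: "Cinf \<theta>" "1 < a" "b < 2" "\<And>r. r < a \<or> b < r \<Longrightarrow> \<theta> r = 0"
  shows "integral {1..2} (\<lambda>r. V r * (real n * r ^ (n - 1) * pderiv \<theta> 1 r + r ^ n * pderiv (pderiv \<theta> 1) 1 r)) =
    - integral {1..2} (\<lambda>r. r ^ n * (V r powr (p - 1) - lam * V r) * \<theta> r)"
proof -
  let ?c = "sphere_area TYPE('a)"
  define \<phi> where "\<phi> x = \<theta> (norm x)" for x :: 'a
  have test: "test_fun annulus \<phi>"
    unfolding \<phi>_def[abs_def] by (rule test_fun_radial[OF \<theta>])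
  have d\<theta>: "(\<theta> has_real_derivative pderiv \<theta> 1 r) (at r)"
    "(pderiv \<theta> 1 has_real_derivative pderiv (pderiv \<theta> 1) 1 r) (at r)" for r
    using Cinf_has_real_derivative[OF \<theta>(1)] Cinf_has_real_derivative[OF Cinf_pderiv[OF \<theta>(1)]]
    by (auto simp: Basis_real_def)
  have c\<theta>: "continuous_on A \<theta>" "continuous_on A (pderiv \<theta> 1)" "continuous_on A (pderiv (pderiv \<theta> 1) 1)" for A
    using \<theta>(1) Cinf_pderiv[OF \<theta>(1)] Cinf_pderiv[OF Cinf_pderiv[OF \<theta>(1)]]
    by (auto intro!: Cinf_continuous simp: Basis_real_def)
  have cV: "continuous_on A V" for A using V(1) continuous_on_subset by blast
  have cVp: "continuous_on {1..2} (\<lambda>r. V r powr (p - 1))"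
    using p by (intro continuous_on_powr' continuous_intros cV) (auto intro: V(2))
  \<comment> \<open>For \<phi> = \<theta>(|x|) the product g \<bullet> grad \<phi> is (g \<bullet>
    x) / |x|^N times r^n \<theta>'; with this Z the flux identity moves the derivative from the weak
    gradient onto \<theta>.\<close>
  define Z where "Z r = r ^ n * pderiv \<theta> 1 r" for r
  define \<zeta> where "\<zeta> r = real n * r ^ (n - 1) * pderiv \<theta> 1 r + r ^ n * pderiv (pderiv \<theta> 1) 1 r" for r
  have Z: "(Z has_real_derivative \<zeta> r) (at r)" for r
    unfolding Z_def[abs_def] \<zeta>_def by (auto intro!: derivative_eq_intros d\<theta>)
  have c\<zeta>: "continuous_on A \<zeta>" for A
    unfolding \<zeta>_def[abs_def] by (intro continuous_intros c\<theta>)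
  have grad: "grad \<phi> x = (pderiv \<theta> 1 (norm x) / norm x) *\<^sub>R x" for x
  proof -
    have "pderiv \<phi> b x = pderiv \<theta> 1 (norm x) / norm x * (x \<bullet> b)" for b
      unfolding \<phi>_def[abs_def] using \<theta> by (intro Cinf_radial(2)[of \<theta> a]) auto
    then have "grad \<phi> x = (\<Sum>b\<in>Basis. (pderiv \<theta> 1 (norm x) / norm x) *\<^sub>R ((x \<bullet> b) *\<^sub>R b))"
      by (simp add: grad_def)
    then show ?thesis by (simp only: scaleR_sum_right[symmetric] euclidean_representation)
  qed
  have first: "(LINT x:annulus|lborel. g x \<bullet> grad \<phi> x) = - ?c * integral {1..2} (\<lambda>r. V r * \<zeta> r)"
  proof -
    have "(LINT x:annulus|lborel. g x \<bullet> grad \<phi> x) =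
        (LINT x:annulus|lborel. ((g x \<bullet> x) / norm x ^ DIM('a)) * Z (norm x))"
    proof (rule set_lebesgue_integral_cong)
      have N: "r ^ DIM('a) = r * r ^ n" for r :: real
        using DIM_positive[where 'a = 'a] unfolding n by (cases "DIM('a)") auto
      show "\<forall>x. x \<in> annulus \<longrightarrow> g x \<bullet> grad \<phi> x = ((g x \<bullet> x) / norm x ^ DIM('a)) * Z (norm x)"
        by (auto simp: annulus_def grad Z_def N)
    qed simp
    then show ?thesis using flux Z c\<zeta> unfolding radial_flux_def by simp
  qed
  have polar: "(LINT x:annulus|lborel. f (norm (x::'a))) = ?c * integral {1..2} (\<lambda>r. r ^ n * f r)"
    and polar_int: "set_integrable lborel annulus (\<lambda>x::'a. f (norm x))"
    if "continuous_on {1..2} f" for f :: "real \<Rightarrow> real"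
    using polar_continuous[where 'a = 'a, OF that]
    by (auto simp: n set_lebesgue_integral_def set_integrable_def)
  have cl: "continuous_on {1..2} (\<lambda>r. lam * V r * \<theta> r)"
    and cr: "continuous_on {1..2} (\<lambda>r. V r powr (p - 1) * \<theta> r)"
    by (intro continuous_intros cV c\<theta> cVp)+
  have g_grad: "set_integrable lborel annulus (\<lambda>x. g x \<bullet> grad \<phi> x)"
    and u_\<phi>: "set_integrable lborel annulus (\<lambda>x. lam * u x * \<phi> x)"
    using set_integrable_inner_continuous[OF g, of "grad \<phi>"]
      set_integrable_mult_right[OF set_integrable_inner_continuous[OF u, of \<phi>], of lam] test
    by (auto simp: test_fun_def mult.assoc intro: continuous_grad Cinf_continuous)
  have "(LINT x:annulus|lborel. g x \<bullet> grad \<phi> x + lam * u x * \<phi> x) =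
      (LINT x:annulus|lborel. g x \<bullet> grad \<phi> x + lam * V (norm x) * \<theta> (norm x))"
    by (intro annulus_integral_cong_AE set_integral_add g_grad u_\<phi> polar_int[OF cl])
      (use uV in \<open>auto elim!: eventually_mono simp: \<phi>_def\<close>)
  also have "\<dots> = - ?c * integral {1..2} (\<lambda>r. V r * \<zeta> r) + ?c * integral {1..2} (\<lambda>r. r ^ n * (lam * V r * \<theta> r))"
    unfolding set_integral_add(2)[OF g_grad polar_int[OF cl]] first polar[OF cl] ..
  finally have L: "(LINT x:annulus|lborel. g x \<bullet> grad \<phi> x + lam * u x * \<phi> x) = \<dots>" .
  have "(LINT x:annulus|lborel. u x powr (p - 1) * \<phi> x) =
      (LINT x:annulus|lborel. V (norm (x::'a)) powr (p - 1) * \<theta> (norm x))"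
    by (intro annulus_integral_cong_AE conjunct1[OF weak[OF test]] polar_int[OF cr])
      (use uV in \<open>auto elim!: eventually_mono simp: \<phi>_def\<close>)
  also have "\<dots> = ?c * integral {1..2} (\<lambda>r. r ^ n * (V r powr (p - 1) * \<theta> r))"
    by (rule polar[OF cr])
  finally have "?c * (integral {1..2} (\<lambda>r. r ^ n * (lam * V r * \<theta> r)) - integral {1..2} (\<lambda>r. V r * \<zeta> r)) =
      ?c * integral {1..2} (\<lambda>r. r ^ n * (V r powr (p - 1) * \<theta> r))"
    using L conjunct2[OF weak[OF test]] by (simp add: right_diff_distrib)
  then have "integral {1..2} (\<lambda>r. r ^ n * (lam * V r * \<theta> r)) - integral {1..2} (\<lambda>r. V r * \<zeta> r) =
      integral {1..2} (\<lambda>r. r ^ n * (V r powr (p - 1) * \<theta> r))"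
    using sphere_area_pos[where 'a = 'a] by (simp only: mult_cancel_left) linarith
  moreover have "integral {1..2} (\<lambda>r. r ^ n * (V r powr (p - 1) - lam * V r) * \<theta> r) =
      integral {1..2} (\<lambda>r. r ^ n * (V r powr (p - 1) * \<theta> r)) - integral {1..2} (\<lambda>r. r ^ n * (lam * V r * \<theta> r))"
  proof -
    have "(\<lambda>r. r ^ n * (V r powr (p - 1) - lam * V r) * \<theta> r) =
        (\<lambda>r. r ^ n * (V r powr (p - 1) * \<theta> r) - r ^ n * (lam * V r * \<theta> r))"
      by (simp add: algebra_simps)
    then show ?thesis
      by (simp only:) (intro integral_diff integrable_continuous_real continuous_on_mult cl cr continuous_intros)
  qed
  ultimately show ?thesis unfolding \<zeta>_def by linarith
qed

lemma open_AE_notin_imp_empty: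
  fixes S :: "'a::euclidean_space set"
  assumes "open S" "AE x in lborel. x \<notin> S"
  shows "S = {}"
proof -
  have "S \<in> null_sets lborel"
    using assms AE_iff_null_sets[of S lborel] by simp
  then have "negligible S"
    by (simp add: negligible_iff_null_sets null_sets_completion_iff assms(1))
  then show ?thesis using open_not_negligible[OF assms(1)] by blast
qed

text \<open>Formally (r^n V')' + f = 0 with f = r^n (V^(p-1) - lam V). With q' = n r^(n-1) V,
  \<Psi>' = F and F' = f, the function G = r^n V - q + \<Psi> has weak second derivative 0, hence is
  affine, and \<open>V\<close> inherits the smoothness of q and \<Psi>. Strict positivity is
  uniqueness for the initial value problem: a zero would be a double zero, and \<open>V\<close>
  would vanish on an interval to its right, against \<open>dense\<close>.\<close>

lemma profile_of_continuous_weak_solution: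
  fixes V :: "real \<Rightarrow> real"
  assumes p: "2 < p" and lam: "0 < lam"
    and V: "continuous_on UNIV V" "V 1 = 0" "V 2 = 0"
    and dense: "\<And>a b. 1 \<le> a \<Longrightarrow> a < b \<Longrightarrow> b \<le> 2 \<Longrightarrow> \<exists>r. a < r \<and> r < b \<and> 0 < V r"
    and nonneg: "\<And>r. r \<in> {1..2} \<Longrightarrow> 0 \<le> V r"
    and weak: "\<And>\<theta> a b. Cinf \<theta> \<Longrightarrow> 1 < a \<Longrightarrow> b < 2 \<Longrightarrow> (\<And>r. r < a \<or> b < r \<Longrightarrow> \<theta> r = 0) \<Longrightarrow>
      integral {1..2} (\<lambda>r. V r * (real n * r ^ (n - 1) * pderiv \<theta> 1 r + r ^ n * pderiv (pderiv \<theta> 1) 1 r)) =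
      - integral {1..2} (\<lambda>r. r ^ n * (V r powr (p - 1) - lam * V r) * \<theta> r)"
  obtains W where "profile n lam p V W"
proof -
  have cV: "continuous_on A V" for A using V(1) continuous_on_subset by blast
  have cVp: "continuous_on {1..2} (\<lambda>r. V r powr (p - 1))"
    using p by (intro continuous_on_powr' continuous_intros cV) (auto intro: nonneg)
  define f where "f r = r ^ n * (V r powr (p - 1) - lam * V r)" for r
  have cf: "continuous_on {1..2} f" unfolding f_def by (intro continuous_intros cV cVp)
  define F where "F r = integral {1..r} f" for r
  have dF: "(F has_real_derivative f r) (at r within {1..2})" if "r \<in> {1..2}" for r
    unfolding F_def using integral_has_real_derivative[OF cf that] .
  have cF: "continuous_on {1..2} F" by (rule DERIV_continuous_on[OF dF])
  define \<Psi> where "\<Psi> r = integral {1..r} F" for r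
  have d\<Psi>: "(\<Psi> has_real_derivative F r) (at r within {1..2})" if "r \<in> {1..2}" for r
    unfolding \<Psi>_def using integral_has_real_derivative[OF cF that] .
  have c\<Psi>: "continuous_on {1..2} \<Psi>" by (rule DERIV_continuous_on[OF d\<Psi>])
  define q where "q r = integral {1..r} (\<lambda>r. real n * r ^ (n - 1) * V r)" for r
  have dq: "(q has_real_derivative real n * r ^ (n - 1) * V r) (at r within {1..2})" if "r \<in> {1..2}" for r
    unfolding q_def using that by (intro integral_has_real_derivative continuous_intros cV)
  have cq: "continuous_on {1..2} q" by (rule DERIV_continuous_on[OF dq])
  define G where "G r = r ^ n * V r - q r + \<Psi> r" for r
  have cG: "continuous_on {1..2} G"
    unfolding G_def by (intro continuous_intros cV cq c\<Psi>)
  obtain \<alpha> \<beta> where affine: "\<And>r. r \<in> {1..2} \<Longrightarrow> G r = \<alpha> + \<beta> * r"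
  proof (rule weak_second_derivative_zero_imp_affine[OF cG])
    fix \<theta> :: "real \<Rightarrow> real" and a b :: real
    assume \<theta>: "Cinf \<theta>" "1 < a" "b < 2" "\<And>r. r < a \<or> b < r \<Longrightarrow> \<theta> r = 0"
    define \<theta>1 where "\<theta>1 = pderiv \<theta> 1"
    define \<theta>2 where "\<theta>2 = pderiv \<theta>1 1"
    have C: "Cinf \<theta>1" "Cinf \<theta>2"
      using Cinf_pderiv[OF \<theta>(1)] Cinf_pderiv[OF Cinf_pderiv[OF \<theta>(1)]]
      by (auto simp: Basis_real_def \<theta>1_def \<theta>2_def)
    have c: "continuous_on A \<theta>" "continuous_on A \<theta>1" "continuous_on A \<theta>2" for A
      by (intro Cinf_continuous \<theta> C)+
    have d: "(\<theta> has_real_derivative \<theta>1 r) (at r within A)" "(\<theta>1 has_real_derivative \<theta>2 r) (at r within A)" for r A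
      unfolding \<theta>1_def \<theta>2_def
      using Cinf_has_real_derivative[OF \<theta>(1)] Cinf_has_real_derivative[OF C(1)]
      by (auto intro: has_field_derivative_at_within simp: \<theta>1_def)
    have "\<theta> 1 = 0" "\<theta> 2 = 0" using \<theta> by auto
    moreover have "\<theta>1 1 = 0"
      unfolding \<theta>1_def
      by (rule pderiv_real_eq, rule has_field_derivative_transform_within_open[of "\<lambda>_. 0" 0 1 "{..<a}"])
        (use \<theta> in auto)
    moreover have "\<theta>1 2 = 0"
      unfolding \<theta>1_def
      by (rule pderiv_real_eq, rule has_field_derivative_transform_within_open[of "\<lambda>_. 0" 0 2 "{b<..}"])
        (use \<theta> in auto)
    \<comment> \<open>The integrand is the exact derivative of - q \<theta>' + \<Psi> \<theta>' - F
      \<theta>, in which the terms F \<theta>' cancel; the boundary values vanish together with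
      \<theta> and \<theta>'.\<close>
    moreover have "((\<lambda>r. - (real n * r ^ (n - 1) * V r) * \<theta>1 r - q r * \<theta>2 r + \<Psi> r * \<theta>2 r - f r * \<theta> r) has_integral
        (- q 2 * \<theta>1 2 + \<Psi> 2 * \<theta>1 2 - F 2 * \<theta> 2) - (- q 1 * \<theta>1 1 + \<Psi> 1 * \<theta>1 1 - F 1 * \<theta> 1)) {1..2}"
    proof (rule fundamental_theorem_of_calculus)
      fix r :: real assume r: "r \<in> {1..2}"
      have "((\<lambda>r. - q r * \<theta>1 r + \<Psi> r * \<theta>1 r - F r * \<theta> r) has_real_derivative
          (- (real n * r ^ (n - 1) * V r) * \<theta>1 r + \<theta>2 r * (- q r)) + (F r * \<theta>1 r + \<theta>2 r * \<Psi> r)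
          - (f r * \<theta> r + \<theta>1 r * F r)) (at r within {1..2})"
        by (intro DERIV_add DERIV_diff DERIV_mult DERIV_minus d dq[OF r] d\<Psi>[OF r] dF[OF r])
      then show "((\<lambda>r. - q r * \<theta>1 r + \<Psi> r * \<theta>1 r - F r * \<theta> r) has_vector_derivative
          - (real n * r ^ (n - 1) * V r) * \<theta>1 r - q r * \<theta>2 r + \<Psi> r * \<theta>2 r - f r * \<theta> r) (at r within {1..2})"
        unfolding has_real_derivative_iff_has_vector_derivative by (simp add: algebra_simps)
    qed simp
    ultimately have I0: "((\<lambda>r. - (real n * r ^ (n - 1) * V r) * \<theta>1 r - q r * \<theta>2 r + \<Psi> r * \<theta>2 r - f r * \<theta> r)
        has_integral 0) {1..2}" by simp
    have I1: "((\<lambda>r. V r * (real n * r ^ (n - 1) * \<theta>1 r + r ^ n * \<theta>2 r)) has_integral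
        - integral {1..2} (\<lambda>r. f r * \<theta> r)) {1..2}"
    proof -
      have "continuous_on {1..2} (\<lambda>r. V r * (real n * r ^ (n - 1) * \<theta>1 r + r ^ n * \<theta>2 r))"
        by (intro continuous_intros cV c)
      from integrable_integral[OF integrable_continuous_real[OF this]] show ?thesis
        using weak[OF \<theta>] by (simp only: \<theta>1_def \<theta>2_def f_def)
    qed
    have I2: "((\<lambda>r. f r * \<theta> r) has_integral integral {1..2} (\<lambda>r. f r * \<theta> r)) {1..2}"
      by (intro integrable_integral integrable_continuous_real continuous_intros cf c)
    have "((\<lambda>r. (- (real n * r ^ (n - 1) * V r) * \<theta>1 r - q r * \<theta>2 r + \<Psi> r * \<theta>2 r - f r * \<theta> r) +
        V r * (real n * r ^ (n - 1) * \<theta>1 r + r ^ n * \<theta>2 r) + f r * \<theta> r) has_integral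
        0 + - integral {1..2} (\<lambda>r. f r * \<theta> r) + integral {1..2} (\<lambda>r. f r * \<theta> r)) {1..2}"
      by (intro has_integral_add I0 I1 I2)
    moreover have "(\<lambda>r. (- (real n * r ^ (n - 1) * V r) * \<theta>1 r - q r * \<theta>2 r + \<Psi> r * \<theta>2 r - f r * \<theta> r) +
        V r * (real n * r ^ (n - 1) * \<theta>1 r + r ^ n * \<theta>2 r) + f r * \<theta> r) = (\<lambda>r. G r * \<theta>2 r)"
      by (intro ext) (simp add: G_def algebra_simps)
    ultimately have "((\<lambda>r. G r * \<theta>2 r) has_integral 0) {1..2}" by simp
    then show "integral {1..2} (\<lambda>r. G r * pderiv (pderiv \<theta> 1) 1 r) = 0"
      unfolding \<theta>2_def \<theta>1_def by (rule integral_unique)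
  qed (rule that)
  \<comment> \<open>Differentiating the affine identity gives r^n V' = \<beta> - F.\<close>
  define W where "W r = \<beta> - F r" for r
  have V_eq: "V r = (\<alpha> + \<beta> * r + q r - \<Psi> r) / r ^ n" if "r \<in> {1..2}" for r
  proof -
    have "r ^ n * V r = \<alpha> + \<beta> * r + q r - \<Psi> r" using affine[OF that] by (simp add: G_def)
    then show ?thesis using that by (simp add: field_simps)
  qed
  have at: "at r within {1..2} = at r" if "1 < r" "r < 2" for r :: real
    using that by (simp add: at_within_Icc_at)
  have dV: "(V has_real_derivative W r / r ^ n) (at r)" if r: "1 < r" "r < 2" for r
  proof -
    have r': "r \<in> {1..2}" using r by simp
    note d = dq[OF r', unfolded at[OF r]] d\<Psi>[OF r', unfolded at[OF r]]
    have "((\<lambda>r. (\<alpha> + \<beta> * r + q r - \<Psi> r) / r ^ n) has_real_derivative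
        ((\<beta> + real n * r ^ (n - 1) * V r - F r) * r ^ n - (\<alpha> + \<beta> * r + q r - \<Psi> r) * (real n * r ^ (n - 1)))
          / (r ^ n * r ^ n)) (at r)"
      using r by (auto intro!: derivative_eq_intros d)
    moreover have "((\<beta> + real n * r ^ (n - 1) * V r - F r) * r ^ n - (\<alpha> + \<beta> * r + q r - \<Psi> r) * (real n * r ^ (n - 1)))
          / (r ^ n * r ^ n) = W r / r ^ n"
    proof -
      have "\<alpha> + \<beta> * r + q r - \<Psi> r = r ^ n * V r" using V_eq[OF r'] r by simp
      then show ?thesis unfolding W_def using r by (simp add: field_simps)
    qed
    ultimately have "((\<lambda>r. (\<alpha> + \<beta> * r + q r - \<Psi> r) / r ^ n) has_real_derivative W r / r ^ n) (at r)" by simp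
    then show ?thesis
      by (rule has_field_derivative_transform_within_open[of _ _ _ "{1<..<2}"]) (use r V_eq in auto)
  qed
  have dW: "(W has_real_derivative r ^ n * (lam * V r - V r powr (p - 1))) (at r)" if r: "1 < r" "r < 2" for r
  proof -
    have "(W has_real_derivative 0 - f r) (at r)"
      unfolding W_def[abs_def] using dF[of r] r at[OF r] by (intro DERIV_diff DERIV_const) auto
    then show ?thesis by (simp add: f_def algebra_simps)
  qed
  have cW: "continuous_on {1..2} W" unfolding W_def by (intro continuous_intros cF)
  have pos: "0 < V r0" if r0: "1 < r0" "r0 < 2" for r0
  proof (rule ccontr)
    assume "\<not> 0 < V r0"
    then have V0: "V r0 = 0" using nonneg[of r0] r0 by simp
    \<comment> \<open>A zero of V \<ge> 0 is an interior minimum, so both initial data at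
      \<open>r0\<close> vanish.\<close>
    have "W r0 / r0 ^ n = 0"
    proof (rule DERIV_local_min[OF dV[OF r0], of "min (r0 - 1) (2 - r0)"])
      show "\<forall>y. \<bar>r0 - y\<bar> < min (r0 - 1) (2 - r0) \<longrightarrow> V r0 \<le> V y"
        using V0 nonneg by (auto simp: abs_less_iff)
    qed (use r0 in auto)
    then have W0: "W r0 = 0" using r0 by simp
    obtain m where m: "m \<in> {1..2}" "\<And>r. r \<in> {1..2} \<Longrightarrow> V r \<le> V m"
      using continuous_attains_sup[of "{1..2::real}" V] cV by auto
    define K where "K = 2 ^ n * (V m powr (p - 2) + lam)"
    have K: "K > 0" using lam by (simp add: K_def add_nonneg_pos)
    have fK: "\<bar>r ^ n * (lam * V r - V r powr (p - 1))\<bar> \<le> K * V r" if r: "r \<in> {1..2}" for r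
    proof -
      have Vr: "V r powr (p - 1) = V r * V r powr (p - 2)"
        using powr_mult_base[of "V r" "p - 2"] nonneg[OF r] by simp
      have "lam * V r - V r powr (p - 1) = V r * (lam - V r powr (p - 2))"
        by (simp add: Vr algebra_simps)
      moreover have "\<bar>lam - V r powr (p - 2)\<bar> \<le> V m powr (p - 2) + lam"
        using powr_mono2[of "p - 2" "V r" "V m"] nonneg[OF r] m(2)[OF r] p lam powr_ge_zero[of "V r" "p - 2"] by linarith
      moreover have "r ^ n \<le> 2 ^ n" "0 \<le> r ^ n" using r by (auto intro: power_mono)
      ultimately have "\<bar>r ^ n * (lam * V r - V r powr (p - 1))\<bar> \<le> 2 ^ n * (V r * (V m powr (p - 2) + lam))"
        using nonneg[OF r] unfolding abs_mult by (intro mult_mono) (auto simp: abs_mult mult_left_mono)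
      then show ?thesis by (simp add: K_def mult_ac)
    qed
    \<comment> \<open>The mean value theorem for \<open>W\<close> and for \<open>V\<close> gains a
      factor \<delta> each, so the maximum V s over [r0, r0 + \<delta>] satisfies V s \<le>
      \<delta>^2 K V s. The choice makes \<delta>^2 K < 1 and keeps the interval below 2; the
      halving makes the inequalities strict.\<close>
    define \<delta> where "\<delta> = min (2 - r0) (1 / (1 + K)) / 2"
    have \<delta>: "0 < \<delta>" "r0 + \<delta> < 2" "\<delta> * (1 + K) < 1"
    proof -
      show "0 < \<delta>" using r0 K by (simp add: \<delta>_def)
      show "r0 + \<delta> < 2" using r0 by (auto simp: \<delta>_def min_def field_simps)
      have "\<delta> \<le> 1 / (1 + K) / 2" unfolding \<delta>_def by (intro divide_right_mono) auto
      then have "\<delta> * (1 + K) \<le> 1 / 2" using K by (simp add: field_simps)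
      then show "\<delta> * (1 + K) < 1" by simp
    qed
    have "\<delta> * \<delta> * K < 1"
    proof -
      have "\<delta> * 1 \<le> \<delta> * (1 + K)" "\<delta> * K \<le> \<delta> * (1 + K)" using \<delta>(1) K by (intro mult_left_mono; simp)+
      then have "\<delta> < 1" "\<delta> * K < 1" using \<delta>(3) by linarith+
      then have "\<delta> * (\<delta> * K) < 1 * 1" using \<delta>(1) K by (intro mult_strict_mono) auto
      then show ?thesis by (simp add: mult.assoc)
    qed
    obtain s where s: "s \<in> {r0..r0 + \<delta>}" "\<And>r. r \<in> {r0..r0 + \<delta>} \<Longrightarrow> V r \<le> V s"
      using continuous_attains_sup[of "{r0..r0 + \<delta>}" V] cV \<delta>(1) by auto
    have Vs: "0 \<le> V s" using s(1) r0 \<delta> by (intro nonneg) auto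
    have W_bound: "W x \<le> \<delta> * (K * V s)" if x: "r0 < x" "x \<le> r0 + \<delta>" for x
    proof -
      obtain y where y: "r0 < y" "y < x" "W x - W r0 = (x - r0) * (y ^ n * (lam * V y - V y powr (p - 1)))"
        using MVT2[OF x(1), of W "\<lambda>y. y ^ n * (lam * V y - V y powr (p - 1))"] dW r0 x \<delta> by force
      have "y ^ n * (lam * V y - V y powr (p - 1)) \<le> K * V y"
        using fK[of y] y x r0 \<delta> by auto
      also have "\<dots> \<le> K * V s" using s(2)[of y] y x K by (intro mult_left_mono) auto
      finally have "W x - W r0 \<le> (x - r0) * (K * V s)" unfolding y(3) using x by (intro mult_left_mono) auto
      also have "\<dots> \<le> \<delta> * (K * V s)" using x K Vs by (intro mult_right_mono) auto
      finally show ?thesis using W0 by simp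
    qed
    have "V s \<le> \<delta> * (\<delta> * (K * V s))"
    proof (cases "s = r0")
      case True
      then show ?thesis using V0 by simp
    next
      case False
      then have rs: "r0 < s" "s \<le> r0 + \<delta>" using s(1) by auto
      obtain x where x: "r0 < x" "x < s" "V s - V r0 = (s - r0) * (W x / x ^ n)"
        using MVT2[OF rs(1), of V "\<lambda>x. W x / x ^ n"] dV r0 rs \<delta> by force
      have nn: "0 \<le> \<delta> * (K * V s)" using \<delta> K Vs by simp
      have "1 \<le> x ^ n" using x r0 by simp
      have "W x / x ^ n \<le> \<delta> * (K * V s) / x ^ n"
        using W_bound[of x] x rs r0 by (intro divide_right_mono) auto
      also have "\<dots> \<le> \<delta> * (K * V s) / 1"
        using nn \<open>1 \<le> x ^ n\<close> by (intro divide_left_mono) auto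
      finally have "W x / x ^ n \<le> \<delta> * (K * V s)" by simp
      then have "(s - r0) * (W x / x ^ n) \<le> (s - r0) * (\<delta> * (K * V s))" using rs by (intro mult_left_mono) auto
      also have "\<dots> \<le> \<delta> * (\<delta> * (K * V s))" using rs nn by (intro mult_right_mono) auto
      finally show ?thesis using x(3) V0 by simp
    qed
    then have "V s * (1 - \<delta> * \<delta> * K) \<le> 0" by (simp add: algebra_simps)
    then have "V s \<le> 0" using \<open>\<delta> * \<delta> * K < 1\<close> by (simp add: mult_le_0_iff)
    moreover obtain r where "r0 < r" "r < r0 + \<delta>" "0 < V r"
      using dense[of r0 "r0 + \<delta>"] r0 \<delta> by auto
    ultimately show False using s(2)[of r] by simp
  qed
  have "profile n lam p V W"
    by unfold_locales (use p lam V pos dV dW cV cW in auto)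
  then show ?thesis by (rule that)
qed

text \<open>From here on \<open>u\<close> is seen only through \<open>profile.B\<close>. Positivity
  of \<open>u\<close> almost everywhere makes \<open>V\<close> positive at a dense set of radii, and
  continuity gives V \<ge> 0; strict positivity is left to the equation.\<close>

lemma profile_exists:
  fixes u :: "'a::euclidean_space \<Rightarrow> real"
  assumes p: "2 < p" and lam: "0 < lam" and sol: "pos_rad_solution lam p annulus u"
  obtains V W where "profile (DIM('a) - 1) lam p V W"
    "(LINT x:annulus|lborel. (u x)\<^sup>2) = sphere_area TYPE('a) * profile.B (DIM('a) - 1) V"
proof -
  define n where "n = DIM('a) - 1"
  obtain g where H: "H10_grad annulus u g" and radial: "radial_on annulus u"
    and u_pos: "AE x in lborel. x \<in> annulus \<longrightarrow> u x > 0"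
    and weak: "\<And>\<phi>. test_fun annulus \<phi> \<Longrightarrow> set_integrable lborel annulus (\<lambda>x. u x powr (p - 1) * \<phi> x) \<and>
          (LINT x:annulus|lborel. g x \<bullet> grad \<phi> x + lam * u x * \<phi> x) =
          (LINT x:annulus|lborel. u x powr (p - 1) * \<phi> x)"
    using sol unfolding pos_rad_solution_def by blast
  have u: "set_borel_measurable lborel annulus u" "set_integrable lborel annulus (\<lambda>x. (norm (u x))\<^sup>2)"
    and g: "set_borel_measurable lborel annulus g" "set_integrable lborel annulus (\<lambda>x. (norm (g x))\<^sup>2)"
    using H unfolding H10_grad_def H1_grad_def by auto
  obtain V where V: "continuous_on UNIV V" "V 1 = 0" "V 2 = 0"
    and uV: "AE x in lborel. x \<in> annulus \<longrightarrow> u x = V (norm x)"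
    and flux: "radial_flux g V"
    by (rule radial_representation[OF H radial]) blast
  have cV: "continuous_on A V" for A using V(1) continuous_on_subset by blast
  have V_pos_AE: "AE x in lborel. x \<in> annulus \<longrightarrow> 0 < V (norm (x::'a))"
    using uV u_pos by eventually_elim auto
  have dense: "\<exists>r. a < r \<and> r < b \<and> 0 < V r" if "1 \<le> a" "a < b" "b \<le> 2" for a b
  proof (rule ccontr)
    assume no: "\<nexists>r. a < r \<and> r < b \<and> 0 < V r"
    \<comment> \<open>An interval of radii with V \<le> 0 would give an open shell that almost every
      point avoids, hence an empty one.\<close>
    define S where "S = {x::'a. a < norm x} \<inter> {x. norm x < b}"
    have "open S" unfolding S_def by (intro open_Int open_Collect_less continuous_intros)
    moreover have "AE x in lborel. x \<notin> S"
      using V_pos_AE by eventually_elim (use no that in \<open>auto simp: S_def annulus_def\<close>)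
    ultimately have "S = {}" by (rule open_AE_notin_imp_empty)
    moreover have "0 \<le> (a + b) / 2" using that by simp
    then obtain x :: 'a where "norm x = (a + b) / 2" by (rule vector_choose_size)
    then have "x \<in> S" using that by (simp add: S_def)
    ultimately show False by blast
  qed
  have nonneg: "0 \<le> V r" if r: "r \<in> {1..2}" for r
  proof (rule ccontr)
    assume "\<not> 0 \<le> V r"
    then have neg: "V r < 0" by simp
    then have r': "1 < r" "r < 2" using r V by (auto simp: less_le)
    have "open (V -` {..<0} \<inter> {1<..<2})"
      by (intro open_Int open_vimage V) auto
    moreover have "r \<in> V -` {..<0} \<inter> {1<..<2}" using neg r' by simp
    ultimately obtain e where e: "e > 0" "ball r e \<subseteq> V -` {..<0} \<inter> {1<..<2}"
      by (rule openE)
    define d where "d = min (e / 2) (2 - r)"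
    have d: "d > 0" "d < e" "r + d \<le> 2" using e r' by (auto simp: d_def)
    obtain s where "r < s" "s < r + d" "0 < V s" using dense[of r "r + d"] r' d by auto
    moreover have "s \<in> ball r e" using calculation d by (simp add: dist_real_def)
    ultimately show False using e(2) by force
  qed
  obtain W where W: "profile n lam p V W"
    by (rule profile_of_continuous_weak_solution[OF p lam V dense nonneg
          weak_radial_equation[OF V(1) nonneg p uV flux
            set_integrable_of_square[OF u] set_integrable_of_square[OF g] weak n_def]])
  have "(LINT x:annulus|lborel. (u x)\<^sup>2) = (LINT x:annulus|lborel. (V (norm (x::'a)))\<^sup>2)"
    by (rule annulus_integral_cong_AE)
      (use u uV polar_continuous(1)[of "\<lambda>r. (V r)\<^sup>2", where 'a = 'a] in
        \<open>auto elim!: eventually_mono intro!: continuous_intros cV simp: set_integrable_def\<close>)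
  also have "\<dots> = sphere_area TYPE('a) * integral {1..2} (\<lambda>r. r ^ n * (V r)\<^sup>2)"
  proof -
    have "continuous_on {1..2} (\<lambda>r. (V r)\<^sup>2)" by (intro continuous_intros cV)
    from polar_continuous(2)[where 'a = 'a, OF this] show ?thesis
      by (simp add: set_lebesgue_integral_def n_def)
  qed
  also have "integral {1..2} (\<lambda>r. r ^ n * (V r)\<^sup>2) = profile.B n V"
    by (rule profile.B_def[OF W, symmetric])
  finally show ?thesis using that W unfolding n_def by blast
qed

section \<open>The three asymptotic regimes\<close>

theorem theorem2p7:
  fixes u :: "real \<Rightarrow> 'a::euclidean_space \<Rightarrow> real" and p :: real
  assumes N: "DIM('a) \<ge> 2"
    and p_gt: "2 < p"
    and p_crit: "DIM('a) = 2 \<or> p < 2 * real DIM('a) / (real DIM('a) - 2)"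
    and sol: "\<And>lam. lam > 0 \<Longrightarrow> pos_rad_solution lam p (annulus :: 'a set) (u lam)"
  shows "((DIM('a) = 2 \<and> p < 6) \<or> DIM('a) \<ge> 3 \<longrightarrow>
            filterlim (\<lambda>lam. LINT x:annulus|lborel. (u lam x)\<^sup>2) at_top at_top)
       \<and> (DIM('a) = 2 \<and> p = 6 \<longrightarrow>
            0 < Liminf at_top (\<lambda>lam. ereal (LINT x:annulus|lborel. (u lam x)\<^sup>2)) \<and>
            Liminf at_top (\<lambda>lam. ereal (LINT x:annulus|lborel. (u lam x)\<^sup>2)) < \<infinity>)
       \<and> (DIM('a) = 2 \<and> p > 6 \<longrightarrow>
            ((\<lambda>lam. LINT x:annulus|lborel. (u lam x)\<^sup>2) \<longlongrightarrow> 0) at_top)"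
proof -
  let ?c = "sphere_area TYPE('a)"
  define m where "m lam = (LINT x:annulus|lborel. (u lam x)\<^sup>2)" for lam
  have c: "?c > 0" by (rule sphere_area_pos)
  have lower: "?c / 2 * lam powr ((6 - p) / (2 * (p - 2))) \<le> m lam" if lam: "lam > 0" and p6: "p \<le> 6" for lam
  proof (rule profile_exists[OF p_gt lam sol[OF lam]])
    fix V W
    assume VW: "profile (DIM('a) - 1) lam p V W"
      "(LINT x:annulus|lborel. (u lam x)\<^sup>2) = ?c * profile.B (DIM('a) - 1) V"
    have "lam powr ((6 - p) / (2 * (p - 2))) \<le> 2 * profile.B (DIM('a) - 1) V"
      by (rule profile.mass_lower_bound[OF VW(1) p6])
    then have "?c / 2 * lam powr ((6 - p) / (2 * (p - 2))) \<le> ?c / 2 * (2 * profile.B (DIM('a) - 1) V)"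
      using c by (intro mult_left_mono) auto
    then show ?thesis using VW(2) by (simp add: m_def)
  qed
  obtain C \<Lambda> where "\<forall>n lam V W. planar_profile n lam p V W \<longrightarrow> \<Lambda> < lam \<longrightarrow>
      profile.B n V \<le> C * lam powr (p / (p - 2) - 3 / 2)"
    using planar_mass_upper_bound[OF p_gt] by (elim exE)
  then have C: "profile.B n V \<le> C * lam powr (p / (p - 2) - 3 / 2)"
    if "planar_profile n lam p V W" "\<Lambda> < lam" for n lam V W
    using that by blast
  have upper: "m lam \<le> ?c * C * lam powr (p / (p - 2) - 3 / 2)"
    if lam: "lam > 0" "\<Lambda> < lam" and dim: "DIM('a) = 2" for lam
  proof (rule profile_exists[OF p_gt lam(1) sol[OF lam(1)]])
    fix V W
    assume VW: "profile (DIM('a) - 1) lam p V W"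
      "(LINT x:annulus|lborel. (u lam x)\<^sup>2) = ?c * profile.B (DIM('a) - 1) V"
    have "planar_profile (DIM('a) - 1) lam p V W"
      using VW(1) dim by (simp add: planar_profile_def planar_profile_axioms_def)
    from C[OF this lam(2)] have "?c * profile.B (DIM('a) - 1) V \<le> ?c * (C * lam powr (p / (p - 2) - 3 / 2))"
      using c by (intro mult_left_mono) auto
    then show ?thesis using VW(2) by (simp only: mult.assoc m_def)
  qed
  have one: "filterlim m at_top at_top" if "(DIM('a) = 2 \<and> p < 6) \<or> DIM('a) \<ge> 3"
  proof -
    have p6: "p < 6"
    proof (cases "DIM('a) = 2")
      case False
      then have N3: "real DIM('a) \<ge> 3" using N by simp
      then have "p < 2 * real DIM('a) / (real DIM('a) - 2)" using p_crit False by blast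
      \<comment> \<open>2 N / (N - 2) decreases in N and equals 6 at N = 3, so the subcritical range
        lies below 6.\<close>
      also have "\<dots> \<le> 6" using N3 by (simp add: divide_le_eq)
      finally show ?thesis .
    qed (use that in auto)
    define s where "s = (6 - p) / (2 * (p - 2))"
    have s: "s > 0" using p6 p_gt by (simp add: s_def)
    have "filterlim (\<lambda>lam. exp (s * ln lam)) at_top at_top"
      by (intro filterlim_compose[OF exp_at_top] filterlim_tendsto_pos_mult_at_top[OF tendsto_const s] ln_at_top)
    moreover have "\<forall>\<^sub>F lam in at_top. exp (s * ln lam) = lam powr s"
      using eventually_gt_at_top[of 0] by eventually_elim (simp add: powr_def)
    ultimately have "filterlim (\<lambda>lam. lam powr s) at_top at_top"
      by (subst (asm) filterlim_cong[OF refl refl]) auto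
    then have lim: "filterlim (\<lambda>lam. ?c / 2 * lam powr s) at_top at_top"
      using c by (intro filterlim_tendsto_pos_mult_at_top[OF tendsto_const]) auto
    have "\<forall>\<^sub>F lam in at_top. ?c / 2 * lam powr s \<le> m lam"
      using eventually_gt_at_top[of 0]
      by eventually_elim (unfold s_def, rule lower, use p6 in auto)
    then show ?thesis by (rule filterlim_at_top_mono[OF lim])
  qed
  \<comment> \<open>At p = 6 both exponents are 0 and the two bounds become constants; finiteness of
    the lower limit is read off from the upper one.\<close>
  have two: "0 < Liminf at_top (\<lambda>lam. ereal (m lam)) \<and> Liminf at_top (\<lambda>lam. ereal (m lam)) < \<infinity>"
    if "DIM('a) = 2" "p = 6"
  proof
    have "\<forall>\<^sub>F lam in at_top. ereal (?c / 2) \<le> ereal (m lam)"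
      using eventually_gt_at_top[of 0]
    proof eventually_elim
      case (elim lam)
      then show ?case using lower[of lam] that by simp
    qed
    then have "ereal (?c / 2) \<le> Liminf at_top (\<lambda>lam. ereal (m lam))" by (rule Liminf_bounded)
    moreover have "0 < ereal (?c / 2)" using c by simp
    ultimately show "0 < Liminf at_top (\<lambda>lam. ereal (m lam))" by (rule less_le_trans[rotated])
    have "\<forall>\<^sub>F lam in at_top. ereal (m lam) \<le> ereal (?c * C)"
      using eventually_gt_at_top[of 0] eventually_gt_at_top[of \<Lambda>]
    proof eventually_elim
      case (elim lam)
      then show ?case using upper[of lam] that by simp
    qed
    then have "Limsup at_top (\<lambda>lam. ereal (m lam)) \<le> ereal (?c * C)" by (rule Limsup_bounded)
    with Liminf_le_Limsup have "Liminf at_top (\<lambda>lam. ereal (m lam)) \<le> ereal (?c * C)"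
      by (rule order_trans) simp
    then show "Liminf at_top (\<lambda>lam. ereal (m lam)) < \<infinity>" by (rule le_less_trans) simp
  qed
  have three: "(m \<longlongrightarrow> 0) at_top" if "DIM('a) = 2" "p > 6"
  proof -
    \<comment> \<open>The exponent equals (6 - p) / (2 (p - 2)), the one of the lower bound, and is
      negative for p > 6.\<close>
    have e: "p / (p - 2) - 3 / 2 < 0" using that p_gt by (simp add: field_simps)
    show ?thesis
    proof (rule tendsto_sandwich)
      show "\<forall>\<^sub>F lam in at_top. 0 \<le> m lam"
        by (intro always_eventually allI)
          (simp add: m_def set_lebesgue_integral_def)
      show "\<forall>\<^sub>F lam in at_top. m lam \<le> ?c * C * lam powr (p / (p - 2) - 3 / 2)"
        using eventually_gt_at_top[of 0] eventually_gt_at_top[of \<Lambda>]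
        by eventually_elim (use upper that in auto)
      have "((\<lambda>lam. ?c * C * lam powr (p / (p - 2) - 3 / 2)) \<longlongrightarrow> ?c * C * 0) at_top"
        by (intro tendsto_mult tendsto_const tendsto_neg_powr[OF e] filterlim_ident)
      then show "((\<lambda>lam. ?c * C * lam powr (p / (p - 2) - 3 / 2)) \<longlongrightarrow> 0) at_top" by simp
    qed simp
  qed
  show ?thesis using one two three unfolding m_def by blast
qed

end
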